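(* Let $R$ be a Noetherian local ring with maximal ideal $\mathfrak m$, let $M$ be a non-zero finitely generated $R$-module of dimension $d$, and let $(x_1,\dots,x_r)$ be part of a system of parameters of $M$, where $0\le r<d$. Then the following conditions are equivalent: (i) $(x_1,\dots,x_r)$ is part of a reducing system of parameters of $M$. (ii) $M_P$ is an $r$-dimensional Cohen--Macaulay module over $R_P$ for all $P\in\operatorname{Supp} M\cap V(x_1,\dots,x_r)$ satisfying $\dim R/P=\dim M-r$. (iii) There is a part $(y_1,\dots,y_r)$ of a reducing system of parameters of $M$ such that $(y_1,\dots,y_r)M=(x_1,\dots,x_r)M$. (iv) There is a part $(y_1,\dots,y_r)$ of a reducing system of parameters of $M$ such that $\operatorname{Supp} M\cap V(x_1,\dots,x_r)\subseteq V(y_1,\dots,y_r)$.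
   Context: For a subset $X\subseteq R$, $V(X)$ denotes the set of prime ideals of $R$ containing $X$. A system of parameters of $M$ (with $d=\dim M$) is a sequence $(x_1,\dots,x_d)$ of elements of $\mathfrak m$ such that $M/(x_1,\dots,x_d)M$ has finite length. A system of parameters $(x_1,\dots,x_d)$ of $M$ is called reducing if for all $i=1,\dots,d-1$ one has $x_i\notin P$ for every $P\in\operatorname{Ass} M/(x_1,\dots,x_{i-1})M$ with $\dim R/P=d-i$. A sequence $(x_1,\dots,x_r)$ of elements of $\mathfrak m$ is called part of a (reducing) system of parameters of $M$ if there are $x_{r+1},\dots,x_d\in\mathfrak m$ such that $(x_1,\dots,x_r,x_{r+1},\dots,x_d)$ is a (reducing) system of parameters of $M$ (in this order). A module is Cohen--Macaulay if its depth equals its dimension. *)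

theory Defs
  imports "HOL-Library.Extended_Nat" "HOL-Algebra.Module" "HOL-Algebra.Ring_Divisibility"
begin

section \<open>Local rings, submodules and quotient modules\<close>

locale local_ring = cring R for R (structure) +
  fixes \<mm>
  assumes maximal: "maximalideal \<mm> R"
    and maximal_unique: "maximalideal J R \<Longrightarrow> J = \<mm>"

definition submodule_gen ::
  "('a, 'e) ring_scheme \<Rightarrow> ('a, 'b, 'f) module_scheme \<Rightarrow> 'b set \<Rightarrow> 'b set"
  where "submodule_gen R M A = \<Inter> {N. submodule N R M \<and> A \<subseteq> N}"

definition finitely_generated ::
  "('a, 'e) ring_scheme \<Rightarrow> ('a, 'b, 'f) module_scheme \<Rightarrow> bool"
  where "finitely_generated R M \<longleftrightarrow>
    (\<exists>A \<subseteq> carrier M. finite A \<and> submodule_gen R M A = carrier M)"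

definition ideal_smult ::
  "('a, 'e) ring_scheme \<Rightarrow> ('a, 'b, 'f) module_scheme \<Rightarrow> 'a set \<Rightarrow> 'b set"
  where "ideal_smult R M I = submodule_gen R M {a \<odot>\<^bsub>M\<^esub> x | a x. a \<in> I \<and> x \<in> carrier M}"

text \<open>The type of modules extends that of rings; the fields \<open>mult\<close> and \<open>one\<close> of a module
  carry no information, and are left unspecified in the constructions below.\<close>

definition quot_module ::
  "('a, 'e) ring_scheme \<Rightarrow> ('a, 'b, 'f) module_scheme \<Rightarrow> 'b set \<Rightarrow> ('a, 'b set) module"
  where "quot_module R M N =
    \<lparr>carrier = a_rcosets\<^bsub>M\<^esub> N, mult = undefined, one = undefined,
     zero = N, add = set_add M,
     smult = (\<lambda>a A. \<Union>x\<in>A. N +>\<^bsub>M\<^esub> (a \<odot>\<^bsub>M\<^esub> x))\<rparr>"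

text \<open>\<open>M/(x\<^sub>1, \<dots>, x\<^sub>k)M\<close>\<close>

abbreviation quot_seq ::
  "('a, 'e) ring_scheme \<Rightarrow> ('a, 'b, 'f) module_scheme \<Rightarrow> 'a list \<Rightarrow> ('a, 'b set) module"
  where "quot_seq R M xs \<equiv> quot_module R M (ideal_smult R M (Idl\<^bsub>R\<^esub> (set xs)))"


section \<open>Localization\<close>

text \<open>\<open>frac R M S x s\<close> is the fraction \<open>x/s\<close>: the class of \<open>(x, s)\<close> under
  \<open>(x, s) \<sim> (y, t) \<longleftrightarrow> (\<exists>u \<in> S. u(tx) = u(sy))\<close>.\<close>

definition frac ::
  "('a, 'e) ring_scheme \<Rightarrow> ('a, 'b, 'f) module_scheme \<Rightarrow> 'a set \<Rightarrow> 'b \<Rightarrow> 'a \<Rightarrow> ('b \<times> 'a) set"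
  where "frac R M S x s = {(y, t). y \<in> carrier M \<and> t \<in> S \<and>
    (\<exists>u\<in>S. u \<odot>\<^bsub>M\<^esub> (t \<odot>\<^bsub>M\<^esub> x) = u \<odot>\<^bsub>M\<^esub> (s \<odot>\<^bsub>M\<^esub> y))}"

definition loc_module ::
  "('a, 'e) ring_scheme \<Rightarrow> ('a, 'b, 'f) module_scheme \<Rightarrow> 'a set \<Rightarrow>
    (('a \<times> 'a) set, ('b \<times> 'a) set) module"
  where "loc_module R M S =
    \<lparr>carrier = {frac R M S x s | x s. x \<in> carrier M \<and> s \<in> S},
     mult = undefined, one = undefined,
     zero = frac R M S \<zero>\<^bsub>M\<^esub> \<one>\<^bsub>R\<^esub>,
     add = (\<lambda>A B. \<Union>(x, s)\<in>A. \<Union>(y, t)\<in>B.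
       frac R M S (t \<odot>\<^bsub>M\<^esub> x \<oplus>\<^bsub>M\<^esub> s \<odot>\<^bsub>M\<^esub> y) (s \<otimes>\<^bsub>R\<^esub> t)),
     smult = (\<lambda>A B. \<Union>(a, s)\<in>A. \<Union>(y, t)\<in>B. frac R M S (a \<odot>\<^bsub>M\<^esub> y) (s \<otimes>\<^bsub>R\<^esub> t))\<rparr>"

definition self_module :: "('a, 'e) ring_scheme \<Rightarrow> ('a, 'a) module"
  where "self_module R =
    \<lparr>carrier = carrier R, mult = mult R, one = \<one>\<^bsub>R\<^esub>, zero = \<zero>\<^bsub>R\<^esub>, add = add R, smult = mult R\<rparr>"

definition loc_ring :: "('a, 'e) ring_scheme \<Rightarrow> 'a set \<Rightarrow> ('a \<times> 'a) set ring"
  where "loc_ring R S =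
    (let L = loc_module R (self_module R) S in
    \<lparr>carrier = carrier L, mult = smult L, one = frac R (self_module R) S \<one>\<^bsub>R\<^esub> \<one>\<^bsub>R\<^esub>,
     zero = zero L, add = add L\<rparr>)"

text \<open>\<open>R\<^sub>P\<close>, its maximal ideal \<open>PR\<^sub>P\<close>, and \<open>M\<^sub>P\<close>\<close>

abbreviation ring_at :: "('a, 'e) ring_scheme \<Rightarrow> 'a set \<Rightarrow> ('a \<times> 'a) set ring"
  where "ring_at R P \<equiv> loc_ring R (carrier R - P)"

definition ideal_at :: "('a, 'e) ring_scheme \<Rightarrow> 'a set \<Rightarrow> ('a \<times> 'a) set set"
  where "ideal_at R P =
    {frac R (self_module R) (carrier R - P) a s | a s. a \<in> P \<and> s \<in> carrier R - P}"

abbreviation module_at ::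
  "('a, 'e) ring_scheme \<Rightarrow> ('a, 'b, 'f) module_scheme \<Rightarrow> 'a set \<Rightarrow>
    (('a \<times> 'a) set, ('b \<times> 'a) set) module"
  where "module_at R M P \<equiv> loc_module R M (carrier R - P)"


section \<open>Support, associated primes, dimension, length\<close>

definition V :: "('a, 'e) ring_scheme \<Rightarrow> 'a set \<Rightarrow> 'a set set"
  where "V R A = {P. primeideal P R \<and> A \<subseteq> P}"

definition Supp :: "('a, 'e) ring_scheme \<Rightarrow> ('a, 'b, 'f) module_scheme \<Rightarrow> 'a set set"
  where "Supp R M = {P. primeideal P R \<and> carrier (module_at R M P) \<noteq> {\<zero>\<^bsub>module_at R M P\<^esub>}}"

definition Ass :: "('a, 'e) ring_scheme \<Rightarrow> ('a, 'b, 'f) module_scheme \<Rightarrow> 'a set set"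
  where "Ass R M = {P. primeideal P R \<and>
    (\<exists>x\<in>carrier M. P = {a \<in> carrier R. a \<odot>\<^bsub>M\<^esub> x = \<zero>\<^bsub>M\<^esub>})}"

definition annihilator :: "('a, 'e) ring_scheme \<Rightarrow> ('a, 'b, 'f) module_scheme \<Rightarrow> 'a set"
  where "annihilator R M = {a \<in> carrier R. \<forall>x\<in>carrier M. a \<odot>\<^bsub>M\<^esub> x = \<zero>\<^bsub>M\<^esub>}"

text \<open>As \<^term>\<open>Sup {} = (0::enat)\<close>, the zero ring and the zero module get dimension \<open>0\<close>
  here, rather than \<open>-1\<close> or \<open>-\<infinity>\<close>; dimensions are only used for non-zero objects.\<close>

definition krull_dim :: "('a, 'e) ring_scheme \<Rightarrow> enat"
  where "krull_dim R = Sup {enat n | n. \<exists>P :: nat \<Rightarrow> 'a set.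
    (\<forall>i\<le>n. primeideal (P i) R) \<and> (\<forall>i<n. P i \<subset> P (Suc i))}"

definition module_dim :: "('a, 'e) ring_scheme \<Rightarrow> ('a, 'b, 'f) module_scheme \<Rightarrow> enat"
  where "module_dim R M = krull_dim (R Quot (annihilator R M))"

definition module_length :: "('a, 'e) ring_scheme \<Rightarrow> ('a, 'b, 'f) module_scheme \<Rightarrow> enat"
  where "module_length R M = Sup {enat n | n. \<exists>N :: nat \<Rightarrow> 'b set.
    (\<forall>i\<le>n. submodule (N i) R M) \<and> (\<forall>i<n. N i \<subset> N (Suc i))}"


section \<open>Depth and Cohen--Macaulay modules\<close>

definition nonzerodivisor_on ::
  "('a, 'b, 'f) module_scheme \<Rightarrow> 'a \<Rightarrow> bool"
  where "nonzerodivisor_on M a \<longleftrightarrow> (\<forall>x\<in>carrier M. a \<odot>\<^bsub>M\<^esub> x = \<zero>\<^bsub>M\<^esub> \<longrightarrow> x = \<zero>\<^bsub>M\<^esub>)"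

definition regular_sequence ::
  "('a, 'e) ring_scheme \<Rightarrow> ('a, 'b, 'f) module_scheme \<Rightarrow> 'a list \<Rightarrow> bool"
  where "regular_sequence R M xs \<longleftrightarrow>
    set xs \<subseteq> carrier R \<and>
    (\<forall>i<length xs. nonzerodivisor_on (quot_seq R M (take i xs)) (xs ! i)) \<and>
    carrier (quot_seq R M xs) \<noteq> {\<zero>\<^bsub>quot_seq R M xs\<^esub>}"

text \<open>Here and below, \<open>\<mm>\<close> is meant to be the maximal ideal of the local
  ring \<open>R\<close>.\<close>

definition depth ::
  "('a, 'e) ring_scheme \<Rightarrow> 'a set \<Rightarrow> ('a, 'b, 'f) module_scheme \<Rightarrow> enat"
  where "depth R \<mm> M = Sup {enat (length xs) | xs. set xs \<subseteq> \<mm> \<and> regular_sequence R M xs}"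

definition cohen_macaulay ::
  "('a, 'e) ring_scheme \<Rightarrow> 'a set \<Rightarrow> ('a, 'b, 'f) module_scheme \<Rightarrow> bool"
  where "cohen_macaulay R \<mm> M \<longleftrightarrow> depth R \<mm> M = module_dim R M"


section \<open>Systems of parameters\<close>

definition sop ::
  "('a, 'e) ring_scheme \<Rightarrow> 'a set \<Rightarrow> ('a, 'b, 'f) module_scheme \<Rightarrow> 'a list \<Rightarrow> bool"
  where "sop R \<mm> M xs \<longleftrightarrow>
    enat (length xs) = module_dim R M \<and> set xs \<subseteq> \<mm> \<and> module_length R (quot_seq R M xs) < \<infinity>"

text \<open>Lists are indexed from \<open>0\<close>, so \<open>x\<^sub>i\<close> is \<open>xs ! (i - 1)\<close>.\<close>

definition reducing_sop ::
  "('a, 'e) ring_scheme \<Rightarrow> 'a set \<Rightarrow> ('a, 'b, 'f) module_scheme \<Rightarrow> 'a list \<Rightarrow> bool"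
  where "reducing_sop R \<mm> M xs \<longleftrightarrow>
    sop R \<mm> M xs \<and>
    (\<forall>i\<in>{1..<length xs}. \<forall>P\<in>Ass R (quot_seq R M (take (i - 1) xs)).
      krull_dim (R Quot P) = enat (length xs - i) \<longrightarrow> xs ! (i - 1) \<notin> P)"

definition part_of_sop ::
  "('a, 'e) ring_scheme \<Rightarrow> 'a set \<Rightarrow> ('a, 'b, 'f) module_scheme \<Rightarrow> 'a list \<Rightarrow> bool"
  where "part_of_sop R \<mm> M xs \<longleftrightarrow> (\<exists>zs. sop R \<mm> M (xs @ zs))"

definition part_of_reducing_sop ::
  "('a, 'e) ring_scheme \<Rightarrow> 'a set \<Rightarrow> ('a, 'b, 'f) module_scheme \<Rightarrow> 'a list \<Rightarrow> bool"
  where "part_of_reducing_sop R \<mm> M xs \<longleftrightarrow> (\<exists>zs. reducing_sop R \<mm> M (xs @ zs))"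

end

theory Submission
  imports Defs
begin

text \<open>
  Fix a prime \<open>P\<close> in the support of \<open>M/xM\<close> with \<open>dim R/P = d - r\<close>; condition (ii) says that \<open>x\<close> is an
  \<open>M\<^sub>P\<close>-regular sequence for all such \<open>P\<close>, because a system of parameters of a Cohen--Macaulay
  module is a regular sequence and conversely a regular sequence of length \<open>r\<close> forces
  \<open>depth M\<^sub>P = dim M\<^sub>P = r\<close>.

  If \<open>x\<close> is reducing, it is \<open>M\<^sub>P\<close>-regular by descending induction on \<open>i\<close>: let
  \<open>N = M/(x\<^sub>1, \<dots>, x\<^bsub>i-1\<^esub>)M\<close> and suppose that \<open>x\<^bsub>i+1\<^esub>, \<dots>, x\<^sub>r\<close> is regular on \<open>(N/x\<^sub>iN)\<^sub>P\<close>. The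
  \<open>x\<^sub>i\<close>-torsion \<open>T\<close> of \<open>N\<close> embeds modulo \<open>x\<^sub>i\<close> into \<open>N/x\<^sub>iN\<close>, whose associated primes below \<open>P\<close> have
  distance at least \<open>r - i\<close> from \<open>P\<close>. So if \<open>T\<^sub>P\<close> is non-zero, it has an associated prime \<open>Q\<close> with
  \<open>dim R/Q \<ge> d - i\<close>, which contains \<open>x\<^sub>i\<close>, and this is what the reducing condition excludes.
  Conversely, a prime \<open>Q\<close> violating that condition at step \<open>i\<close> lies, by Krull's principal ideal theorem
  applied to \<open>x\<^bsub>i+1\<^esub>, \<dots>, x\<^sub>r\<close>, below some \<open>P\<close> as above, where \<open>x\<^sub>i\<close> is then not regular.

  Since (ii) depends on \<open>x\<close> only through the set of primes \<open>P\<close>, (iv) for \<open>y\<close> implies (ii) for \<open>x\<close>.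
\<close>

section \<open>Submodules and colon ideals\<close>

text \<open>Quotients and localizations of \<open>M\<close> are replaced by submodules of the fixed
  module \<open>M\<close>: \<open>N\<close> stands for \<open>M/N\<close>, and
  \<open>sat P N\<close> records what vanishes in \<open>(M/N)_P\<close>. A quotient module has
  elements of another type, so an induction passing from \<open>M\<close> to \<open>M/xM\<close> is
  awkward on the quotients themselves; on submodules it only enlarges \<open>N\<close>. Dimensions
  are likewise read as lengths of strict chains of primes ending in \<open>P\<close> or in the
  maximal ideal.

  The obstacle is the regularity of a system of parameters on a Cohen--Macaulay module: depth only
  provides some regular sequence of the right length. It is traded for the given one element by
  element, which rests on comparing the socles of \<open>M/xM\<close> and \<open>M/yM\<close>, not
  on homological invariance of depth.

  The condition \<open>dim R/P = d - r\<close> bounds \<open>dim M_P\<close> by \<open>r\<close>: a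
  chain ending in \<open>P\<close> is prolonged by \<open>d - r\<close> steps to the maximal ideal.
  The bound \<open>r < d\<close> puts all \<open>r\<close> elements in the range of the reducing
  condition, which does not constrain the last element of a system. Finally, (iii) implies (iv)
  because the support of \<open>M/xM\<close> depends only on the submodule
  \<open>xM\<close>.\<close>

lemma (in noetherian_ring) ideal_family_maximal:
  assumes "F \<noteq> {}" and "\<And>I. I \<in> F \<Longrightarrow> ideal I R"
  shows "\<exists>I\<in>F. \<forall>J\<in>F. I \<subseteq> J \<longrightarrow> J = I"
proof (rule subset_Zorn_nonempty[OF assms(1)])
  fix C assume C: "C \<noteq> {}" "subset.chain F C"
  then have "subset.chain {I. ideal I R} C"
    using assms(2) by (auto simp: subset_chain_def)
  then have "\<Union>C \<in> C" using ideal_chain_is_trivial C(1) by blast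
  then show "\<Union>C \<in> F" using C(2) by (auto simp: subset_chain_def)
qed

lemma prime_compl:
  assumes "primeideal P R"
  shows "\<one>\<^bsub>R\<^esub> \<in> carrier R - P"
    and "s \<in> carrier R - P \<Longrightarrow> t \<in> carrier R - P \<Longrightarrow> s \<otimes>\<^bsub>R\<^esub> t \<in> carrier R - P"
proof -
  interpret primeideal P R by fact
  show "\<one>\<^bsub>R\<^esub> \<in> carrier R - P" using one_imp_carrier I_notcarr by blast
  show "s \<otimes>\<^bsub>R\<^esub> t \<in> carrier R - P" if "s \<in> carrier R - P" "t \<in> carrier R - P"
    using that I_prime by auto
qed

lemma prime_subset: "primeideal P R \<Longrightarrow> P \<subseteq> carrier R"
  by (rule additive_subgroup.a_subset[OF ideal.axioms(1)[OF primeideal.axioms(1)]])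

lemma prime_absorb:
  assumes "primeideal P R" "a \<in> P" "b \<in> carrier R"
  shows "a \<otimes>\<^bsub>R\<^esub> b \<in> P" "b \<otimes>\<^bsub>R\<^esub> a \<in> P"
  using assms primeideal.axioms(1)[OF assms(1)] by (auto simp: ideal.I_l_closed ideal.I_r_closed)

lemma prime_add:
  assumes "primeideal P R" "a \<in> P" "b \<in> P"
  shows "a \<oplus>\<^bsub>R\<^esub> b \<in> P"
  using assms primeideal.axioms(1)[OF assms(1)]
  by (simp add: additive_subgroup.a_closed ideal.axioms(1))

lemma prime_mult_cancel:
  assumes "primeideal P R" "s \<otimes>\<^bsub>R\<^esub> a \<in> P" "s \<in> carrier R - P" "a \<in> carrier R"
  shows "a \<in> P"
  using assms primeideal.I_prime by fastforce

context module
begin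

abbreviation smult_M (infixl "\<cdot>" 70) where "a \<cdot> x \<equiv> a \<odot>\<^bsub>M\<^esub> x"
abbreviation "S0 \<equiv> {\<zero>\<^bsub>M\<^esub>}"

lemma submodule_carr: "submodule N R M \<Longrightarrow> y \<in> N \<Longrightarrow> y \<in> carrier M"
  using submoduleE(1) by blast

lemma submodule_zero: "submodule N R M \<Longrightarrow> \<zero>\<^bsub>M\<^esub> \<in> N"
  using subgroup.one_closed[OF submodule.axioms(1), of N R M] by simp

lemma submodule_diff:
  "submodule N R M \<Longrightarrow> p \<in> N \<Longrightarrow> q \<in> N \<Longrightarrow> p \<ominus>\<^bsub>M\<^esub> q \<in> N"
  unfolding M.minus_eq using submoduleE(3,5) by blast

lemma submodule_of_closed:
  assumes "H \<subseteq> carrier M" "\<zero>\<^bsub>M\<^esub> \<in> H" "\<And>a b. a \<in> H \<Longrightarrow> b \<in> H \<Longrightarrow> a \<oplus>\<^bsub>M\<^esub> b \<in> H"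
    "\<And>a x. a \<in> carrier R \<Longrightarrow> x \<in> H \<Longrightarrow> a \<cdot> x \<in> H"
  shows "submodule H R M"
proof (rule submoduleI)
  show "\<ominus>\<^bsub>M\<^esub> a \<in> H" if "a \<in> H" for a
    using assms(4)[of "\<ominus> \<one>" a] that smult_l_minus[of \<one> a] subsetD[OF assms(1) that] by simp
qed (use assms in auto)

lemma submodule_int:
  assumes "submodule N R M" "submodule L R M" shows "submodule (N \<inter> L) R M"
  by (rule submoduleI)
    (simp_all add: assms[THEN submoduleE(3)] assms[THEN submoduleE(4)] assms[THEN submoduleE(5)]
      assms[THEN submodule_zero] le_infI1 assms(1)[THEN submoduleE(1)])

lemma submodule_zeroset: "submodule S0 R M"
  by (rule submoduleI) simp_all

text \<open>Plays the role of equality in \<open>M/N\<close>. The carrier conditions are built in,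
  so that a congruence brings the membership facts of both sides with it.\<close>

definition cng :: "'c set \<Rightarrow> 'c \<Rightarrow> 'c \<Rightarrow> bool"
  where "cng N p q \<longleftrightarrow> p \<in> carrier M \<and> q \<in> carrier M \<and> p \<ominus>\<^bsub>M\<^esub> q \<in> N"

lemma cng_carr: "cng N p q \<Longrightarrow> p \<in> carrier M" "cng N p q \<Longrightarrow> q \<in> carrier M"
  by (auto simp: cng_def)

lemma cng_refl: "submodule N R M \<Longrightarrow> p \<in> carrier M \<Longrightarrow> cng N p p"
  by (auto simp: cng_def M.minus_eq M.r_neg submodule_zero)

lemma cng_sym: assumes N: "submodule N R M" and "cng N p q" shows "cng N q p"
proof -
  have "q \<ominus>\<^bsub>M\<^esub> p = \<ominus>\<^bsub>M\<^esub> (p \<ominus>\<^bsub>M\<^esub> q)"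
    using assms(2) by (simp add: cng_def M.minus_eq M.minus_add M.a_comm)
  then show ?thesis using assms submoduleE(3) by (auto simp: cng_def)
qed

lemma cng_trans:
  assumes N: "submodule N R M" and "cng N p q" "cng N q t" shows "cng N p t"
proof -
  have "p \<ominus>\<^bsub>M\<^esub> t = (p \<ominus>\<^bsub>M\<^esub> q) \<oplus>\<^bsub>M\<^esub> (q \<ominus>\<^bsub>M\<^esub> t)"
    using assms(2,3) by (simp add: cng_def M.minus_eq M.a_assoc M.r_neg1)
  then show ?thesis using assms submoduleE(5) by (auto simp: cng_def)
qed

lemma cng_smult:
  assumes N: "submodule N R M" and "cng N p q" "a \<in> carrier R"
  shows "cng N (a \<cdot> p) (a \<cdot> q)"
proof -
  have "a \<cdot> p \<ominus>\<^bsub>M\<^esub> a \<cdot> q = a \<cdot> (p \<ominus>\<^bsub>M\<^esub> q)"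
    using assms(2,3) by (simp add: cng_def M.minus_eq smult_r_distr smult_r_minus)
  then show ?thesis using assms submoduleE(4) by (auto simp: cng_def)
qed

lemma cng_add:
  assumes N: "submodule N R M" and "cng N p q" "cng N p' q'"
  shows "cng N (p \<oplus>\<^bsub>M\<^esub> p') (q \<oplus>\<^bsub>M\<^esub> q')"
proof -
  have "(p \<oplus>\<^bsub>M\<^esub> p') \<ominus>\<^bsub>M\<^esub> (q \<oplus>\<^bsub>M\<^esub> q') = (p \<ominus>\<^bsub>M\<^esub> q) \<oplus>\<^bsub>M\<^esub> (p' \<ominus>\<^bsub>M\<^esub> q')"
    using assms(2,3) by (simp add: cng_def M.minus_eq M.minus_add M.a_ac)
  then show ?thesis using assms submoduleE(5) by (auto simp: cng_def)
qed

lemma cng_minus: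
  assumes N: "submodule N R M" and "cng N p q"
  shows "cng N (\<ominus>\<^bsub>M\<^esub> p) (\<ominus>\<^bsub>M\<^esub> q)"
proof -
  have "(\<ominus>\<^bsub>M\<^esub> p) \<ominus>\<^bsub>M\<^esub> (\<ominus>\<^bsub>M\<^esub> q) = \<ominus>\<^bsub>M\<^esub> (p \<ominus>\<^bsub>M\<^esub> q)"
    using assms(2) by (simp add: cng_def M.minus_eq M.minus_add)
  then show ?thesis using assms submoduleE(3) by (auto simp: cng_def)
qed

lemma cng_zero_iff:
  assumes N: "submodule N R M" shows "cng N p \<zero>\<^bsub>M\<^esub> \<longleftrightarrow> p \<in> N"
proof -
  have "p \<ominus>\<^bsub>M\<^esub> \<zero>\<^bsub>M\<^esub> = p" if "p \<in> carrier M" using that by (simp add: M.minus_eq)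
  then show ?thesis using submodule_carr[OF N] by (auto simp: cng_def)
qed

lemma cng_mem:
  assumes N: "submodule N R M" and "cng N p q" shows "p \<in> N \<longleftrightarrow> q \<in> N"
  using assms cng_zero_iff cng_trans cng_sym by blast

lemma cng_mono: "cng N p q \<Longrightarrow> N \<subseteq> L \<Longrightarrow> cng L p q"
  by (auto simp: cng_def)

lemma smult_comm:
  "\<lbrakk>a \<in> carrier R; b \<in> carrier R; x \<in> carrier M\<rbrakk> \<Longrightarrow>
    a \<cdot> (b \<cdot> x) = b \<cdot> (a \<cdot> x)"
  by (metis R.m_comm smult_assoc1)

lemma smult_minus:
  "\<lbrakk>a \<in> carrier R; x \<in> carrier M; y \<in> carrier M\<rbrakk> \<Longrightarrow>
    a \<cdot> (x \<ominus>\<^bsub>M\<^esub> y) = a \<cdot> x \<ominus>\<^bsub>M\<^esub> a \<cdot> y"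
  by (simp add: M.minus_eq smult_r_distr smult_r_minus)

text \<open>A quotient \<open>M/N\<close> is represented by the submodule \<open>N\<close>: \<open>adj N K y\<close> is \<open>N + Ky\<close>,
  \<open>addm N x L\<close> is \<open>N + xL\<close>, \<open>sat P N\<close> is the kernel of \<open>M \<rightarrow> (M/N)\<^sub>P\<close>, \<open>ass N\<close> is
  \<open>Ass (M/N)\<close>, and \<open>reg P N x\<close> says that \<open>x\<close> is a nonzerodivisor on \<open>(M/N)\<^sub>P\<close>.\<close>

definition adj :: "'c set \<Rightarrow> 'a set \<Rightarrow> 'c \<Rightarrow> 'c set"
  where "adj N K y = {w. \<exists>c\<in>K. cng N w (c \<cdot> y)}"

definition addm :: "'c set \<Rightarrow> 'a \<Rightarrow> 'c set \<Rightarrow> 'c set"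
  where "addm N x L = {w. \<exists>v\<in>L. cng N w (x \<cdot> v)}"

text \<open>The annihilator of the class of \<open>y\<close> in \<open>M/N\<close>. Associated
  primes and vanishing at a prime are both read off from it.\<close>

definition col :: "'c set \<Rightarrow> 'c \<Rightarrow> 'a set"
  where "col N y = {a \<in> carrier R. a \<cdot> y \<in> N}"

definition sat :: "'a set \<Rightarrow> 'c set \<Rightarrow> 'c set"
  where "sat P N = {y \<in> carrier M. \<exists>s\<in>carrier R - P. s \<cdot> y \<in> N}"

definition ass :: "'c set \<Rightarrow> 'a set set"
  where "ass N = {Q. primeideal Q R \<and> (\<exists>y\<in>carrier M. Q = col N y)}"

definition reg :: "'a set \<Rightarrow> 'c set \<Rightarrow> 'a \<Rightarrow> bool"
  where "reg P N x \<longleftrightarrow> (\<forall>w\<in>carrier M. x \<cdot> w \<in> sat P N \<longrightarrow> w \<in> sat P N)"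

lemma adj_submodule:
  assumes N: "submodule N R M" and y: "y \<in> carrier M" and K: "ideal K R"
  shows "submodule (adj N K y) R M"
proof -
  interpret K: ideal K R by fact
  show ?thesis
  proof (rule submodule_of_closed)
    show "adj N K y \<subseteq> carrier M" by (auto simp: adj_def cng_def)
    have "cng N \<zero>\<^bsub>M\<^esub> (\<zero> \<cdot> y)" using y cng_refl[OF N] by simp
    then show "\<zero>\<^bsub>M\<^esub> \<in> adj N K y" using K.zero_closed by (auto simp: adj_def)
    show "a \<oplus>\<^bsub>M\<^esub> b \<in> adj N K y" if "a \<in> adj N K y" "b \<in> adj N K y" for a b
    proof -
      from that obtain c d where c: "c \<in> K" "cng N a (c \<cdot> y)" "d \<in> K" "cng N b (d \<cdot> y)"
        by (auto simp: adj_def)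
      then have "cng N (a \<oplus>\<^bsub>M\<^esub> b) ((c \<oplus> d) \<cdot> y)"
        using cng_add[OF N c(2,4)] y K.Icarr by (simp add: smult_l_distr)
      then show ?thesis using c by (auto simp: adj_def)
    qed
    show "a \<cdot> x \<in> adj N K y" if "a \<in> carrier R" "x \<in> adj N K y" for a x
    proof -
      from that obtain c where c: "c \<in> K" "cng N x (c \<cdot> y)" by (auto simp: adj_def)
      then have "cng N (a \<cdot> x) ((a \<otimes> c) \<cdot> y)"
        using cng_smult[OF N c(2)] that y K.Icarr by (simp add: smult_assoc1)
      then show ?thesis using c that K.I_l_closed by (auto simp: adj_def)
    qed
  qed
qed

lemma adj_sup:
  assumes N: "submodule N R M" and y: "y \<in> carrier M" and K: "ideal K R"
  shows "N \<subseteq> adj N K y" "c \<in> K \<Longrightarrow> c \<cdot> y \<in> adj N K y"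
proof -
  interpret K: ideal K R by fact
  show "N \<subseteq> adj N K y"
  proof
    fix n assume n: "n \<in> N"
    then have "cng N n (\<zero> \<cdot> y)" using y cng_zero_iff[OF N] by simp
    then show "n \<in> adj N K y" using K.zero_closed by (auto simp: adj_def)
  qed
  show "c \<cdot> y \<in> adj N K y" if "c \<in> K"
    using that cng_refl[OF N, of "c \<cdot> y"] K.Icarr[OF that] y by (auto simp: adj_def)
qed

lemma adj_R_gen:
  assumes "submodule N R M" "y \<in> carrier M"
  shows "submodule (adj N (carrier R) y) R M" "N \<subseteq> adj N (carrier R) y" "y \<in> adj N (carrier R) y"
  using adj_submodule[OF assms R.oneideal] adj_sup(1)[OF assms R.oneideal]
    adj_sup(2)[OF assms R.oneideal R.one_closed] assms(2) by simp_all

lemma addm_submodule: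
  assumes N: "submodule N R M" and x: "x \<in> carrier R" and L: "submodule L R M"
  shows "submodule (addm N x L) R M"
proof (rule submodule_of_closed)
  note Lc = submodule_carr[OF L]
  show "addm N x L \<subseteq> carrier M" by (auto simp: addm_def cng_def)
  have "cng N \<zero>\<^bsub>M\<^esub> (x \<cdot> \<zero>\<^bsub>M\<^esub>)" using x cng_refl[OF N] by simp
  then show "\<zero>\<^bsub>M\<^esub> \<in> addm N x L" using submodule_zero[OF L] by (auto simp: addm_def)
  show "a \<oplus>\<^bsub>M\<^esub> b \<in> addm N x L" if "a \<in> addm N x L" "b \<in> addm N x L" for a b
  proof -
    from that obtain v w where v: "v \<in> L" "cng N a (x \<cdot> v)" "w \<in> L" "cng N b (x \<cdot> w)"
      by (auto simp: addm_def)
    then have "cng N (a \<oplus>\<^bsub>M\<^esub> b) (x \<cdot> (v \<oplus>\<^bsub>M\<^esub> w))"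
      using cng_add[OF N v(2,4)] x Lc by (simp add: smult_r_distr)
    then show ?thesis using v submoduleE(5)[OF L] by (auto simp: addm_def)
  qed
  show "a \<cdot> z \<in> addm N x L" if "a \<in> carrier R" "z \<in> addm N x L" for a z
  proof -
    from that obtain v where v: "v \<in> L" "cng N z (x \<cdot> v)" by (auto simp: addm_def)
    then have "cng N (a \<cdot> z) (x \<cdot> (a \<cdot> v))"
      using cng_smult[OF N v(2)] that x Lc by (simp add: smult_comm)
    then show ?thesis using v that submoduleE(4)[OF L] by (auto simp: addm_def)
  qed
qed

lemma addm_sup:
  assumes N: "submodule N R M" and x: "x \<in> carrier R" and L: "submodule L R M"
  shows "N \<subseteq> addm N x L" "v \<in> L \<Longrightarrow> x \<cdot> v \<in> addm N x L"
proof -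
  show "N \<subseteq> addm N x L"
  proof
    fix n assume n: "n \<in> N"
    then have "cng N n (x \<cdot> \<zero>\<^bsub>M\<^esub>)" using x cng_zero_iff[OF N] by simp
    then show "n \<in> addm N x L" using submodule_zero[OF L] by (auto simp: addm_def)
  qed
  show "x \<cdot> v \<in> addm N x L" if "v \<in> L"
    using that cng_refl[OF N, of "x \<cdot> v"] submodule_carr[OF L that] x by (auto simp: addm_def)
qed

lemma addm_least:
  assumes W: "submodule W R M" and "N \<subseteq> W" "\<And>v. v \<in> L \<Longrightarrow> x \<cdot> v \<in> W"
  shows "addm N x L \<subseteq> W"
proof
  fix w assume "w \<in> addm N x L"
  then obtain v where "v \<in> L" "cng N w (x \<cdot> v)" by (auto simp: addm_def)
  then show "w \<in> W" using assms(2,3) cng_mem[OF W] cng_mono by blast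
qed

lemma addm_commute:
  assumes "submodule N R M" "x \<in> carrier R" "y \<in> carrier R"
  shows "addm (addm N x (carrier M)) y (carrier M) = addm (addm N y (carrier M)) x (carrier M)"
proof -
  have *: "addm (addm N x (carrier M)) y (carrier M) \<subseteq> addm (addm N y (carrier M)) x (carrier M)"
    if x: "x \<in> carrier R" and y: "y \<in> carrier R" for x y
  proof (intro addm_least)
    note c = carrier_is_submodule
    note sy = addm_submodule[OF assms(1) y c]
    show sxy: "submodule (addm (addm N y (carrier M)) x (carrier M)) R M"
      using addm_submodule[OF sy x c] .
    then show "submodule (addm (addm N y (carrier M)) x (carrier M)) R M" .
    show "N \<subseteq> addm (addm N y (carrier M)) x (carrier M)"
      using addm_sup(1)[OF assms(1) y c] addm_sup(1)[OF sy x c] by blast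
    show "x \<cdot> v \<in> addm (addm N y (carrier M)) x (carrier M)" if "v \<in> carrier M" for v
      using addm_sup(2)[OF sy x c that] .
    show "y \<cdot> v \<in> addm (addm N y (carrier M)) x (carrier M)" if "v \<in> carrier M" for v
      using addm_sup(2)[OF assms(1) y c that] addm_sup(1)[OF sy x c] by blast
  qed
  show ?thesis using *[OF assms(2,3)] *[OF assms(3,2)] by blast
qed

lemma col_ideal:
  assumes N: "submodule N R M" and y: "y \<in> carrier M"
  shows "ideal (col N y) R"
proof (rule idealI[OF R.ring_axioms])
  show "subgroup (col N y) (add_monoid R)"
  proof (rule R.add.subgroupI)
    show "col N y \<subseteq> carrier R" by (auto simp: col_def)
    have "\<zero> \<in> col N y" using y submodule_zero[OF N] by (simp add: col_def)
    then show "col N y \<noteq> {}" by blast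
    show "\<ominus> a \<in> col N y" if "a \<in> col N y" for a
      using that y submoduleE(3)[OF N] by (simp add: col_def smult_l_minus)
    show "a \<oplus> b \<in> col N y" if "a \<in> col N y" "b \<in> col N y" for a b
      using that y submoduleE(5)[OF N] by (simp add: col_def smult_l_distr)
  qed
  show "x \<otimes> a \<in> col N y" if "a \<in> col N y" "x \<in> carrier R" for a x
    using that y submoduleE(4)[OF N] by (auto simp: col_def smult_assoc1)
  then show "a \<otimes> x \<in> col N y" if "a \<in> col N y" "x \<in> carrier R" for a x
    using that R.m_comm[of a x] by (auto simp: col_def)
qed

lemma sat_submodule:
  assumes N: "submodule N R M" and P: "primeideal P R"
  shows "submodule (sat P N) R M"
proof (rule submodule_of_closed)
  show "sat P N \<subseteq> carrier M" by (auto simp: sat_def)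
  show "\<zero>\<^bsub>M\<^esub> \<in> sat P N" using submodule_zero[OF N] prime_compl(1)[OF P] by (auto simp: sat_def)
  show "a \<oplus>\<^bsub>M\<^esub> b \<in> sat P N" if "a \<in> sat P N" "b \<in> sat P N" for a b
  proof -
    from that obtain s t where st: "s \<in> carrier R - P" "t \<in> carrier R - P"
      "s \<cdot> a \<in> N" "t \<cdot> b \<in> N" and ab: "a \<in> carrier M" "b \<in> carrier M" by (auto simp: sat_def)
    have "(s \<otimes> t) \<cdot> (a \<oplus>\<^bsub>M\<^esub> b) = t \<cdot> (s \<cdot> a) \<oplus>\<^bsub>M\<^esub> s \<cdot> (t \<cdot> b)"
      using st ab by (simp add: smult_r_distr smult_assoc1 smult_comm)
    also have "\<dots> \<in> N" using st submoduleE(4,5)[OF N] by auto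
    finally show ?thesis using ab prime_compl(2)[OF P st(1,2)] by (auto simp: sat_def)
  qed
  show "a \<cdot> x \<in> sat P N" if "a \<in> carrier R" "x \<in> sat P N" for a x
  proof -
    from that obtain s where s: "s \<in> carrier R - P" "s \<cdot> x \<in> N" "x \<in> carrier M"
      by (auto simp: sat_def)
    have "s \<cdot> (a \<cdot> x) = a \<cdot> (s \<cdot> x)" using s that smult_comm by auto
    then have "s \<cdot> (a \<cdot> x) \<in> N" using s that submoduleE(4)[OF N] by simp
    then show ?thesis using s that unfolding sat_def by blast
  qed
qed

lemma sat_sup:
  assumes N: "submodule N R M" and P: "primeideal P R" shows "N \<subseteq> sat P N"
  using submodule_carr[OF N] prime_compl(1)[OF P] by (force simp: sat_def)

lemma sat_mono: "N \<subseteq> L \<Longrightarrow> sat P N \<subseteq> sat P L"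
  by (auto simp: sat_def)

lemma sat_antimono: "P \<subseteq> Q \<Longrightarrow> sat Q N \<subseteq> sat P N"
  by (auto simp: sat_def)

lemma sat_cancel:
  assumes P: "primeideal P R" and "s \<in> carrier R - P" "s \<cdot> y \<in> sat P N" "y \<in> carrier M"
  shows "y \<in> sat P N"
proof -
  from assms obtain t where t: "t \<in> carrier R - P" "t \<cdot> (s \<cdot> y) \<in> N" by (auto simp: sat_def)
  then show ?thesis using assms prime_compl(2)[OF P t(1) assms(2)]
    by (auto simp: sat_def smult_assoc1[symmetric])
qed

lemma sat_sat: assumes N: "submodule N R M" and P: "primeideal P R" shows "sat P (sat P N) = sat P N"
  using sat_sup[OF sat_submodule[OF N P] P] sat_cancel[OF P] by (auto simp: sat_def[of P "sat P N"])

text \<open>The class of \<open>y\<close> survives in \<open>(M/N)_P\<close> exactly when nothing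
  outside \<open>P\<close> kills it; non-vanishing becomes an inclusion of ideals.\<close>

lemma notin_sat:
  "y \<in> carrier M \<Longrightarrow> y \<notin> sat P N \<longleftrightarrow> col N y \<subseteq> P"
  by (auto simp: sat_def col_def)

lemma reg_cancel:
  assumes N: "submodule N R M" and "reg P N x" "x \<in> carrier R"
    and "p \<in> carrier M" "q \<in> carrier M" and "cng (sat P N) (x \<cdot> p) (x \<cdot> q)"
  shows "cng (sat P N) p q"
  using assms smult_minus by (auto simp: cng_def reg_def)

lemma sat_addmE:
  assumes N: "submodule N R M" and P: "primeideal P R" and x: "x \<in> carrier R" and L: "L \<subseteq> carrier M"
    and "w \<in> sat P (addm N x L)"
  obtains s v where "s \<in> carrier R - P" "v \<in> L" "cng N (s \<cdot> w) (x \<cdot> v)"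
  using assms(5) by (auto simp: sat_def addm_def)

lemma sat_addmI:
  assumes P: "primeideal P R" and N: "submodule N R M" and x: "x \<in> carrier R"
    and v: "v \<in> carrier M" and s: "s \<in> carrier R - P" and w: "w \<in> carrier M"
    and c: "cng (sat P N) (s \<cdot> w) (x \<cdot> v)"
  shows "w \<in> sat P (addm N x (carrier M))"
proof -
  let ?A = "sat P (addm N x (carrier M))"
  have A: "submodule ?A R M" by (intro sat_submodule addm_submodule N x P carrier_is_submodule)
  have "sat P N \<subseteq> ?A" using addm_sup(1)[OF N x carrier_is_submodule] sat_mono by blast
  then have "cng ?A (s \<cdot> w) (x \<cdot> v)" using c cng_mono by blast
  moreover have "x \<cdot> v \<in> ?A"
    using addm_sup(2)[OF N x carrier_is_submodule v] sat_sup[OF addm_submodule[OF N x carrier_is_submodule] P] by blast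
  ultimately have "s \<cdot> w \<in> ?A" using cng_mem[OF A] by blast
  then show ?thesis using sat_cancel[OF P s] w by blast
qed

text \<open>If \<open>yw = zv\<close>, then \<open>z\<close> kills \<open>v\<close> modulo
  \<open>y\<close>, so \<open>v = yv'\<close>; cancelling \<open>y\<close> in
  \<open>yw = yzv'\<close> gives \<open>w = zv'\<close>. All equations hold modulo \<open>N\<close>
  and up to factors outside \<open>P\<close>. Only this half of the permutation of
  \<open>y, z\<close> is needed: the exchange argument picks \<open>z\<close> regular modulo
  \<open>N\<close> beforehand.\<close>

lemma reg_permute:
  assumes N: "submodule N R M" and P: "primeideal P R" and y: "y \<in> carrier R" and z: "z \<in> carrier R"
    and ry: "reg P N y" and rz: "reg P (addm N y (carrier M)) z"
  shows "reg P (addm N z (carrier M)) y"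
  unfolding reg_def
proof (intro ballI impI)
  fix w assume w: "w \<in> carrier M" and "y \<cdot> w \<in> sat P (addm N z (carrier M))"
  note NP = sat_submodule[OF N P]
  obtain s v where s: "s \<in> carrier R - P" and v: "v \<in> carrier M"
    and c1: "cng N (s \<cdot> (y \<cdot> w)) (z \<cdot> v)"
    using sat_addmE[OF N P z _ \<open>y \<cdot> w \<in> _\<close>] by blast
  have "cng N (z \<cdot> v) (y \<cdot> (s \<cdot> w))"
    using cng_sym[OF N c1] s y w smult_comm by auto
  then have "z \<cdot> v \<in> addm N y (carrier M)" using s w by (auto simp: addm_def)
  then have "v \<in> sat P (addm N y (carrier M))"
    using rz v sat_sup[OF addm_submodule[OF N y carrier_is_submodule] P] by (auto simp: reg_def)
  then obtain t v' where t: "t \<in> carrier R - P" and v': "v' \<in> carrier M"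
    and c2: "cng N (t \<cdot> v) (y \<cdot> v')"
    using sat_addmE[OF N P y] by blast
  have "cng N (y \<cdot> ((t \<otimes> s) \<cdot> w)) (z \<cdot> (t \<cdot> v))"
    using cng_smult[OF N c1, of t] s t y z v w by (simp add: smult_comm smult_assoc1)
  moreover have "cng N (z \<cdot> (t \<cdot> v)) (y \<cdot> (z \<cdot> v'))"
    using cng_smult[OF N c2 z] y z v' smult_comm by simp
  ultimately have "cng (sat P N) (y \<cdot> ((t \<otimes> s) \<cdot> w)) (y \<cdot> (z \<cdot> v'))"
    using cng_trans[OF N] cng_mono sat_sup[OF N P] by blast
  then have "cng (sat P N) ((t \<otimes> s) \<cdot> w) (z \<cdot> v')"
    using reg_cancel[OF N ry y] s t w z v' by auto
  then show "w \<in> sat P (addm N z (carrier M))"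
    using sat_addmI[OF P N z v' prime_compl(2)[OF P t s] w] by blast
qed

end

text \<open>The maximum condition on submodules is taken as the axiom because every Noetherian
  induction below picks a maximal member of a family of submodules.
  \<open>finitely_generated_noeth\<close> derives it from finite generation.\<close>

locale noeth_module = module R M + R?: noetherian_ring R for R (structure) and M (structure) +
  assumes submodule_family_maximal: "F \<noteq> {} \<Longrightarrow> (\<And>L. L \<in> F \<Longrightarrow> submodule L R M) \<Longrightarrow>
    \<exists>L\<in>F. \<forall>L'\<in>F. L \<subseteq> L' \<longrightarrow> L' = L"
begin

section \<open>Associated primes\<close>

text \<open>A common denominator for all of \<open>L\<close>, usually found by multiplying the
  denominators of finitely many generators. Here \<open>s\<close> is chosen with
  \<open>{z \<in> L. sz \<in> N}\<close> maximal; if \<open>t\<close> works for a given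
  \<open>z\<close>, then \<open>ts\<close> works for \<open>z\<close> and for everything
  \<open>s\<close> worked for, so \<open>s\<close> already worked for \<open>z\<close>.\<close>

lemma sat_uniform:
  assumes N: "submodule N R M" and L: "submodule L R M" and P: "primeideal P R" and "L \<subseteq> sat P N"
  shows "\<exists>s\<in>carrier R - P. \<forall>z\<in>L. s \<cdot> z \<in> N"
proof -
  define K where "K s = {z \<in> L. s \<cdot> z \<in> N}" for s
  have Lc: "z \<in> carrier M" if "z \<in> L" for z using submodule_carr[OF L that] .
  have K: "submodule (K s) R M" if s: "s \<in> carrier R" for s
  proof (rule submodule_of_closed)
    show "K s \<subseteq> carrier M" using Lc by (auto simp: K_def)
    show "\<zero>\<^bsub>M\<^esub> \<in> K s" using submodule_zero[OF L] submodule_zero[OF N] s by (simp add: K_def)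
    show "a \<oplus>\<^bsub>M\<^esub> b \<in> K s" if "a \<in> K s" "b \<in> K s" for a b
      using that submoduleE(5)[OF L] submoduleE(5)[OF N] s Lc by (simp add: K_def smult_r_distr)
    show "a \<cdot> x \<in> K s" if "a \<in> carrier R" "x \<in> K s" for a x
      using that submoduleE(4)[OF L] submoduleE(4)[OF N] s Lc smult_comm[of s a x]
      by (simp add: K_def)
  qed
  have "\<exists>T\<in>K ` (carrier R - P). \<forall>T'\<in>K ` (carrier R - P). T \<subseteq> T' \<longrightarrow> T' = T"
    by (rule submodule_family_maximal) (use K prime_compl(1)[OF P] in blast)+
  then obtain s where s: "s \<in> carrier R - P"
    and max: "\<And>t. t \<in> carrier R - P \<Longrightarrow> K s \<subseteq> K t \<Longrightarrow> K t = K s" by auto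
  have "s \<cdot> z \<in> N" if z: "z \<in> L" for z
  proof -
    obtain t where t: "t \<in> carrier R - P" "t \<cdot> z \<in> N" using assms(4) z by (auto simp: sat_def)
    have "K s \<subseteq> K (t \<otimes> s)"
      using s t(1) Lc submoduleE(4)[OF N] by (auto simp: K_def smult_assoc1)
    then have "K (t \<otimes> s) = K s" using max prime_compl(2)[OF P t(1) s] by blast
    moreover have "z \<in> K (t \<otimes> s)"
      using s t z Lc[OF z] submoduleE(4)[OF N] smult_comm[of t s z] by (simp add: K_def smult_assoc1)
    ultimately show ?thesis by (simp add: K_def)
  qed
  then show ?thesis using s by blast
qed

lemma col_mult_sup:
  assumes N: "submodule N R M" and "y \<in> carrier M" "c \<in> carrier R"
  shows "col N y \<subseteq> col N (c \<cdot> y)"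
proof
  fix a assume "a \<in> col N y"
  then show "a \<in> col N (c \<cdot> y)"
    using assms submoduleE(4)[OF N] smult_comm[of a c y] by (simp add: col_def)
qed

text \<open>A maximal element among the annihilators of the non-zero multiples of \<open>y\<close>
  in \<open>M/T\<close> is prime: if \<open>a\<close> does not kill \<open>z\<close>, then
  \<open>az\<close> has the same annihilator as \<open>z\<close>, so \<open>ab\<close> killing
  \<open>z\<close> forces \<open>b\<close> to kill \<open>z\<close>. Staying among multiples of
  \<open>y\<close> keeps control of which ideals the prime contains.\<close>

lemma ex_col_prime:
  assumes T: "submodule T R M" and y: "y \<in> carrier M" "y \<notin> T"
  shows "\<exists>c\<in>carrier R. c \<cdot> y \<notin> T \<and> primeideal (col T (c \<cdot> y)) R"
proof -
  define C where "C = {c \<in> carrier R. c \<cdot> y \<notin> T}"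
  have "\<one> \<in> C" using y by (simp add: C_def)
  have "\<exists>I\<in>(\<lambda>c. col T (c \<cdot> y)) ` C. \<forall>J\<in>(\<lambda>c. col T (c \<cdot> y)) ` C. I \<subseteq> J \<longrightarrow> J = I"
    by (rule ideal_family_maximal) (use \<open>\<one> \<in> C\<close> col_ideal[OF T] y in \<open>auto simp: C_def\<close>)
  then obtain c where c: "c \<in> carrier R" "c \<cdot> y \<notin> T"
    and max: "\<And>d. d \<in> carrier R \<Longrightarrow> d \<cdot> y \<notin> T \<Longrightarrow> col T (c \<cdot> y) \<subseteq> col T (d \<cdot> y) \<Longrightarrow>
      col T (d \<cdot> y) = col T (c \<cdot> y)" by (auto simp: C_def)
  define z where "z = c \<cdot> y"
  have z: "z \<in> carrier M" "z \<notin> T" using c y by (auto simp: z_def)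
  have "primeideal (col T z) R"
  proof (rule primeidealI[OF col_ideal[OF T z(1)] R.is_cring])
    have "\<one> \<notin> col T z" using z by (simp add: col_def)
    then show "carrier R \<noteq> col T z" by auto
    fix a b assume ab: "a \<in> carrier R" "b \<in> carrier R" "a \<otimes> b \<in> col T z"
    show "a \<in> col T z \<or> b \<in> col T z"
    proof (cases "a \<in> col T z")
      case False
      then have "a \<cdot> z \<notin> T" using ab by (auto simp: col_def)
      moreover have "a \<cdot> z = (a \<otimes> c) \<cdot> y" using ab c y by (simp add: z_def smult_assoc1)
      ultimately have "col T (a \<cdot> z) = col T z"
        using max[of "a \<otimes> c"] col_mult_sup[OF T z(1) ab(1)] ab c by (simp add: z_def)
      moreover have "b \<in> col T (a \<cdot> z)"
        using ab z by (simp add: col_def smult_assoc1 smult_comm)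
      ultimately show ?thesis by blast
    qed simp
  qed
  then show ?thesis using c by (auto simp: z_def)
qed

text \<open>Associated primes lift from the localization. A prime \<open>J\<close> is the
  annihilator of a multiple \<open>z\<close> of \<open>y\<close> modulo \<open>sat P N\<close>; a
  common denominator \<open>s\<close> moves \<open>Jz\<close> into \<open>N\<close>, and then
  \<open>sz\<close> has annihilator exactly \<open>J\<close> modulo \<open>N\<close>. As
  \<open>sz\<close> is a multiple of \<open>y\<close>, the prime also contains
  \<open>col N y\<close>.\<close>

lemma ass_below:
  assumes N: "submodule N R M" and P: "primeideal P R" and y: "y \<in> carrier M" and "col N y \<subseteq> P"
  obtains c where "c \<in> carrier R" "col N (c \<cdot> y) \<in> ass N" "col N (c \<cdot> y) \<subseteq> P"
    "primeideal (col N (c \<cdot> y)) R"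
proof -
  let ?T = "sat P N"
  have T: "submodule ?T R M" using sat_submodule[OF N P] .
  have "y \<notin> ?T" using assms notin_sat by blast
  then obtain c where c: "c \<in> carrier R" "c \<cdot> y \<notin> ?T" and pr: "primeideal (col ?T (c \<cdot> y)) R"
    using ex_col_prime[OF T y] by blast
  define z where "z = c \<cdot> y"
  define J where "J = col ?T z"
  have z: "z \<in> carrier M" "z \<notin> ?T" using c y by (auto simp: z_def)
  have J: "primeideal J R" using pr by (simp add: J_def z_def)
  have Ji: "ideal J R" using primeideal.axioms(1)[OF J] .
  have JR: "J \<subseteq> carrier R" using prime_subset[OF J] .
  \<comment> \<open>This is the submodule \<open>Jz\<close>, to which \<open>sat_uniform\<close> is
    applied.\<close>
  let ?L = "adj S0 J z"
  have "?L \<subseteq> ?T"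
  proof
    fix w assume "w \<in> ?L"
    then obtain j where "j \<in> J" "cng S0 w (j \<cdot> z)" by (auto simp: adj_def)
    moreover from this have "j \<cdot> z \<in> ?T" by (simp add: J_def col_def)
    ultimately show "w \<in> ?T" using cng_mem[OF T] cng_mono submodule_zero[OF T] by blast
  qed
  then obtain s where s: "s \<in> carrier R - P" and sL: "\<forall>w\<in>?L. s \<cdot> w \<in> N"
    using sat_uniform[OF N adj_submodule[OF submodule_zeroset z(1) Ji] P] by blast
  have eq: "col N ((s \<otimes> c) \<cdot> y) = J"
  proof -
    have sz: "(s \<otimes> c) \<cdot> y = s \<cdot> z" using s c y by (simp add: z_def smult_assoc1)
    have "j \<cdot> (s \<cdot> z) \<in> N" if "j \<in> J" for j
    proof -
      have "s \<cdot> (j \<cdot> z) \<in> N" using sL adj_sup(2)[OF submodule_zeroset z(1) Ji that] by blast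
      then show ?thesis using smult_comm[of s j z] s z JR that by auto
    qed
    moreover have "j \<in> J" if "j \<in> carrier R" "j \<cdot> (s \<cdot> z) \<in> N" for j
    proof -
      have "s \<cdot> (j \<cdot> z) \<in> N" using smult_comm[of s j z] s z that by auto
      then have "j \<cdot> z \<in> ?T" using s z that by (auto simp: sat_def)
      then show ?thesis using that by (simp add: J_def col_def)
    qed
    ultimately show ?thesis using JR unfolding sz by (auto simp: col_def)
  qed
  have "J \<subseteq> P"
  proof
    fix j assume j: "j \<in> J"
    then have "j \<in> carrier R" "j \<cdot> z \<in> ?T" by (auto simp: J_def col_def)
    then show "j \<in> P" using sat_cancel[OF P _ _ z(1)] z(2) by blast
  qed
  have sc: "s \<otimes> c \<in> carrier R" using s c by simp
  moreover have "J \<in> ass N" unfolding ass_def using J eq sc y by blast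
  ultimately show ?thesis using that[of "s \<otimes> c"] \<open>J \<subseteq> P\<close> J by (simp add: eq)
qed

lemma ass_prime: "Q \<in> ass N \<Longrightarrow> primeideal Q R"
  by (simp add: ass_def)

text \<open>If \<open>x\<close> kills a non-zero \<open>w\<close> in \<open>(M/N)_P\<close>, some
  multiple of \<open>w\<close> has as annihilator an associated prime inside \<open>P\<close>. It
  contains \<open>sx\<close> for some \<open>s\<close> outside \<open>P\<close>, hence
  \<open>x\<close>.\<close>

lemma reg_iff_ass:
  assumes N: "submodule N R M" and P: "primeideal P R" and x: "x \<in> carrier R"
  shows "reg P N x \<longleftrightarrow> (\<forall>Q\<in>ass N. Q \<subseteq> P \<longrightarrow> x \<notin> Q)"
proof
  assume r: "reg P N x"
  show "\<forall>Q\<in>ass N. Q \<subseteq> P \<longrightarrow> x \<notin> Q"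
  proof (intro ballI impI notI)
    fix Q assume "Q \<in> ass N" "Q \<subseteq> P" "x \<in> Q"
    then obtain y where y: "y \<in> carrier M" "Q = col N y" by (auto simp: ass_def)
    then have "x \<cdot> y \<in> sat P N" using \<open>x \<in> Q\<close> sat_sup[OF N P] by (auto simp: col_def)
    then have "y \<in> sat P N" using r y by (simp add: reg_def)
    then show False using notin_sat[OF y(1)] y(2) \<open>Q \<subseteq> P\<close> by blast
  qed
next
  assume a: "\<forall>Q\<in>ass N. Q \<subseteq> P \<longrightarrow> x \<notin> Q"
  show "reg P N x" unfolding reg_def
  proof (intro ballI impI, rule ccontr)
    fix w assume w: "w \<in> carrier M" "x \<cdot> w \<in> sat P N" "w \<notin> sat P N"
    then have "col N w \<subseteq> P" using notin_sat by blast
    then obtain c where c: "c \<in> carrier R" "col N (c \<cdot> w) \<in> ass N" "col N (c \<cdot> w) \<subseteq> P"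
      and pr: "primeideal (col N (c \<cdot> w)) R"
      using ass_below[OF N P w(1)] by blast
    obtain s where s: "s \<in> carrier R - P" "s \<cdot> (x \<cdot> w) \<in> N" using w by (auto simp: sat_def)
    then have "s \<otimes> x \<in> col N w" using x w by (simp add: col_def smult_assoc1)
    then have "s \<otimes> x \<in> col N (c \<cdot> w)" using col_mult_sup[OF N w(1) c(1)] by blast
    then have "x \<in> col N (c \<cdot> w)" using prime_mult_cancel[OF pr _ _ x] s(1) c(3) by blast
    then show False using a c by blast
  qed
qed

section \<open>Nakayama's lemma, locally at a prime\<close>

text \<open>In the usual form: \<open>K\<close> is contained in \<open>K' + JK\<close> locally at
  \<open>P\<close>, hence in \<open>K'\<close>. The sum is not formed; the hypothesis quantifies
  over all submodules \<open>W\<close> containing \<open>K'\<close> and \<open>JK\<close>. For a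
  maximal counterexample \<open>L\<close> and \<open>y\<close> in \<open>K\<close> outside
  \<open>sat P L\<close>, adjoining \<open>y\<close> to \<open>L\<close> captures \<open>K\<close>,
  so \<open>JK\<close> falls locally into \<open>L + Jy\<close>. Thus \<open>sy = jy\<close> modulo
  \<open>L\<close> with \<open>s - j\<close> outside \<open>P\<close>, and \<open>y\<close> vanishes
  at \<open>P\<close> after all.\<close>

lemma nakayama:
  assumes K: "submodule K R M" and K': "submodule K' R M" and P: "primeideal P R"
    and J: "ideal J R" "J \<subseteq> P"
    and hyp: "\<And>W. submodule W R M \<Longrightarrow> K' \<subseteq> W \<Longrightarrow> (\<And>j k. j \<in> J \<Longrightarrow> k \<in> K \<Longrightarrow> j \<cdot> k \<in> W) \<Longrightarrow> K \<subseteq> sat P W"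
  shows "K \<subseteq> sat P K'"
proof (rule ccontr)
  assume neg: "\<not> ?thesis"
  define F where "F = {L. submodule L R M \<and> K' \<subseteq> L \<and> \<not> K \<subseteq> sat P L}"
  have "\<exists>L\<in>F. \<forall>L'\<in>F. L \<subseteq> L' \<longrightarrow> L' = L"
    by (rule submodule_family_maximal) (use neg K' in \<open>auto simp: F_def\<close>)
  then obtain L where L: "submodule L R M" "K' \<subseteq> L" "\<not> K \<subseteq> sat P L"
    and max: "\<And>L'. L' \<in> F \<Longrightarrow> L \<subseteq> L' \<Longrightarrow> L' = L" by (auto simp: F_def)
  from L(3) obtain y where y: "y \<in> K" "y \<notin> sat P L" by blast
  have yc: "y \<in> carrier M" using submodule_carr[OF K y(1)] .
  have Jc: "J \<subseteq> carrier R" using additive_subgroup.a_subset[OF ideal.axioms(1)[OF J(1)]] .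
  note A = adj_R_gen[OF L(1) yc]
  have "y \<notin> L" using y sat_sup[OF L(1) P] by blast
  then have "adj L (carrier R) y \<notin> F" using max[of "adj L (carrier R) y"] A(2,3) by blast
  then have KA: "K \<subseteq> sat P (adj L (carrier R) y)" using A L(2) by (auto simp: F_def)
  let ?W = "adj L J y"
  have W: "submodule ?W R M" "L \<subseteq> ?W" using adj_submodule[OF L(1) yc J(1)] adj_sup(1)[OF L(1) yc J(1)] .
  have "K \<subseteq> sat P (sat P ?W)"
  proof (rule hyp)
    show "submodule (sat P ?W) R M" using sat_submodule[OF W(1) P] .
    show "K' \<subseteq> sat P ?W" using L(2) W(2) sat_sup[OF W(1) P] by blast
    fix j k assume j: "j \<in> J" and k: "k \<in> K"
    have kc: "k \<in> carrier M" using submodule_carr[OF K k] .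
    from k KA obtain s c where s: "s \<in> carrier R - P" "c \<in> carrier R" "cng L (s \<cdot> k) (c \<cdot> y)"
      by (auto simp: sat_def adj_def)
    have "cng L (s \<cdot> (j \<cdot> k)) ((j \<otimes> c) \<cdot> y)"
      using cng_smult[OF L(1) s(3), of j] j Jc s kc yc smult_comm[of s j k] by (auto simp: smult_assoc1)
    moreover have "j \<otimes> c \<in> J" using ideal.I_r_closed[OF J(1) j s(2)] .
    ultimately have "s \<cdot> (j \<cdot> k) \<in> ?W" by (auto simp: adj_def)
    then show "j \<cdot> k \<in> sat P ?W" using s(1) kc j Jc by (auto simp: sat_def)
  qed
  then have "y \<in> sat P ?W" using y(1) sat_sat[OF W(1) P] by blast
  then obtain s j where s: "s \<in> carrier R - P" "j \<in> J" "cng L (s \<cdot> y) (j \<cdot> y)"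
    by (auto simp: sat_def adj_def)
  have jc: "j \<in> carrier R" using s Jc by blast
  have "(s \<ominus> j) \<cdot> y = s \<cdot> y \<ominus>\<^bsub>M\<^esub> j \<cdot> y"
    using s jc yc by (simp add: R.minus_eq M.minus_eq smult_l_distr smult_l_minus)
  then have "(s \<ominus> j) \<cdot> y \<in> L" using s(3) by (simp add: cng_def)
  moreover have "s \<ominus> j \<in> carrier R - P"
  proof -
    have "s = (s \<ominus> j) \<oplus> j" using s jc by (simp add: R.minus_eq R.a_assoc R.l_neg)
    then have "s \<ominus> j \<notin> P" using prime_add[OF P, of "s \<ominus> j" j] s J(2) by auto
    then show ?thesis using s jc by simp
  qed
  ultimately show False using y(2) yc by (auto simp: sat_def)
qed

text \<open>As \<open>x\<close> is regular, \<open>U = {u. Qu = 0}\<close> meets \<open>xM\<close> in \<open>xU\<close>, so by Nakayama's lemma \<open>U\<close> is not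
  contained in \<open>xM\<close>; an associated prime of \<open>(U + xM)/xM\<close> contains \<open>Q + (x)\<close>.\<close>

lemma ass_climb:
  assumes N: "submodule N R M" and P: "primeideal P R" and Q: "Q \<in> ass N" "Q \<subseteq> P"
    and x: "x \<in> P" and rx: "reg P N x"
  shows "\<exists>Q'\<in>ass (addm N x (carrier M)). Q \<subset> Q' \<and> Q' \<subseteq> P"
proof -
  have xc: "x \<in> carrier R" using prime_subset[OF P] x by blast
  have prQ: "primeideal Q R" using Q ass_prime by blast
  have Qc: "Q \<subseteq> carrier R" using prime_subset[OF prQ] .
  let ?N1 = "addm N x (carrier M)"
  have N1: "submodule ?N1 R M" "N \<subseteq> ?N1"
    using addm_submodule[OF N xc carrier_is_submodule] addm_sup(1)[OF N xc carrier_is_submodule] .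
  have NP: "submodule (sat P N) R M" using sat_submodule[OF N P] .
  define U where "U = {u \<in> carrier M. \<forall>q\<in>Q. q \<cdot> u \<in> sat P N}"
  have U: "submodule U R M"
  proof (rule submodule_of_closed)
    show "U \<subseteq> carrier M" by (auto simp: U_def)
    show "\<zero>\<^bsub>M\<^esub> \<in> U" using submodule_zero[OF NP] Qc by (auto simp: U_def)
    show "a \<oplus>\<^bsub>M\<^esub> b \<in> U" if "a \<in> U" "b \<in> U" for a b
      using that submoduleE(5)[OF NP] Qc by (auto simp: U_def smult_r_distr subset_iff)
    show "a \<cdot> u \<in> U" if "a \<in> carrier R" "u \<in> U" for a u
      using that submoduleE(4)[OF NP] Qc smult_comm[of _ a u] by (auto simp: U_def subset_iff)
  qed
  obtain y where y: "y \<in> carrier M" "Q = col N y" using Q by (auto simp: ass_def)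
  have "y \<in> U" using y sat_sup[OF N P] by (auto simp: U_def col_def)
  moreover have "y \<notin> sat P N" using notin_sat[OF y(1)] y(2) Q(2) by blast
  ultimately have "\<not> U \<subseteq> sat P N" by blast
  have "\<not> U \<subseteq> sat P ?N1"
  proof
    assume UN: "U \<subseteq> sat P ?N1"
    have "U \<subseteq> sat P N"
    proof (rule nakayama[OF U N P primeideal.axioms(1)[OF P]])
      fix W assume W: "submodule W R M" "N \<subseteq> W" and JW: "\<And>j k. j \<in> P \<Longrightarrow> k \<in> U \<Longrightarrow> j \<cdot> k \<in> W"
      show "U \<subseteq> sat P W"
      proof
        fix u assume u: "u \<in> U"
        have uc: "u \<in> carrier M" using u by (simp add: U_def)
        have "u \<in> sat P ?N1" using u UN by blast
        then obtain s v where s: "s \<in> carrier R - P" and v: "v \<in> carrier M"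
          and c: "cng N (s \<cdot> u) (x \<cdot> v)"
          using sat_addmE[OF N P xc subset_refl] by metis
        have "q \<cdot> v \<in> sat P N" if q: "q \<in> Q" for q
        proof -
          have qc: "q \<in> carrier R" using q Qc by blast
          have "cng N (s \<cdot> (q \<cdot> u)) (x \<cdot> (q \<cdot> v))"
            using cng_smult[OF N c qc] smult_comm[of q s u] smult_comm[of q x v] qc s xc uc v by simp
          moreover have "s \<cdot> (q \<cdot> u) \<in> sat P N"
            using u q s submoduleE(4)[OF NP] by (simp add: U_def)
          ultimately have "x \<cdot> (q \<cdot> v) \<in> sat P N"
            using cng_mem[OF NP] cng_mono sat_sup[OF N P] by blast
          then show ?thesis using rx qc v by (simp add: reg_def)
        qed
        then have "v \<in> U" using v by (simp add: U_def)
        then have "x \<cdot> v \<in> W" using JW x by blast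
        then have "s \<cdot> u \<in> W" using cng_mem[OF W(1)] cng_mono[OF c W(2)] by blast
        then show "u \<in> sat P W" using s uc by (auto simp: sat_def)
      qed
    qed simp
    then show False using \<open>\<not> U \<subseteq> sat P N\<close> by blast
  qed
  then obtain u where u: "u \<in> U" "u \<notin> sat P ?N1" by blast
  have uc: "u \<in> carrier M" using u by (simp add: U_def)
  obtain c where c: "c \<in> carrier R" "col ?N1 (c \<cdot> u) \<in> ass ?N1" "col ?N1 (c \<cdot> u) \<subseteq> P"
    and pr: "primeideal (col ?N1 (c \<cdot> u)) R"
    using ass_below[OF N1(1) P uc] notin_sat[OF uc] u(2) by blast
  have "x \<in> col ?N1 (c \<cdot> u)"
    using addm_sup(2)[OF N xc carrier_is_submodule] c(1) uc xc by (simp add: col_def)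
  moreover have "x \<notin> Q" using rx reg_iff_ass[OF N P xc] Q by blast
  moreover have "Q \<subseteq> col ?N1 (c \<cdot> u)"
  proof
    fix q assume q: "q \<in> Q"
    then have qc: "q \<in> carrier R" using Qc by blast
    have "q \<cdot> u \<in> sat P N" using u q by (simp add: U_def)
    then obtain s where s: "s \<in> carrier R - P" "s \<cdot> (q \<cdot> u) \<in> N" by (auto simp: sat_def)
    then have "s \<otimes> q \<in> col ?N1 u" using qc uc N1(2) by (auto simp: col_def smult_assoc1)
    then have "s \<otimes> q \<in> col ?N1 (c \<cdot> u)" using col_mult_sup[OF N1(1) uc c(1)] by blast
    then show "q \<in> col ?N1 (c \<cdot> u)" using prime_mult_cancel[OF pr _ _ qc] s(1) c(3) by blast
  qed
  ultimately show ?thesis using c by blast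
qed

text \<open>Replaces a filtration of \<open>M/N\<close> with factors \<open>R/Q\<close>: a maximal
  \<open>K\<close> for which \<open>Ass (K/N)\<close> is finite must be \<open>M\<close>, since
  otherwise adjoining an element whose annihilator modulo \<open>K\<close> is a prime
  \<open>Q\<close> adds at most \<open>Q\<close>.\<close>

lemma finite_ass:
  assumes N: "submodule N R M"
  shows "finite (ass N)"
proof -
  define A where "A K = {Q. primeideal Q R \<and> (\<exists>y\<in>K. Q = col N y)}" for K
  define F where "F = {K. submodule K R M \<and> N \<subseteq> K \<and> finite (A K)}"
  have "A N = {}"
  proof -
    have "\<not> primeideal (col N y) R" if "y \<in> N" for y
    proof -
      have "\<one> \<in> col N y" using that submodule_carr[OF N that] by (simp add: col_def)
      then show ?thesis using prime_compl(1) by blast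
    qed
    then show ?thesis by (auto simp: A_def)
  qed
  then have "N \<in> F" using N by (simp add: F_def)
  have "\<exists>L\<in>F. \<forall>L'\<in>F. L \<subseteq> L' \<longrightarrow> L' = L"
    by (rule submodule_family_maximal) (use \<open>N \<in> F\<close> in \<open>auto simp: F_def\<close>)
  then obtain K where K: "submodule K R M" "N \<subseteq> K" "finite (A K)"
    and max: "\<And>L'. L' \<in> F \<Longrightarrow> K \<subseteq> L' \<Longrightarrow> L' = K" by (auto simp: F_def)
  have "carrier M \<subseteq> K"
  proof (rule ccontr)
    assume "\<not> carrier M \<subseteq> K"
    then obtain y where "y \<in> carrier M" "y \<notin> K" by blast
    then obtain c where c: "c \<in> carrier R" "c \<cdot> y \<notin> K" "primeideal (col K (c \<cdot> y)) R"
      using ex_col_prime[OF K(1)] by blast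
    define z where "z = c \<cdot> y"
    have z: "z \<in> carrier M" "z \<notin> K" using c \<open>y \<in> carrier M\<close> by (auto simp: z_def)
    define Q where "Q = col K z"
    have Q: "primeideal Q R" using c by (simp add: Q_def z_def)
    note B = adj_R_gen[OF K(1) z(1)]
    let ?K' = "adj K (carrier R) z"
    have "A ?K' \<subseteq> insert Q (A K)"
    proof
      fix P assume "P \<in> A ?K'"
      then obtain w where P: "primeideal P R" "P = col N w" and w: "w \<in> ?K'" by (auto simp: A_def)
      have wc: "w \<in> carrier M" using submodule_carr[OF B(1) w] .
      show "P \<in> insert Q (A K)"
      \<comment> \<open>Either a multiple of \<open>w\<close> is in \<open>K\<close> and non-zero
        modulo \<open>N\<close>, and it has the same annihilator \<open>P\<close> as
        \<open>w\<close>; or \<open>Rw\<close> meets \<open>K\<close> only in \<open>N\<close>, so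
        that \<open>P\<close> is also the annihilator of \<open>w\<close> in the quotient of
        \<open>K + Rz\<close> by \<open>K\<close>, a copy of \<open>R/Q\<close>.\<close>
      proof (cases "\<exists>b\<in>carrier R. b \<cdot> w \<in> K \<and> b \<cdot> w \<notin> N")
        case True
        then obtain b where b: "b \<in> carrier R" "b \<cdot> w \<in> K" "b \<cdot> w \<notin> N" by blast
        have "b \<in> carrier R - P" using b P(2) by (simp add: col_def)
        have "col N (b \<cdot> w) \<subseteq> P"
        proof
          fix p assume p: "p \<in> col N (b \<cdot> w)"
          then have "b \<otimes> p \<in> P" using P(2) b wc by (auto simp: col_def smult_assoc1 smult_comm)
          then show "p \<in> P" using prime_mult_cancel[OF P(1)] \<open>b \<in> carrier R - P\<close> p by (auto simp: col_def)
        qed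
        then have "P = col N (b \<cdot> w)" using P(2) col_mult_sup[OF N wc b(1)] by blast
        then show ?thesis using P(1) b(2) by (auto simp: A_def)
      next
        case False
        then have Pw: "P = col K w" using P(2) K(2) by (auto simp: col_def)
        obtain a where a: "a \<in> carrier R" "cng K w (a \<cdot> z)" using w by (auto simp: adj_def)
        have iff: "e \<in> P \<longleftrightarrow> e \<otimes> a \<in> Q" if "e \<in> carrier R" for e
        proof -
          have "cng K (e \<cdot> w) ((e \<otimes> a) \<cdot> z)"
            using cng_smult[OF K(1) a(2) that] a that z by (simp add: smult_assoc1)
          then show ?thesis using cng_mem[OF K(1)] that a by (simp add: Pw Q_def col_def)
        qed
        have "a \<notin> Q" using iff[of \<one>] a prime_compl(1)[OF P(1)] by auto
        have "P = Q"
        proof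
          show "P \<subseteq> Q"
            using iff prime_subset[OF P(1)] primeideal.I_prime[OF Q] \<open>a \<notin> Q\<close> a by blast
          show "Q \<subseteq> P" using iff prime_subset[OF Q] prime_absorb(1)[OF Q] a by blast
        qed
        then show ?thesis by simp
      qed
    qed
    then have "finite (A ?K')" using K(3) finite_subset by blast
    then have "?K' \<in> F" using B K(2) by (auto simp: F_def)
    then have "?K' = K" using max B(2) by blast
    then show False using B(3) z(2) by blast
  qed
  then have "ass N \<subseteq> A K" by (auto simp: ass_def A_def)
  then show ?thesis using K(3) finite_subset by blast
qed

section \<open>Bounded chains\<close>

text \<open>The bound below expresses that \<open>(M/N)\<^sub>P\<close> has finite length.\<close>

definition local_chain :: "'a set \<Rightarrow> 'c set \<Rightarrow> (nat \<Rightarrow> 'c set) \<Rightarrow> bool"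
  where "local_chain P N C \<longleftrightarrow>
    (\<forall>i. submodule (C i) R M \<and> N \<subseteq> C i \<and> sat P (C i) \<subseteq> C i \<and> C i \<subseteq> C (Suc i))"

lemma local_chain_mono: "local_chain P N C \<Longrightarrow> i \<le> j \<Longrightarrow> C i \<subseteq> C j"
  by (rule lift_Suc_mono_le[of C]) (auto simp: local_chain_def)

text \<open>The minimality hypothesis says that \<open>P\<close> is the only prime between the
  annihilator of \<open>M/N\<close> and \<open>P\<close>, so locally only copies of the residue
  field of \<open>P\<close> occur. \<open>good K n\<close> bounds by \<open>n\<close> the strict
  steps of a chain that are visible inside \<open>K\<close>; strict steps are counted because a
  chain may stagnate. A maximal \<open>K\<close> with such a bound must agree with \<open>M\<close>
  at \<open>P\<close>: otherwise an element \<open>z\<close> with annihilator \<open>P\<close>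
  modulo \<open>K\<close> can be adjoined, and the bound grows by one.\<close>

lemma local_chain_bounded:
  assumes N: "submodule N R M" and P: "primeideal P R"
    and min: "\<And>Q. primeideal Q R \<Longrightarrow> Q \<subseteq> P \<Longrightarrow>
      {a \<in> carrier R. \<forall>z\<in>carrier M. a \<cdot> z \<in> N} \<subseteq> Q \<Longrightarrow> Q = P"
  shows "\<exists>n. \<forall>C m. local_chain P N C \<longrightarrow> card {i. i < m \<and> C i \<noteq> C (Suc i)} \<le> n"
proof -
  define good where "good K n \<longleftrightarrow>
    (\<forall>C m. local_chain P N C \<longrightarrow> card {i. i < m \<and> C i \<inter> K \<noteq> C (Suc i) \<inter> K} \<le> n)" for K and n :: nat
  define F where "F = {K. submodule K R M \<and> N \<subseteq> K \<and> (\<exists>n. good K n)}"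
  have "good N 0"
    unfolding good_def
  proof (intro allI impI)
    fix C and m :: nat assume "local_chain P N C"
    then have "C i \<inter> N = N" for i by (auto simp: local_chain_def)
    then show "card {i. i < m \<and> C i \<inter> N \<noteq> C (Suc i) \<inter> N} \<le> 0" by simp
  qed
  then have "N \<in> F" using N by (auto simp: F_def)
  have "\<exists>L\<in>F. \<forall>L'\<in>F. L \<subseteq> L' \<longrightarrow> L' = L"
    by (rule submodule_family_maximal) (use \<open>N \<in> F\<close> in \<open>auto simp: F_def\<close>)
  then obtain K n where K: "submodule K R M" "N \<subseteq> K" and n: "good K n"
    and max: "\<And>L'. L' \<in> F \<Longrightarrow> K \<subseteq> L' \<Longrightarrow> L' = K" by (auto simp: F_def)
  have MK: "carrier M \<subseteq> sat P K"
  proof (rule ccontr)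
    assume "\<not> carrier M \<subseteq> sat P K"
    then obtain y where y: "y \<in> carrier M" "y \<notin> sat P K" by blast
    then have "col K y \<subseteq> P" using notin_sat by blast
    then obtain c where c: "c \<in> carrier R" "col K (c \<cdot> y) \<in> ass K" "col K (c \<cdot> y) \<subseteq> P"
      "primeideal (col K (c \<cdot> y)) R"
      by (rule ass_below[OF K(1) P y(1)])
    define z where "z = c \<cdot> y"
    have z: "z \<in> carrier M" using c y by (simp add: z_def)
    have "col K z = P"
    proof (rule min)
      show "primeideal (col K z) R" "col K z \<subseteq> P" using c by (auto simp: z_def)
      show "{a \<in> carrier R. \<forall>z\<in>carrier M. a \<cdot> z \<in> N} \<subseteq> col K z"
        using z K(2) by (auto simp: col_def)
    qed
    then have colP: "a \<cdot> z \<in> K \<longleftrightarrow> a \<in> P" if "a \<in> carrier R" for a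
      using that by (auto simp: col_def)
    have zK: "z \<notin> K" using colP[of \<one>] z prime_compl(1)[OF P] by simp
    note B = adj_R_gen[OF K(1) z]
    let ?K' = "adj K (carrier R) z"
    have "good ?K' (Suc n)"
      unfolding good_def
    proof (intro allI impI)
      fix C and m :: nat assume C: "local_chain P N C"
      then have Cs: "\<And>i. submodule (C i) R M" and CP: "\<And>i. sat P (C i) \<subseteq> C i"
        by (auto simp: local_chain_def)
      let ?D = "{i. i < m \<and> C i \<inter> K \<noteq> C (Suc i) \<inter> K}"
      let ?E = "{i. i < m \<and> C i \<inter> ?K' \<noteq> C (Suc i) \<inter> ?K' \<and> C i \<inter> K = C (Suc i) \<inter> K}"
      \<comment> \<open>Modulo \<open>K\<close>, \<open>u\<close> and \<open>w\<close> are multiples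
        \<open>az\<close> and \<open>bz\<close> with \<open>a\<close> outside \<open>P\<close>. The
        difference \<open>aw - bu\<close> lies in \<open>K\<close>, where the step \<open>j\<close>
        is invisible, so it is already in \<open>C j\<close>; as \<open>u\<close> is there too,
        \<open>aw\<close> and by saturation \<open>w\<close> lie in \<open>C j\<close>. Hence at
        most one step is visible in \<open>K + Rz\<close> but not in \<open>K\<close>.\<close>
      have no: False if ij: "i < j" and i: "i \<in> ?E" and j: "j \<in> ?E" for i j
      proof -
        have "C i \<inter> ?K' \<subseteq> C (Suc i) \<inter> ?K'" "C j \<inter> ?K' \<subseteq> C (Suc j) \<inter> ?K'"
          using C by (auto simp: local_chain_def)
        then obtain u w where u: "u \<in> C (Suc i)" "u \<in> ?K'" "u \<notin> C i"
          and w: "w \<in> C (Suc j)" "w \<in> ?K'" "w \<notin> C j" using i j by blast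
        obtain a b where a: "a \<in> carrier R" "cng K u (a \<cdot> z)" and b: "b \<in> carrier R" "cng K w (b \<cdot> z)"
          using u w by (auto simp: adj_def)
        have uc: "u \<in> carrier M" and wc: "w \<in> carrier M" using cng_carr a b by blast+
        have "u \<notin> K" using u i by blast
        then have aP: "a \<in> carrier R - P" using cng_mem[OF K(1) a(2)] colP a by blast
        have "cng K (a \<cdot> w) (a \<cdot> (b \<cdot> z))" using cng_smult[OF K(1) b(2) a(1)] .
        moreover have "cng K (b \<cdot> u) (a \<cdot> (b \<cdot> z))"
          using cng_smult[OF K(1) a(2) b(1)] smult_comm[of b a z] a b z by simp
        ultimately have "cng K (a \<cdot> w) (b \<cdot> u)" using cng_sym cng_trans K(1) by blast
        then have dK: "a \<cdot> w \<ominus>\<^bsub>M\<^esub> b \<cdot> u \<in> K" by (simp add: cng_def)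
        have uj: "u \<in> C j" using u(1) local_chain_mono[OF C, of "Suc i" j] ij by auto
        then have "u \<in> C (Suc j)" using local_chain_mono[OF C, of j "Suc j"] by auto
        then have "a \<cdot> w \<ominus>\<^bsub>M\<^esub> b \<cdot> u \<in> C (Suc j)"
          using submodule_diff[OF Cs] submoduleE(4)[OF Cs] a b w by simp
        then have "a \<cdot> w \<ominus>\<^bsub>M\<^esub> b \<cdot> u \<in> C j" using dK j by blast
        then have "cng (C j) (a \<cdot> w) (b \<cdot> u)" using a b uc wc by (simp add: cng_def)
        moreover have "b \<cdot> u \<in> C j" using submoduleE(4)[OF Cs] b uj by simp
        ultimately have "a \<cdot> w \<in> C j" using cng_mem[OF Cs] by blast
        then have "w \<in> sat P (C j)" using aP wc by (auto simp: sat_def)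
        then show False using CP w(3) by blast
      qed
      have fE: "finite ?E" by simp
      have "e1 = e2" if "e1 \<in> ?E" "e2 \<in> ?E" for e1 e2
        using no[OF _ that] no[OF _ that(2,1)] by (cases e1 e2 rule: linorder_cases) blast+
      then have "card ?E \<le> Suc 0"
        unfolding card_le_Suc0_iff_eq[OF fE] by blast
      moreover have "card ?D \<le> n" using n C unfolding good_def by blast
      moreover have "card {i. i < m \<and> C i \<inter> ?K' \<noteq> C (Suc i) \<inter> ?K'} \<le> card (?D \<union> ?E)"
        by (rule card_mono) auto
      moreover have "card (?D \<union> ?E) \<le> card ?D + card ?E" by (rule card_Un_le)
      ultimately show "card {i. i < m \<and> C i \<inter> ?K' \<noteq> C (Suc i) \<inter> ?K'} \<le> Suc n" by linarith
    qed
    then have "?K' \<in> F" using B K(2) by (auto simp: F_def)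
    then have "?K' = K" using max B(2) by blast
    then show False using B(3) zK by blast
  qed
  show ?thesis
  proof (intro exI allI impI)
    fix C and m :: nat assume C: "local_chain P N C"
    then have Cs: "\<And>i. submodule (C i) R M" and CP: "\<And>i. sat P (C i) \<subseteq> C i"
      by (auto simp: local_chain_def)
    have "C i = C (Suc i)" if e: "C i \<inter> K = C (Suc i) \<inter> K" for i
    proof
      show "C i \<subseteq> C (Suc i)" using C by (simp add: local_chain_def)
      show "C (Suc i) \<subseteq> C i"
      proof
        fix w assume w: "w \<in> C (Suc i)"
        have wc: "w \<in> carrier M" using submodule_carr[OF Cs w] .
        then obtain s where s: "s \<in> carrier R - P" "s \<cdot> w \<in> K" using MK by (auto simp: sat_def)
        then have "s \<cdot> w \<in> C i" using e submoduleE(4)[OF Cs] w by blast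
        then have "w \<in> sat P (C i)" using s wc by (auto simp: sat_def)
        then show "w \<in> C i" using CP by blast
      qed
    qed
    then have "card {i. i < m \<and> C i \<noteq> C (Suc i)} \<le> card {i. i < m \<and> C i \<inter> K \<noteq> C (Suc i) \<inter> K}"
      by (intro card_mono) auto
    also have "\<dots> \<le> n" using n C unfolding good_def by blast
    finally show "card {i. i < m \<and> C i \<noteq> C (Suc i)} \<le> n" .
  qed
qed

end

section \<open>Prime avoidance\<close>

lemma (in cring) prime_separation:
  assumes "finite F" and "\<And>Q'. Q' \<in> F \<Longrightarrow> primeideal Q' R \<and> \<not> Q' \<subseteq> Q"
    and Q: "primeideal Q R" and I: "ideal I R" "\<not> I \<subseteq> Q"
  shows "\<exists>b\<in>I. b \<notin> Q \<and> (\<forall>Q'\<in>F. b \<in> Q')"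
  using assms(1,2)
proof (induction F)
  case empty
  then show ?case using I by blast
next
  case (insert Q' F)
  then obtain b where b: "b \<in> I" "b \<notin> Q" "\<forall>Q'\<in>F. b \<in> Q'" by blast
  obtain c where c: "c \<in> Q'" "c \<notin> Q" using insert.prems by blast
  have Q': "primeideal Q' R" using insert.prems by blast
  have cR: "c \<in> carrier R" and bR: "b \<in> carrier R"
    using c prime_subset[OF Q'] b(1) ideal.Icarr[OF I(1)] by auto
  have "c \<otimes> b \<in> I" "c \<otimes> b \<notin> Q" "c \<otimes> b \<in> Q'"
    using ideal.I_l_closed[OF I(1) b(1) cR] primeideal.I_prime[OF Q cR bR] b(2) c(2) prime_absorb(1)[OF Q' c(1) bR]
    by blast+
  moreover have "c \<otimes> b \<in> Q''" if "Q'' \<in> F" for Q''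
    using prime_absorb(2)[of Q'' R b c] b(3) insert.prems that cR by simp
  ultimately show ?case by blast
qed

text \<open>A minimal member \<open>Q\<close> is removed, so that no other member lies inside it. If
  the element \<open>a\<close> avoiding the others falls into \<open>Q\<close>, it is corrected by
  some \<open>b\<close> in \<open>I\<close> that lies in all the others but not in \<open>Q\<close>,
  which \<open>prime_separation\<close> supplies as a product.\<close>

lemma (in cring) prime_avoidance:
  assumes "finite F" and "\<And>Q. Q \<in> F \<Longrightarrow> primeideal Q R \<and> \<not> I \<subseteq> Q" and I: "ideal I R"
  shows "\<exists>z\<in>I. \<forall>Q\<in>F. z \<notin> Q"
  using assms(1,2)
proof (induction "card F" arbitrary: F)
  case 0
  then have "F = {}" by simp
  then show ?case using additive_subgroup.zero_closed[OF ideal.axioms(1)[OF I]] by blast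
next
  case (Suc n)
  then have "F \<noteq> {}" by auto
  then obtain Q where Q: "Q \<in> F" and min: "\<And>Q'. Q' \<in> F \<Longrightarrow> Q' \<subseteq> Q \<Longrightarrow> Q' = Q"
    using finite_has_minimal[OF Suc.prems(1)] by metis
  have "\<exists>z\<in>I. \<forall>Q'\<in>F - {Q}. z \<notin> Q'"
    using Suc.hyps(2) Suc.prems Q by (intro Suc.hyps(1)) auto
  then obtain a where a: "a \<in> I" "\<forall>Q'\<in>F - {Q}. a \<notin> Q'" by blast
  show ?case
  proof (cases "a \<in> Q")
    case False
    then show ?thesis using a by blast
  next
    case True
    have prQ: "primeideal Q R" "\<not> I \<subseteq> Q" using Suc.prems Q by auto
    obtain b where b: "b \<in> I" "b \<notin> Q" "\<forall>Q'\<in>F - {Q}. b \<in> Q'"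
      using prime_separation[of "F - {Q}", OF _ _ prQ(1) I prQ(2)] Suc.prems min by blast
    have ab: "a \<in> carrier R" "b \<in> carrier R" using a b ideal.Icarr[OF I] by auto
    have ca: "a = \<ominus> b \<oplus> (a \<oplus> b)" "b = \<ominus> a \<oplus> (a \<oplus> b)"
      using ab by (simp_all add: a_comm[of a b] r_neg1 r_neg2, simp add: a_comm[of b a] r_neg1)
    have "a \<oplus> b \<notin> Q'" if "Q' \<in> F" for Q'
    proof
      assume s: "a \<oplus> b \<in> Q'"
      have pr: "primeideal Q' R" using that Suc.prems by blast
      have sg: "additive_subgroup Q' R" using ideal.axioms(1)[OF primeideal.axioms(1)[OF pr]] .
      show False
      proof (cases "Q' = Q")
        case True
        then show False
          using ca(2) prime_add[OF pr _ s, of "\<ominus> a"] additive_subgroup.a_inv_closed[OF sg] \<open>a \<in> Q\<close> b(2) is_abelian_group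
          by auto
      next
        case False
        then show False
          using ca(1) prime_add[OF pr _ s, of "\<ominus> b"] additive_subgroup.a_inv_closed[OF sg] that a(2) b(3) is_abelian_group
          by auto
      qed
    qed
    moreover have "a \<oplus> b \<in> I" using a b additive_subgroup.a_closed[OF ideal.axioms(1)[OF I]] by blast
    ultimately show ?thesis by blast
  qed
qed

section \<open>Finitely generated modules over Noetherian rings\<close>

lemma (in module) submodule_Inter:
  assumes "F \<noteq> {}" and "\<And>N. N \<in> F \<Longrightarrow> submodule N R M"
  shows "submodule (\<Inter>F) R M"
proof (rule submoduleI)
  show "\<Inter>F \<subseteq> carrier M" using assms submodule_carr by blast
qed (use assms(2) submodule_zero submoduleE(3,4,5) in blast)+

lemma (in module) submodule_gen_submodule:
  assumes "A \<subseteq> carrier M"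
  shows "submodule (submodule_gen R M A) R M" "A \<subseteq> submodule_gen R M A"
  unfolding submodule_gen_def
  using assms carrier_is_submodule by (auto intro!: submodule_Inter)

lemma (in module) submodule_gen_least:
  "submodule N R M \<Longrightarrow> A \<subseteq> N \<Longrightarrow> submodule_gen R M A \<subseteq> N"
  by (auto simp: submodule_gen_def)

text \<open>Induction on the generators, stated for families of submodules of the span so that the
  module stays fixed. A submodule \<open>L\<close> of the span of \<open>A\<close> and
  \<open>a\<close> is controlled by two invariants: its ideal of coefficients along
  \<open>a\<close>, and its intersection with the span of \<open>A\<close>.\<close>

lemma (in module) finitely_generated_noeth:
  assumes "noetherian_ring R" and "finitely_generated R M"
  shows "noeth_module R M"
proof -
  interpret N: noetherian_ring R by fact
  have *: "\<exists>L\<in>F. \<forall>L'\<in>F. L \<subseteq> L' \<longrightarrow> L' = L"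
    if "finite A" "A \<subseteq> carrier M" "F \<noteq> {}" "\<And>L. L \<in> F \<Longrightarrow> submodule L R M \<and> L \<subseteq> submodule_gen R M A" for A F
    using that
  proof (induction A arbitrary: F)
    case empty
    have "L = S0" if "L \<in> F" for L
      using empty.prems(3)[OF that] submodule_gen_least[OF submodule_zeroset, of "{}"] submodule_zero by blast
    then show ?case using empty.prems(2) by blast
  next
    case (insert a A)
    let ?S = "submodule_gen R M A"
    have a: "a \<in> carrier M" and A: "A \<subseteq> carrier M" using insert.prems by auto
    note S = submodule_gen_submodule[OF A]
    note B = adj_R_gen[OF S(1) a]
    have sub: "submodule L R M" "L \<subseteq> adj ?S (carrier R) a" if "L \<in> F" for L
      using insert.prems(3)[OF that] submodule_gen_least[OF B(1), of "insert a A"] B S by auto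
    \<comment> \<open>The coefficients of \<open>a\<close> that occur in elements of
      \<open>L\<close> modulo the span of \<open>A\<close>.\<close>
    define I where "I L = {c \<in> carrier R. \<exists>w\<in>L. cng ?S w (c \<cdot> a)}" for L
    have I: "ideal (I L) R" if "L \<in> F" for L
    proof (rule idealI[OF R.ring_axioms])
      note L = sub(1)[OF that]
      show "subgroup (I L) (add_monoid R)"
      proof (rule R.add.subgroupI)
        show "I L \<subseteq> carrier R" by (auto simp: I_def)
        have "cng ?S \<zero>\<^bsub>M\<^esub> (\<zero> \<cdot> a)" using a cng_refl[OF S(1)] by simp
        then have "\<zero> \<in> I L" using submodule_zero[OF L] by (auto simp: I_def)
        then show "I L \<noteq> {}" by blast
        show "\<ominus> c \<in> I L" if c: "c \<in> I L" for c
        proof -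
          from c obtain w where w: "w \<in> L" "cng ?S w (c \<cdot> a)" "c \<in> carrier R" by (auto simp: I_def)
          then show ?thesis using cng_minus[OF S(1) w(2)] a submoduleE(3)[OF L]
            by (auto simp: I_def smult_l_minus)
        qed
        show "c \<oplus> d \<in> I L" if cd: "c \<in> I L" "d \<in> I L" for c d
        proof -
          from cd obtain w v where w: "w \<in> L" "cng ?S w (c \<cdot> a)" "c \<in> carrier R"
            and v: "v \<in> L" "cng ?S v (d \<cdot> a)" "d \<in> carrier R" by (auto simp: I_def)
          then have "cng ?S (w \<oplus>\<^bsub>M\<^esub> v) ((c \<oplus> d) \<cdot> a)"
            using cng_add[OF S(1) w(2) v(2)] a by (simp add: smult_l_distr)
          then show ?thesis using w v submoduleE(5)[OF L w(1) v(1)] unfolding I_def by blast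
        qed
      qed
      show 1: "b \<otimes> c \<in> I L" if c: "c \<in> I L" "b \<in> carrier R" for b c
      proof -
        from c obtain w where w: "w \<in> L" "cng ?S w (c \<cdot> a)" "c \<in> carrier R" by (auto simp: I_def)
        then have "cng ?S (b \<cdot> w) ((b \<otimes> c) \<cdot> a)"
          using cng_smult[OF S(1) w(2) c(2)] a c(2) by (simp add: smult_assoc1)
        then show ?thesis using w c submoduleE(4)[OF L c(2) w(1)] unfolding I_def by blast
      qed
      show "c \<otimes> b \<in> I L" if c: "c \<in> I L" "b \<in> carrier R" for b c
        using 1[OF c] c R.m_comm[of c b] by (simp add: I_def)
    qed
    have "\<exists>T\<in>I ` F. \<forall>T'\<in>I ` F. T \<subseteq> T' \<longrightarrow> T' = T"
      by (rule N.ideal_family_maximal) (use insert.prems(2) I in auto)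
    then obtain L0 where L0: "L0 \<in> F" and max0: "\<And>L. L \<in> F \<Longrightarrow> I L0 \<subseteq> I L \<Longrightarrow> I L = I L0" by auto
    \<comment> \<open>Above \<open>L0\<close> the coefficient ideal is constant, so only the
      intersection with the span of \<open>A\<close> remains to be maximized.\<close>
    define F' where "F' = {L \<in> F. L0 \<subseteq> L}"
    have IF': "I L = I L0" if "L \<in> F'" for L
    proof (rule max0)
      show "L \<in> F" using that by (simp add: F'_def)
      show "I L0 \<subseteq> I L" using that by (auto simp: F'_def I_def)
    qed
    have "\<exists>T\<in>(\<lambda>L. L \<inter> ?S) ` F'. \<forall>T'\<in>(\<lambda>L. L \<inter> ?S) ` F'. T \<subseteq> T' \<longrightarrow> T' = T"
    proof (rule insert.IH)
      show "A \<subseteq> carrier M" by fact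
      show "(\<lambda>L. L \<inter> ?S) ` F' \<noteq> {}" using L0 by (auto simp: F'_def)
      show "submodule L R M \<and> L \<subseteq> ?S" if "L \<in> (\<lambda>L. L \<inter> ?S) ` F'" for L
        using that sub(1) submodule_int[OF _ S(1)] by (auto simp: F'_def)
    qed
    then obtain L where L: "L \<in> F'"
      and max: "\<And>L'. L' \<in> F' \<Longrightarrow> L \<inter> ?S \<subseteq> L' \<inter> ?S \<Longrightarrow> L' \<inter> ?S = L \<inter> ?S" by auto
    have LF: "L \<in> F" and L0L: "L0 \<subseteq> L" using L by (auto simp: F'_def)
    have "L' = L" if L': "L' \<in> F" "L \<subseteq> L'" for L'
    proof
      have L'F: "L' \<in> F'" using L' L0L by (auto simp: F'_def)
      have int: "L' \<inter> ?S = L \<inter> ?S" using max[OF L'F] L' by blast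
      show "L' \<subseteq> L"
      proof
        fix z assume z: "z \<in> L'"
        then obtain c where c: "c \<in> carrier R" "cng ?S z (c \<cdot> a)" using sub(2)[OF L'(1)] by (auto simp: adj_def)
        then have "c \<in> I L'" using z by (auto simp: I_def)
        then have "c \<in> I L" using IF'[OF L] IF'[OF L'F] by simp
        then obtain w where w: "w \<in> L" "cng ?S w (c \<cdot> a)" by (auto simp: I_def)
        \<comment> \<open>Equal coefficient ideals give \<open>w\<close> in \<open>L\<close> with
          the same coefficient as \<open>z\<close>; the difference lies in the span of
          \<open>A\<close>, where \<open>L\<close> and \<open>L'\<close> agree.\<close>
        have zw: "cng ?S z w" using cng_trans[OF S(1) c(2) cng_sym[OF S(1) w(2)]] .
        have "z \<ominus>\<^bsub>M\<^esub> w \<in> L'" using submodule_diff[OF sub(1)[OF L'(1)]] z w(1) L'(2) by blast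
        then have "z \<ominus>\<^bsub>M\<^esub> w \<in> L" using int zw by (auto simp: cng_def)
        then have "cng L z w" using zw by (simp add: cng_def)
        then show "z \<in> L" using cng_mem[OF sub(1)[OF LF]] w(1) by blast
      qed
    qed (fact L')
    then show ?case using LF by blast
  qed
  obtain A where A: "A \<subseteq> carrier M" "finite A" "submodule_gen R M A = carrier M"
    using assms(2) by (auto simp: finitely_generated_def)
  show ?thesis
  proof (intro noeth_module.intro noeth_module_axioms.intro)
    show "module R M" by (rule module_axioms)
    show "noetherian_ring R" by fact
    show "\<exists>L\<in>F. \<forall>L'\<in>F. L \<subseteq> L' \<longrightarrow> L' = L" if "F \<noteq> {}" "\<And>L. L \<in> F \<Longrightarrow> submodule L R M" for F
      by (rule *[OF A(2,1) that(1)]) (use that(2) A(3) submodule_carr in blast)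
  qed
qed

section \<open>Krull's principal ideal theorem\<close>

lemma self_module_simps [simp]:
  "carrier (self_module R) = carrier R" "smult (self_module R) = mult R"
  "zero (self_module R) = zero R" "add (self_module R) = add R"
  by (simp_all add: self_module_def)

lemma (in cring) self_module_module: "module R (self_module R)"
proof (rule moduleI)
  show "abelian_group (self_module R)"
    by (rule abelian_groupI) (auto simp: a_ac intro: add.l_inv_ex)
qed (auto simp: l_distr r_distr m_assoc cring_axioms)

lemma (in cring) submodule_self_iff: "submodule N R (self_module R) \<longleftrightarrow> ideal N R"
proof -
  interpret S: module R "self_module R" by (rule self_module_module)
  have ai: "\<ominus>\<^bsub>self_module R\<^esub> a = \<ominus> a" for a by (simp add: a_inv_def m_inv_def)
  show ?thesis
  proof
    assume N: "submodule N R (self_module R)"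
    show "ideal N R"
    proof (rule idealI[OF ring_axioms])
      show "subgroup N (add_monoid R)"
        by (rule add.subgroupI) (use S.submoduleE[OF N] ai in simp_all)
      show 1: "x \<otimes> a \<in> N" if "a \<in> N" "x \<in> carrier R" for a x
        using S.submoduleE(4)[OF N] that by simp
      show "a \<otimes> x \<in> N" if "a \<in> N" "x \<in> carrier R" for a x
        using 1[OF that] S.submodule_carr[OF N that(1)] that m_comm[of a x] by simp
    qed
  next
    assume N: "ideal N R"
    interpret N: ideal N R by fact
    show "submodule N R (self_module R)"
      by (rule S.submoduleI) (use N.a_subset N.I_l_closed ai in auto)
  qed
qed

locale noeth_cring = noetherian_ring R + cring R for R (structure)
begin

text \<open>Viewing the ring as a module over itself makes saturation, Nakayama's lemma and the
  chain bound available for ideals.\<close>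

lemma noeth_self: "noeth_module R (self_module R)"
proof (intro noeth_module.intro noeth_module_axioms.intro)
  show "module R (self_module R)" by (rule self_module_module)
  show "noetherian_ring R" by (rule noetherian_ring_axioms)
  show "\<exists>L\<in>F. \<forall>L'\<in>F. L \<subseteq> L' \<longrightarrow> L' = L" if "F \<noteq> {}" "\<And>L. L \<in> F \<Longrightarrow> submodule L R (self_module R)" for F
    using ideal_family_maximal that submodule_self_iff by blast
qed

lemma prime_pow:
  "primeideal Q R \<Longrightarrow> q \<in> carrier R \<Longrightarrow> q [^] (n::nat) \<in> Q \<Longrightarrow> q \<in> Q"
proof (induction n)
  case 0
  then show ?case using prime_compl(1)[of Q R] by simp
next
  case (Suc n)
  then show ?case using primeideal.I_prime[OF Suc.prems(1), of "q [^] n" q] by auto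
qed

text \<open>Krull's argument with symbolic powers \<open>Sy k\<close> of \<open>Q1\<close> modulo \<open>Q0\<close>: if \<open>P\<close> is minimal over \<open>Q0 + (x)\<close>,
  then the local chain \<open>Sy k + (x)\<close> becomes stationary, and two uses of Nakayama's lemma give
  \<open>Sy k = Sy (k + 1)\<close> and then \<open>Q1 \<subseteq> Q0\<close>.\<close>

lemma principal_ideal_theorem:
  assumes Q0: "primeideal Q0 R" and Q1: "primeideal Q1 R" and P: "primeideal P R"
    and sub: "Q0 \<subset> Q1" "Q1 \<subset> P" and x: "x \<in> P"
  shows "\<exists>P'. primeideal P' R \<and> Q0 \<subseteq> P' \<and> x \<in> P' \<and> P' \<subset> P"
proof (rule ccontr)
  assume neg: "\<not> ?thesis"
  then have min: "P' = P" if "primeideal P' R" "Q0 \<subseteq> P'" "x \<in> P'" "P' \<subseteq> P" for P' using that by blast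
  have xQ1: "x \<notin> Q1" using neg Q1 sub by blast
  have xR: "x \<in> carrier R" using x prime_subset[OF P] by blast
  interpret S: noeth_module R "self_module R" by (rule noeth_self)
  have sm: "submodule I R (self_module R)" if "primeideal I R" for I
    using that submodule_self_iff primeideal.axioms(1) by blast
  note cs = S.carrier_is_submodule
  \<comment> \<open>The least submodule containing \<open>Q0\<close> and all products from
    \<open>Q1\<close> and \<open>K\<close>, that is, \<open>Q0 + Q1 K\<close>.\<close>
  define T where "T K = \<Inter>{W. submodule W R (self_module R) \<and> Q0 \<subseteq> W \<and> (\<forall>j\<in>Q1. \<forall>k\<in>K. j \<otimes> k \<in> W)}" for K
  have T: "submodule (T K) R (self_module R)" "Q0 \<subseteq> T K" "\<And>j k. j \<in> Q1 \<Longrightarrow> k \<in> K \<Longrightarrow> j \<otimes> k \<in> T K"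
    if K: "K \<subseteq> carrier R" for K
  proof -
    have "carrier R \<in> {W. submodule W R (self_module R) \<and> Q0 \<subseteq> W \<and> (\<forall>j\<in>Q1. \<forall>k\<in>K. j \<otimes> k \<in> W)}"
      using cs prime_subset[OF Q0] prime_subset[OF Q1] K by auto
    then show "submodule (T K) R (self_module R)" unfolding T_def by (intro S.submodule_Inter) auto
  qed (auto simp: T_def)
  have T_least: "T K \<subseteq> W"
    if "submodule W R (self_module R)" "Q0 \<subseteq> W" "\<And>j k. j \<in> Q1 \<Longrightarrow> k \<in> K \<Longrightarrow> j \<otimes> k \<in> W" for K W
    using that by (auto simp: T_def)
  \<comment> \<open>Saturating at \<open>Q1\<close> after each multiplication ensures that
    \<open>x\<close>, which is outside \<open>Q1\<close>, can be cancelled: \<open>xc\<close> in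
    \<open>Sy k\<close> implies \<open>c\<close> in \<open>Sy k\<close>.\<close>
  define Sy where "Sy = rec_nat (carrier R) (\<lambda>_ K. S.sat Q1 (T K))"
  have Sy0: "Sy 0 = carrier R" and SyS: "\<And>k. Sy (Suc k) = S.sat Q1 (T (Sy k))" by (simp_all add: Sy_def)
  have Sy: "submodule (Sy k) R (self_module R) \<and> Q0 \<subseteq> Sy k \<and> S.sat Q1 (Sy k) \<subseteq> Sy k" for k
  proof (induction k)
    case 0
    show ?case using cs prime_subset[OF Q0] by (auto simp: Sy0 S.sat_def)
  next
    case (Suc k)
    then have "Sy k \<subseteq> carrier R" using S.submoduleE(1) by force
    note Tk = T[OF this]
    show ?case unfolding SyS
      using S.sat_submodule[OF Tk(1) Q1] S.sat_sat[OF Tk(1) Q1] Tk(2) S.sat_sup[OF Tk(1) Q1] by blast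
  qed
  have SyR: "Sy k \<subseteq> carrier R" for k using Sy[of k] S.submoduleE(1) by force
  have Sy_dec: "Sy (Suc k) \<subseteq> Sy k" for k
  proof -
    have "T (Sy k) \<subseteq> Sy k"
      by (rule T_least) (use Sy[of k] S.submoduleE(4)[of "Sy k"] prime_subset[OF Q1] in auto)
    then show ?thesis unfolding SyS using S.sat_mono[of "T (Sy k)" "Sy k" Q1] Sy[of k] by blast
  qed
  define D where "D k = S.sat P (S.addm (Sy k) x (carrier R))" for k
  have A: "submodule (S.addm (Sy k) x (carrier R)) R (self_module R)" "Sy k \<subseteq> S.addm (Sy k) x (carrier R)" for k
    using S.addm_submodule[OF conjunct1[OF Sy[of k]] xR cs] S.addm_sup(1)[OF conjunct1[OF Sy[of k]] xR cs] by simp_all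
  have A3: "x \<otimes> v \<in> S.addm (Sy k) x (carrier R)" if "v \<in> carrier R" for v k
    using S.addm_sup(2)[OF conjunct1[OF Sy[of k]] xR cs, of v] that by simp
  have D: "submodule (D k) R (self_module R)" "S.addm (Sy k) x (carrier R) \<subseteq> D k" "S.sat P (D k) \<subseteq> D k" for k
    unfolding D_def using S.sat_submodule[OF A(1) P] S.sat_sup[OF A(1) P] S.sat_sat[OF A(1) P] by auto
  have D_dec: "D (Suc k) \<subseteq> D k" for k
    unfolding D_def
    by (intro S.sat_mono S.addm_least A order.trans[OF Sy_dec A(2)]) (simp add: A3)
  let ?N = "S.addm Q0 x (carrier R)"
  have N: "submodule ?N R (self_module R)" "Q0 \<subseteq> ?N" "x \<otimes> \<one> \<in> ?N"
    using S.addm_submodule[OF sm[OF Q0] xR cs] S.addm_sup(1)[OF sm[OF Q0] xR cs]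
      S.addm_sup(2)[OF sm[OF Q0] xR cs, of \<one>] by auto
  have "\<exists>n. \<forall>C m. S.local_chain P ?N C \<longrightarrow> card {i. i < m \<and> C i \<noteq> C (Suc i)} \<le> n"
  proof (rule S.local_chain_bounded[OF N(1) P])
    fix Q assume Q: "primeideal Q R" "Q \<subseteq> P"
      and "{a \<in> carrier R. \<forall>z\<in>carrier (self_module R). a \<odot>\<^bsub>self_module R\<^esub> z \<in> ?N} \<subseteq> Q"
    moreover have "?N \<subseteq> {a \<in> carrier R. \<forall>z\<in>carrier (self_module R). a \<odot>\<^bsub>self_module R\<^esub> z \<in> ?N}"
    proof
      fix a assume a: "a \<in> ?N"
      then have "a \<in> carrier R" using S.submodule_carr[OF N(1)] by simp
      then show "a \<in> {a \<in> carrier R. \<forall>z\<in>carrier (self_module R). a \<odot>\<^bsub>self_module R\<^esub> z \<in> ?N}"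
        using S.submoduleE(4)[OF N(1) _ a] m_comm by auto
    qed
    ultimately have "?N \<subseteq> Q" by blast
    then show "Q = P" using min[OF Q(1) _ _ Q(2)] N xR by auto
  qed
  then obtain n where n: "\<And>C m. S.local_chain P ?N C \<Longrightarrow> card {i. i < m \<and> C i \<noteq> C (Suc i)} \<le> n" by blast
  \<comment> \<open>The submodules \<open>D k\<close> decrease, so they are listed backwards to
    obtain an increasing chain. With one step more than the bound \<open>n\<close> allows, some step
    is an equality.\<close>
  define m where "m = Suc n"
  have "S.local_chain P ?N (\<lambda>i. D (m - i))"
    unfolding S.local_chain_def
  proof (intro allI conjI)
    fix i
    show "submodule (D (m - i)) R (self_module R)" "S.sat P (D (m - i)) \<subseteq> D (m - i)" using D by auto
    show "D (m - i) \<subseteq> D (m - Suc i)"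
      using D_dec[of "m - Suc i"] by (cases "i < m") (auto simp: Suc_diff_Suc)
    have "?N \<subseteq> S.addm (Sy (m - i)) x (carrier R)"
      using A(1) A3 order.trans[OF conjunct1[OF conjunct2[OF Sy[of "m - i"]]] A(2)] by (intro S.addm_least) simp_all
    then show "?N \<subseteq> D (m - i)" using D(2) by blast
  qed
  from n[OF this, of m] have "card {i. i < m \<and> D (m - i) \<noteq> D (m - Suc i)} < card {..<m}"
    unfolding m_def by simp
  then have "{i. i < m \<and> D (m - i) \<noteq> D (m - Suc i)} \<noteq> {..<m}" by (metis less_irrefl)
  then obtain i where "i < m" "D (m - i) = D (m - Suc i)" by blast
  then have "D (Suc (m - Suc i)) = D (m - Suc i)" by (simp add: Suc_diff_Suc)
  then obtain k where k: "D k = D (Suc k)" by metis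
  note Syk = conjunct1[OF Sy[of k]] and SySk = conjunct1[OF Sy[of "Suc k"]]
  have "Sy k \<subseteq> S.sat P (Sy (Suc k))"
  proof (rule S.nakayama[OF Syk SySk P primeideal.axioms(1)[OF P]])
    fix W assume W: "submodule W R (self_module R)" "Sy (Suc k) \<subseteq> W"
      and JW: "\<And>j a. j \<in> P \<Longrightarrow> a \<in> Sy k \<Longrightarrow> j \<odot>\<^bsub>self_module R\<^esub> a \<in> W"
    show "Sy k \<subseteq> S.sat P W"
    proof
      fix a assume a: "a \<in> Sy k"
      then have aR: "a \<in> carrier R" using SyR by blast
      have "a \<in> D (Suc k)" using a A(2) D(2) k by blast
      then obtain s c where s: "s \<in> carrier R - P" and c: "c \<in> carrier R"
        and cg: "S.cng (Sy (Suc k)) (s \<otimes> a) (x \<otimes> c)"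
        unfolding D_def using S.sat_addmE[OF SySk P xR, of "carrier R" a] by auto
      have "s \<otimes> a \<in> Sy k" using S.submoduleE(4)[OF Syk _ a] s by simp
      then have "x \<otimes> c \<in> Sy k" using S.cng_mem[OF Syk S.cng_mono[OF cg Sy_dec]] by blast
      \<comment> \<open>Cancelling \<open>x\<close> is what turns \<open>Sy k\<close> inside
        \<open>Sy (Suc k) + (x)\<close> into \<open>Sy k\<close> inside
        \<open>Sy (Suc k) + x Sy k\<close>, locally at \<open>P\<close>; this is the form that
        Nakayama's lemma accepts.\<close>
      then have "c \<in> S.sat Q1 (Sy k)" using xQ1 xR c by (auto simp: S.sat_def)
      then have "c \<in> Sy k" using Sy by blast
      then have "x \<otimes> c \<in> W" using JW[OF x] by simp
      then have "s \<otimes> a \<in> W" using S.cng_mem[OF W(1) S.cng_mono[OF cg W(2)]] by blast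
      then show "a \<in> S.sat P W" using s aR by (auto simp: S.sat_def)
    qed
  qed simp
  also have "\<dots> \<subseteq> S.sat Q1 (Sy (Suc k))" using S.sat_antimono sub(2) by blast
  also have "\<dots> \<subseteq> Sy (Suc k)" using Sy by blast
  finally have SyTk: "Sy k \<subseteq> S.sat Q1 (T (Sy k))" unfolding SyS .
  \<comment> \<open>Now \<open>Sy k\<close> agrees with \<open>Q0 + Q1 Sy k\<close> locally at
    \<open>Q1\<close>, so Nakayama's lemma at \<open>Q1\<close> leaves only \<open>Q0\<close>. Since
    \<open>Sy k\<close> contains the \<open>k\<close>-th powers of elements of \<open>Q1\<close>,
    this contradicts the strict inclusion of \<open>Q0\<close> in \<open>Q1\<close>.\<close>
  have "Sy k \<subseteq> S.sat Q1 Q0"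
  proof (rule S.nakayama[OF Syk sm[OF Q0] Q1 primeideal.axioms(1)[OF Q1]])
    fix W assume "submodule W R (self_module R)" "Q0 \<subseteq> W"
      and "\<And>j a. j \<in> Q1 \<Longrightarrow> a \<in> Sy k \<Longrightarrow> j \<odot>\<^bsub>self_module R\<^esub> a \<in> W"
    then have "T (Sy k) \<subseteq> W" by (intro T_least) auto
    then show "Sy k \<subseteq> S.sat Q1 W" using SyTk S.sat_mono by blast
  qed simp
  moreover obtain q where q: "q \<in> Q1" "q \<notin> Q0" using sub by blast
  have qR: "q \<in> carrier R" using q prime_subset[OF Q1] by blast
  have "q [^] j \<in> Sy j" for j :: nat
  proof (induction j)
    case 0
    show ?case by (simp add: Sy0)
  next
    case (Suc j)
    have "q \<otimes> q [^] j \<in> T (Sy j)" using T(3)[OF SyR q(1) Suc] .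
    then have "q [^] Suc j \<in> T (Sy j)" using qR nat_pow_Suc2 by metis
    then show ?case unfolding SyS using S.sat_sup[OF T(1)[OF SyR] Q1] by blast
  qed
  ultimately have "q [^] k \<in> S.sat Q1 Q0" by blast
  then obtain s where s: "s \<in> carrier R - Q1" "s \<otimes> q [^] k \<in> Q0" by (auto simp: S.sat_def)
  then have "q [^] k \<in> Q0" using prime_mult_cancel[OF Q0 s(2)] qR sub by blast
  then show False using prime_pow[OF Q0 qR] q(2) by blast
qed

end

section \<open>Chains of primes\<close>

text \<open>A chain with \<open>n\<close> strict inclusions and prescribed ends; primes may be
  skipped, so \<open>n\<close> is only a lower bound for the distance. The recursion is at the lower
  end, where the inductions below modify the chain.\<close>

primrec prime_chain :: "('a, 'e) ring_scheme \<Rightarrow> nat \<Rightarrow> 'a set \<Rightarrow> 'a set \<Rightarrow> bool"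
  where "prime_chain R 0 Q P \<longleftrightarrow> primeideal Q R \<and> Q = P"
  | "prime_chain R (Suc n) Q P \<longleftrightarrow> primeideal Q R \<and> (\<exists>Q'. Q \<subset> Q' \<and> prime_chain R n Q' P)"

lemma prime_chain_primes:
  "prime_chain R n Q P \<Longrightarrow> primeideal Q R" "prime_chain R n Q P \<Longrightarrow> primeideal P R"
proof -
  show "prime_chain R n Q P \<Longrightarrow> primeideal Q R" by (cases n) auto
  show "prime_chain R n Q P \<Longrightarrow> primeideal P R" by (induction n arbitrary: Q) auto
qed

lemma prime_chain_subset: "prime_chain R n Q P \<Longrightarrow> Q \<subseteq> P"
proof (induction n arbitrary: Q)
  case (Suc n)
  then show ?case by fastforce
qed simp

lemma prime_chain_self: "prime_chain R n P P \<Longrightarrow> n = 0"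
  by (cases n) (auto dest: prime_chain_subset)

lemma prime_chain_trans:
  "prime_chain R n Q P \<Longrightarrow> prime_chain R m P T \<Longrightarrow> prime_chain R (n + m) Q T"
  by (induction n arbitrary: Q) auto

lemma prime_chain_step:
  assumes "primeideal Q R" "primeideal P R" "Q \<subseteq> P"
  shows "\<exists>n. prime_chain R n Q P \<and> (Q \<noteq> P \<longrightarrow> n = 1)"
proof (cases "Q = P")
  case True
  then have "prime_chain R 0 Q P" using assms by simp
  then show ?thesis using True by blast
next
  case False
  then have "prime_chain R 1 Q P" using assms by auto
  then show ?thesis by blast
qed

context noeth_cring
begin

text \<open>Requiring the lower end to contain \<open>x\<close> costs at most one step. Applied
  above \<open>Q\<close>, the induction hypothesis gives a prime \<open>Q'\<close> over
  \<open>Q1\<close> containing \<open>x\<close>; the principal ideal theorem for \<open>Q\<close>,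
  \<open>Q1\<close>, \<open>Q'\<close> then inserts below \<open>Q'\<close> another prime containing
  \<open>x\<close>, which restores the missing step.\<close>

lemma prime_chain_drop:
  "prime_chain R (Suc n) Q P \<Longrightarrow> x \<in> P \<Longrightarrow> \<exists>Q'. Q \<subseteq> Q' \<and> x \<in> Q' \<and> prime_chain R n Q' P"
proof (induction n arbitrary: Q)
  case 0
  then show ?case by auto
next
  case (Suc n)
  from Suc.prems(1) obtain Q1 where Q1: "primeideal Q R" "Q \<subset> Q1" "prime_chain R (Suc n) Q1 P"
    by (simp only: prime_chain.simps(2)[of R "Suc n"]) blast
  from Suc.IH[OF Q1(3) Suc.prems(2)] obtain Q' where Q': "Q1 \<subseteq> Q'" "x \<in> Q'" "prime_chain R n Q' P" by blast
  have pr: "primeideal Q1 R" "primeideal Q' R" using prime_chain_primes(1) Q1(3) Q'(3) by blast+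
  show ?case
  proof (cases "Q1 = Q'")
    case True
    then show ?thesis using Q1 Q' by blast
  next
    case False
    then have "Q1 \<subset> Q'" using Q' by blast
    then obtain Q'' where "primeideal Q'' R" "Q \<subseteq> Q''" "x \<in> Q''" "Q'' \<subset> Q'"
      using principal_ideal_theorem[OF Q1(1) pr Q1(2) _ Q'(2)] by blast
    then show ?thesis using Q'(3) by (intro exI[of _ Q'']) auto
  qed
qed

text \<open>The subtraction is truncated: a chain shorter than the list shrinks to the single prime
  \<open>P\<close>, which contains the whole list.\<close>

lemma prime_chain_drop_list:
  "prime_chain R n Q P \<Longrightarrow> set xs \<subseteq> P \<Longrightarrow>
    \<exists>Q'. Q \<subseteq> Q' \<and> set xs \<subseteq> Q' \<and> prime_chain R (n - length xs) Q' P"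
proof (induction xs arbitrary: n Q)
  case Nil
  then show ?case by auto
next
  case (Cons x xs)
  show ?case
  proof (cases n)
    case 0
    then show ?thesis using Cons.prems by auto
  next
    case (Suc k)
    then obtain Q' where Q': "Q \<subseteq> Q'" "x \<in> Q'" "prime_chain R k Q' P"
      using prime_chain_drop[of k Q P x] Cons.prems by auto
    from Cons.IH[OF Q'(3)] Cons.prems obtain Q'' where
      "Q' \<subseteq> Q''" "set xs \<subseteq> Q''" "prime_chain R (k - length xs) Q'' P" by auto
    then show ?thesis using Q' Suc by (intro exI[of _ Q'']) auto
  qed
qed

end

section \<open>Regular sequences, locally at a prime\<close>

context module
begin

definition seqm :: "'c set \<Rightarrow> 'a list \<Rightarrow> 'c set"
  where "seqm N xs = foldl (\<lambda>N x. addm N x (carrier M)) N xs"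

text \<open>The non-vanishing of the last quotient is left out. For elements of a prime
  \<open>P\<close> in the support it follows from Nakayama's lemma, through
  \<open>supp_seqm\<close>.\<close>

primrec regseq :: "'a set \<Rightarrow> 'c set \<Rightarrow> 'a list \<Rightarrow> bool"
  where "regseq P N [] \<longleftrightarrow> True"
  | "regseq P N (x # xs) \<longleftrightarrow> reg P N x \<and> regseq P (addm N x (carrier M)) xs"

definition supp :: "'c set \<Rightarrow> 'a set set"
  where "supp N = {Q. primeideal Q R \<and> \<not> carrier M \<subseteq> sat Q N}"

lemma seqm_simps [simp]:
  "seqm N [] = N" "seqm N (x # xs) = seqm (addm N x (carrier M)) xs"
  "seqm N (xs @ ys) = seqm (seqm N xs) ys"
  by (simp_all add: seqm_def)

lemma addm_carr:
  assumes "submodule N R M" "x \<in> carrier R"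
  shows "submodule (addm N x (carrier M)) R M" "N \<subseteq> addm N x (carrier M)"
    "v \<in> carrier M \<Longrightarrow> x \<cdot> v \<in> addm N x (carrier M)"
  using addm_submodule[OF assms carrier_is_submodule] addm_sup[OF assms carrier_is_submodule] by simp_all

lemma seqm_submodule: "submodule N R M \<Longrightarrow> set xs \<subseteq> carrier R \<Longrightarrow> submodule (seqm N xs) R M"
  by (induction xs arbitrary: N) (auto simp: addm_carr)

lemma seqm_mono: "submodule N R M \<Longrightarrow> set xs \<subseteq> carrier R \<Longrightarrow> N \<subseteq> seqm N xs"
proof (induction xs arbitrary: N)
  case (Cons x xs)
  then show ?case using addm_carr[of N x] Cons.IH[of "addm N x (carrier M)"] by auto
qed simp

lemma regseq_append: "regseq P N (xs @ ys) \<longleftrightarrow> regseq P N xs \<and> regseq P (seqm N xs) ys"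
  by (induction xs arbitrary: N) auto

lemma regseq_iff_nth:
  "regseq P N xs \<longleftrightarrow> (\<forall>i<length xs. reg P (seqm N (take i xs)) (xs ! i))"
proof (induction xs rule: rev_induct)
  case (snoc x xs)
  then show ?case by (auto simp: regseq_append nth_append less_Suc_eq)
qed simp

lemma supp_prime: "Q \<in> supp N \<Longrightarrow> primeideal Q R"
  by (simp add: supp_def)

lemma supp_iff_col:
  "Q \<in> supp N \<longleftrightarrow> primeideal Q R \<and> (\<exists>y\<in>carrier M. col N y \<subseteq> Q)"
  using notin_sat[of _ Q N] by (auto simp: supp_def)

lemma supp_up: "Q \<in> supp N \<Longrightarrow> Q \<subseteq> Q' \<Longrightarrow> primeideal Q' R \<Longrightarrow> Q' \<in> supp N"
  unfolding supp_iff_col by blast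

lemma ass_supp: "Q \<in> ass N \<Longrightarrow> Q \<in> supp N"
  unfolding supp_iff_col ass_def by blast

end

sublocale noeth_module \<subseteq> R?: noeth_cring R ..

context noeth_module
begin

section \<open>Supports of quotients and their behaviour along sequences\<close>

lemma supp_ass:
  assumes "submodule N R M" "Q \<in> supp N"
  shows "\<exists>Q0\<in>ass N. Q0 \<subseteq> Q"
proof -
  obtain y where y: "y \<in> carrier M" "col N y \<subseteq> Q" and Q: "primeideal Q R"
    using assms(2) supp_iff_col by blast
  then obtain c where "c \<in> carrier R" "col N (c \<cdot> y) \<in> ass N" "col N (c \<cdot> y) \<subseteq> Q"
    "primeideal (col N (c \<cdot> y)) R"
    using ass_below[OF assms(1) Q y] by blast
  then show ?thesis by blast
qed

text \<open>If \<open>M/N\<close> vanishes at \<open>Q\<close>, a common denominator lies in its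
  annihilator and outside \<open>Q\<close>; this is where finite generation enters.\<close>

lemma supp_iff_ann:
  assumes N: "submodule N R M" and Q: "primeideal Q R"
  shows "Q \<in> supp N \<longleftrightarrow> {a \<in> carrier R. \<forall>z\<in>carrier M. a \<cdot> z \<in> N} \<subseteq> Q"
proof
  assume "Q \<in> supp N"
  then show "{a \<in> carrier R. \<forall>z\<in>carrier M. a \<cdot> z \<in> N} \<subseteq> Q"
    by (auto simp: supp_iff_col col_def)
next
  assume a: "{a \<in> carrier R. \<forall>z\<in>carrier M. a \<cdot> z \<in> N} \<subseteq> Q"
  show "Q \<in> supp N"
  proof (rule ccontr)
    assume "Q \<notin> supp N"
    then have "carrier M \<subseteq> sat Q N" using Q by (simp add: supp_def)
    then show False using sat_uniform[OF N carrier_is_submodule Q] a by blast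
  qed
qed

text \<open>If \<open>x\<close> lies in \<open>Q\<close>, the vanishing of \<open>M/(N + xM)\<close>
  at \<open>Q\<close> forces that of \<open>M/N\<close> by Nakayama's lemma. If \<open>x\<close> is
  outside \<open>Q\<close>, it is invertible there and the quotient vanishes.\<close>

lemma supp_addm:
  assumes N: "submodule N R M" and x: "x \<in> carrier R"
  shows "supp (addm N x (carrier M)) = {Q \<in> supp N. x \<in> Q}"
proof (rule Set.set_eqI, rule iffI)
  note N1 = addm_carr[OF N x]
  fix Q assume "Q \<in> supp (addm N x (carrier M))"
  then obtain y where Q: "primeideal Q R" and y: "y \<in> carrier M" "col (addm N x (carrier M)) y \<subseteq> Q"
    by (auto simp: supp_iff_col)
  have "col N y \<subseteq> Q" using y N1(2) by (auto simp: col_def)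
  moreover have "x \<in> Q" using y N1(3) x by (auto simp: col_def)
  ultimately show "Q \<in> {Q \<in> supp N. x \<in> Q}" using Q y by (auto simp: supp_iff_col)
next
  note N1 = addm_carr[OF N x]
  fix Q assume "Q \<in> {Q \<in> supp N. x \<in> Q}"
  then have Q: "primeideal Q R" "\<not> carrier M \<subseteq> sat Q N" "x \<in> Q" by (auto simp: supp_def)
  have "\<not> carrier M \<subseteq> sat Q (addm N x (carrier M))"
  proof
    assume a: "carrier M \<subseteq> sat Q (addm N x (carrier M))"
    have "carrier M \<subseteq> sat Q N"
    proof (rule nakayama[OF carrier_is_submodule N Q(1) primeideal.axioms(1)[OF Q(1)]])
      fix W assume "submodule W R M" "N \<subseteq> W" "\<And>j k. j \<in> Q \<Longrightarrow> k \<in> carrier M \<Longrightarrow> j \<cdot> k \<in> W"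
      then have "addm N x (carrier M) \<subseteq> W" using Q(3) by (intro addm_least) auto
      then show "carrier M \<subseteq> sat Q W" using a sat_mono by blast
    qed simp
    then show False using Q(2) by blast
  qed
  then show "Q \<in> supp (addm N x (carrier M))" using Q by (simp add: supp_def)
qed

lemma supp_seqm:
  "submodule N R M \<Longrightarrow> set xs \<subseteq> carrier R \<Longrightarrow> supp (seqm N xs) = {Q \<in> supp N. set xs \<subseteq> Q}"
proof (induction xs arbitrary: N)
  case (Cons x xs)
  then show ?case
    using Cons.IH[of "addm N x (carrier M)"] addm_carr(1)[of N x] supp_addm[of N x] by auto
qed simp

text \<open>Each regular element moves an associated prime strictly upwards by
  \<open>ass_climb\<close>. This is the bound of depth by the dimension of \<open>R_P\<close> modulo
  any associated prime, in terms of chains.\<close>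

lemma regseq_climb:
  assumes "submodule N R M" "primeideal P R" "set ys \<subseteq> P" "regseq P N ys" "Q \<in> ass N" "Q \<subseteq> P"
  shows "\<exists>n\<ge>length ys. prime_chain R n Q P"
  using assms
proof (induction ys arbitrary: N Q)
  case Nil
  then show ?case using prime_chain_step[OF ass_prime, of Q N P] by auto
next
  case (Cons y ys)
  have y: "y \<in> P" "y \<in> carrier R" using Cons.prems prime_subset[OF Cons.prems(2)] by auto
  obtain Q' where Q': "Q' \<in> ass (addm N y (carrier M))" "Q \<subset> Q'" "Q' \<subseteq> P"
    using ass_climb[OF Cons.prems(1,2,5,6) y(1)] Cons.prems(4) by auto
  then obtain n where "n \<ge> length ys" "prime_chain R n Q' P"
    using Cons.IH[OF addm_carr(1)[OF Cons.prems(1) y(2)] Cons.prems(2) _ _ Q'(1,3)] Cons.prems by auto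
  then show ?case using Q' ass_prime[OF Cons.prems(5)] by (intro exI[of _ "Suc n"]) auto
qed

text \<open>An element \<open>u\<close> killed by \<open>P\<close> modulo \<open>xM\<close> gives \<open>yu = xv\<close>, and then \<open>v\<close> is killed by \<open>P\<close> modulo
  \<open>yM\<close>: this is the isomorphism of the socles of \<open>M/xM\<close> and \<open>M/yM\<close>.\<close>

lemma ass_exchange:
  assumes N: "submodule N R M" and P: "primeideal P R" and x: "x \<in> P" "reg P N x"
    and y: "y \<in> P" "reg P N y" and ass: "P \<in> ass (addm N x (carrier M))"
  shows "P \<in> ass (addm N y (carrier M))"
proof -
  have xR: "x \<in> carrier R" and yR: "y \<in> carrier R" using x y prime_subset[OF P] by auto
  let ?X = "addm N x (carrier M)" and ?Y = "addm N y (carrier M)"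
  note X = addm_carr[OF N xR] and Y = addm_carr[OF N yR]
  note NP = sat_submodule[OF N P] and NNP = sat_sup[OF N P]
  obtain u where u: "u \<in> carrier M" "P = col ?X u" using ass by (auto simp: ass_def)
  have PuX: "p \<cdot> u \<in> ?X" if "p \<in> P" for p using u(2) that by (auto simp: col_def)
  obtain v where v: "v \<in> carrier M" "cng N (y \<cdot> u) (x \<cdot> v)"
    using PuX[OF y(1)] by (auto simp: addm_def)
  have Pv: "p \<cdot> v \<in> sat P ?Y" if p: "p \<in> P" for p
  proof -
    have pR: "p \<in> carrier R" using p prime_subset[OF P] by blast
    obtain w where w: "w \<in> carrier M" "cng N (p \<cdot> u) (x \<cdot> w)"
      using PuX[OF p] by (auto simp: addm_def)
    have "cng N (x \<cdot> (p \<cdot> v)) (y \<cdot> (p \<cdot> u))"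
      using cng_sym[OF N cng_smult[OF N v(2) pR]] smult_comm[of p y u] smult_comm[of p x v] pR xR yR u v
      by simp
    moreover have "cng N (y \<cdot> (p \<cdot> u)) (x \<cdot> (y \<cdot> w))"
      using cng_smult[OF N w(2) yR] smult_comm[of y x w] xR yR w by simp
    ultimately have "cng N (x \<cdot> (p \<cdot> v)) (x \<cdot> (y \<cdot> w))" by (rule cng_trans[OF N])
    then have c: "cng (sat P N) (p \<cdot> v) (y \<cdot> w)"
      using reg_cancel[OF N x(2) xR _ _ cng_mono[OF _ NNP]] pR yR v w by simp
    show ?thesis
      by (rule sat_addmI[OF P N yR w(1) prime_compl(1)[OF P]]) (use c pR v w yR in simp_all)
  qed
  \<comment> \<open>The same computation with \<open>x\<close> and \<open>y\<close> exchanged: if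
    \<open>v\<close> vanished modulo \<open>yM\<close>, then \<open>yu = xv\<close> would make
    \<open>u\<close> vanish modulo \<open>xM\<close>.\<close>
  have "v \<notin> sat P ?Y"
  proof
    assume "v \<in> sat P ?Y"
    then obtain s w where s: "s \<in> carrier R - P" and w: "w \<in> carrier M" "cng N (s \<cdot> v) (y \<cdot> w)"
      using sat_addmE[OF N P yR subset_refl] by metis
    have "cng N (y \<cdot> (s \<cdot> u)) (x \<cdot> (s \<cdot> v))"
      using cng_smult[OF N v(2), of s] smult_comm[of s y u] smult_comm[of s x v] s xR yR u v by simp
    moreover have "cng N (x \<cdot> (s \<cdot> v)) (y \<cdot> (x \<cdot> w))"
      using cng_smult[OF N w(2) xR] smult_comm[of y x w] xR yR w by simp
    ultimately have "cng N (y \<cdot> (s \<cdot> u)) (y \<cdot> (x \<cdot> w))" by (rule cng_trans[OF N])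
    then have "cng (sat P N) (s \<cdot> u) (x \<cdot> w)"
      using reg_cancel[OF N y(2) yR _ _ cng_mono[OF _ NNP]] s xR u w by simp
    then have "u \<in> sat P ?X" using sat_addmI[OF P N xR w(1) s u(1)] by blast
    then show False using notin_sat[OF u(1)] u(2) by blast
  qed
  then have "col ?Y v \<subseteq> P" using notin_sat[OF v(1)] by blast
  then obtain c where c: "c \<in> carrier R" "col ?Y (c \<cdot> v) \<in> ass ?Y" "col ?Y (c \<cdot> v) \<subseteq> P"
    and pr: "primeideal (col ?Y (c \<cdot> v)) R"
    by (rule ass_below[OF Y(1) P v(1)])
  have "P \<subseteq> col ?Y (c \<cdot> v)"
  proof
    fix p assume p: "p \<in> P"
    have pR: "p \<in> carrier R" using p prime_subset[OF P] by blast
    obtain s where s: "s \<in> carrier R - P" "s \<cdot> (p \<cdot> v) \<in> ?Y" using Pv[OF p] by (auto simp: sat_def)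
    then have "s \<otimes> p \<in> col ?Y v" using pR v by (simp add: col_def smult_assoc1)
    then have "s \<otimes> p \<in> col ?Y (c \<cdot> v)" using col_mult_sup[OF Y(1) v(1) c(1)] by blast
    then show "p \<in> col ?Y (c \<cdot> v)" using prime_mult_cancel[OF pr _ _ pR] s c(3) by blast
  qed
  then show ?thesis using c by auto
qed

text \<open>Prime avoidance for the finitely many associated primes inside \<open>P\<close> of all
  the given quotients: each is strictly smaller than \<open>P\<close>, so one element of
  \<open>P\<close> avoids them all.\<close>

lemma ex_reg:
  assumes P: "primeideal P R" and "finite \<N>"
    and "\<And>N. N \<in> \<N> \<Longrightarrow> submodule N R M \<and> P \<notin> ass N"
  shows "\<exists>z\<in>P. \<forall>N\<in>\<N>. reg P N z"
proof -
  let ?F = "{Q \<in> \<Union>(ass ` \<N>). Q \<subseteq> P}"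
  have "finite ?F" using assms finite_ass by simp
  moreover have "primeideal Q R \<and> \<not> P \<subseteq> Q" if "Q \<in> ?F" for Q
    using that assms(3) ass_prime by auto
  ultimately obtain z where z: "z \<in> P" "\<forall>Q\<in>?F. z \<notin> Q"
    using prime_avoidance[of ?F P] primeideal.axioms(1)[OF P] by blast
  have zR: "z \<in> carrier R" using z prime_subset[OF P] by blast
  have "reg P N z" if "N \<in> \<N>" for N
    using reg_iff_ass[OF _ P zR, of N] assms(3)[OF that] z(2) that by blast
  then show ?thesis using z by blast
qed

lemma reg_not_ass:
  assumes "submodule N R M" "primeideal P R" "x \<in> P" "reg P N x" shows "P \<notin> ass N"
  using reg_iff_ass[OF assms(1,2)] assms(3,4) prime_subset[OF assms(2)] by blast

text \<open>The exchange passes from \<open>y\<close>, the head of the given sequence, to \<open>x\<close> via an element \<open>z\<close> that is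
  regular on \<open>M/N\<close>, \<open>M/(N + xM)\<close> and \<open>M/(N + yM)\<close>.\<close>

lemma regseq_exchange:
  assumes "submodule N R M" "primeideal P R" "set ys \<subseteq> P" "regseq P N ys" "length ys = Suc t"
    "x \<in> P" "reg P N x"
  shows "\<exists>zs. set zs \<subseteq> P \<and> length zs = t \<and> regseq P (addm N x (carrier M)) zs"
  using assms
proof (induction t arbitrary: N ys x)
  case 0
  show ?case by (rule exI[of _ "[]"]) simp
next
  case (Suc t)
  note N = Suc.prems(1) and P = Suc.prems(2) and x = Suc.prems(6,7)
  obtain y y' ys' where ys: "ys = y # y' # ys'" "length ys' = t"
    using Suc.prems(5) by (auto simp: length_Suc_conv)
  have y: "y \<in> P" "reg P N y" and y': "y' \<in> P" "reg P (addm N y (carrier M)) y'"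
    using Suc.prems(3,4) ys by auto
  have xR: "x \<in> carrier R" and yR: "y \<in> carrier R" using x y prime_subset[OF P] by auto
  let ?X = "addm N x (carrier M)" and ?Y = "addm N y (carrier M)"
  note X = addm_carr(1)[OF N xR] and Y = addm_carr(1)[OF N yR]
  have "P \<notin> ass N" "P \<notin> ass ?Y" using reg_not_ass[OF N P y] reg_not_ass[OF Y P y'] .
  \<comment> \<open>The second element \<open>y'\<close> keeps \<open>P\<close> from being
    associated to \<open>M/(N + yM)\<close>; the exchange of associated primes transfers this to
    \<open>x\<close>.\<close>
  moreover have "P \<notin> ass ?X" using ass_exchange[OF N P x y] \<open>P \<notin> ass ?Y\<close> by blast
  ultimately have "\<exists>z\<in>P. \<forall>L\<in>{N, ?X, ?Y}. reg P L z"
    by (intro ex_reg[OF P]) (use N X Y in auto)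
  then obtain z where z: "z \<in> P" "reg P N z" "reg P ?X z" "reg P ?Y z" by blast
  have zR: "z \<in> carrier R" using z prime_subset[OF P] by blast
  let ?Z = "addm N z (carrier M)"
  note Z = addm_carr(1)[OF N zR]
  \<comment> \<open>The induction hypothesis is used twice with sequences one shorter: modulo
    \<open>y\<close> it trades \<open>y'\<close> for \<open>z\<close>, and after permuting
    \<open>y\<close> and \<open>z\<close> it trades \<open>y\<close> for \<open>x\<close> modulo
    \<open>z\<close>.\<close>
  obtain zs where zs: "set zs \<subseteq> P" "length zs = t" "regseq P (addm ?Y z (carrier M)) zs"
    using Suc.IH[OF Y P _ _ _ z(1) z(4), of "y' # ys'"] Suc.prems(3,4) ys by auto
  have "reg P ?Z y" using reg_permute[OF N P yR zR y(2) z(4)] .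
  then have "regseq P ?Z (y # zs)" using zs(3) addm_commute[OF N yR zR] by simp
  moreover have "reg P ?Z x" using reg_permute[OF N P xR zR x(2) z(3)] .
  ultimately obtain ws where ws: "set ws \<subseteq> P" "length ws = t" "regseq P (addm ?Z x (carrier M)) ws"
    using Suc.IH[OF Z P _ _ _ x(1), of "y # zs"] zs y by auto
  then have "regseq P ?X (z # ws)" using addm_commute[OF N xR zR] z(3) by simp
  then show ?case using ws z by (intro exI[of _ "z # ws"]) simp
qed

text \<open>The last hypothesis says that \<open>xs\<close> is a system of parameters at
  \<open>P\<close>, and \<open>ys\<close> witnesses that the depth is large enough. If the head of
  \<open>xs\<close> lay in an associated prime, climbing along \<open>ys\<close> would give a chain
  too long to be exhausted by the tail of \<open>xs\<close>. The exchange then supplies a witness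
  modulo the head.\<close>

lemma regseq_of_parameters:
  assumes "submodule N R M" "primeideal P R" "set ys \<subseteq> P" "regseq P N ys" "length ys = length xs"
    "set xs \<subseteq> P" "\<And>Q. Q \<in> supp N \<Longrightarrow> Q \<subseteq> P \<Longrightarrow> set xs \<subseteq> Q \<Longrightarrow> Q = P"
  shows "regseq P N xs"
  using assms
proof (induction xs arbitrary: N ys)
  case (Cons x xs)
  note N = Cons.prems(1) and P = Cons.prems(2)
  have x: "x \<in> P" "x \<in> carrier R" using Cons.prems(6) prime_subset[OF P] by auto
  have r: "reg P N x"
    unfolding reg_iff_ass[OF N P x(2)]
  proof (intro ballI impI notI)
    fix Q assume Q: "Q \<in> ass N" "Q \<subseteq> P" "x \<in> Q"
    obtain n where n: "n \<ge> length ys" "prime_chain R n Q P"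
      using regseq_climb[OF N P Cons.prems(3,4) Q(1,2)] by blast
    \<comment> \<open>The chain from \<open>Q\<close> has at least one step more than the tail
      \<open>xs\<close> has elements, so a positive length remains and \<open>Q'\<close> is
      different from \<open>P\<close>, although it contains the head and the tail.\<close>
    then obtain Q' where Q': "Q \<subseteq> Q'" "set xs \<subseteq> Q'" "prime_chain R (n - length xs) Q' P"
      using prime_chain_drop_list[OF n(2), of xs] Cons.prems(6) by auto
    have "Q' \<in> supp N" using supp_up[OF ass_supp[OF Q(1)] Q'(1)] prime_chain_primes(1)[OF Q'(3)] .
    then have "Q' = P" using Cons.prems(7) Q' Q(3) prime_chain_subset[OF Q'(3)] by auto
    then have "n - length xs = 0" using prime_chain_self Q'(3) by blast
    then show False using n(1) Cons.prems(5) by simp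
  qed
  let ?X = "addm N x (carrier M)"
  obtain zs where zs: "set zs \<subseteq> P" "length zs = length xs" "regseq P ?X zs"
    using regseq_exchange[OF N P Cons.prems(3,4) _ x(1) r] Cons.prems(5) by auto
  have "regseq P ?X xs"
  proof (rule Cons.IH[OF addm_carr(1)[OF N x(2)] P zs(1,3,2)])
    show "set xs \<subseteq> P" using Cons.prems(6) by auto
    show "Q = P" if "Q \<in> supp ?X" "Q \<subseteq> P" "set xs \<subseteq> Q" for Q
      using that supp_addm[OF N x(2)] Cons.prems(7) by auto
  qed
  then show ?case using r by simp
qed simp

text \<open>The \<open>x\<close>-torsion \<open>T\<close> of \<open>M/N\<close> embeds modulo \<open>x\<close> into \<open>M/(N + xM)\<close>. If it is non-zero at \<open>P\<close>, an
  associated prime of \<open>M/(N + xM)\<close> lies over an associated prime of \<open>T\<close>.\<close>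

lemma reg_of_unmixed:
  assumes N: "submodule N R M" and P: "primeideal P R" and x: "x \<in> P"
    and unm: "\<And>Q. Q \<in> ass (addm N x (carrier M)) \<Longrightarrow> Q \<subseteq> P \<Longrightarrow> \<exists>n\<ge>t. prime_chain R n Q P"
    and avoid: "\<And>Q n. Q \<in> ass N \<Longrightarrow> Q \<subseteq> P \<Longrightarrow> prime_chain R n Q P \<Longrightarrow> n \<ge> t \<Longrightarrow> x \<notin> Q"
  shows "reg P N x"
proof -
  have xR: "x \<in> carrier R" using x prime_subset[OF P] by blast
  let ?X = "addm N x (carrier M)"
  note X = addm_carr[OF N xR]
  note NP = sat_submodule[OF N P]
  define T where "T = {u \<in> carrier M. \<exists>k::nat. x [^] k \<cdot> u \<in> sat P N}"
  have shift: "x [^] (k + l) \<cdot> u \<in> sat P N" if "x [^] k \<cdot> u \<in> sat P N" "u \<in> carrier M" for k l :: nat and u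
  proof -
    have "x [^] (k + l) \<cdot> u = x [^] l \<cdot> (x [^] k \<cdot> u)"
      using xR that(2) by (simp add: nat_pow_mult[symmetric] smult_assoc1 smult_comm)
    then show ?thesis using submoduleE(4)[OF NP _ that(1)] xR by simp
  qed
  have T: "submodule T R M"
  proof (rule submodule_of_closed)
    show "T \<subseteq> carrier M" by (auto simp: T_def)
    show "\<zero>\<^bsub>M\<^esub> \<in> T" using submodule_zero[OF NP] xR by (auto simp: T_def)
    show "a \<oplus>\<^bsub>M\<^esub> b \<in> T" if ab: "a \<in> T" "b \<in> T" for a b
    proof -
      obtain k l :: nat where "x [^] k \<cdot> a \<in> sat P N" "x [^] l \<cdot> b \<in> sat P N"
        and c: "a \<in> carrier M" "b \<in> carrier M" using ab by (auto simp: T_def)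
      then have "x [^] (k + l) \<cdot> a \<in> sat P N" "x [^] (k + l) \<cdot> b \<in> sat P N"
        using shift[of k a l] shift[of l b k] by (simp_all add: add.commute)
      then have "x [^] (k + l) \<cdot> (a \<oplus>\<^bsub>M\<^esub> b) \<in> sat P N"
        using submoduleE(5)[OF NP] xR c by (simp add: smult_r_distr)
      then show ?thesis using c unfolding T_def by blast
    qed
    show "a \<cdot> u \<in> T" if au: "a \<in> carrier R" "u \<in> T" for a u
    proof -
      obtain k :: nat where "x [^] k \<cdot> u \<in> sat P N" and c: "u \<in> carrier M" using au by (auto simp: T_def)
      then have "x [^] k \<cdot> (a \<cdot> u) \<in> sat P N"
        using submoduleE(4)[OF NP au(1)] smult_comm[of a "x [^] k" u] xR au(1) by fastforce
      then show ?thesis using c au unfolding T_def by blast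
    qed
  qed
  have "T \<subseteq> sat P N"
  proof (rule ccontr)
    assume nT: "\<not> T \<subseteq> sat P N"
    have "\<not> T \<subseteq> sat P ?X"
    proof
      assume TX: "T \<subseteq> sat P ?X"
      have "T \<subseteq> sat P N"
      proof (rule nakayama[OF T N P primeideal.axioms(1)[OF P]])
        fix W assume W: "submodule W R M" "N \<subseteq> W" and JW: "\<And>j k. j \<in> P \<Longrightarrow> k \<in> T \<Longrightarrow> j \<cdot> k \<in> W"
        show "T \<subseteq> sat P W"
        proof
          fix u assume u: "u \<in> T"
          then obtain k :: nat where k: "x [^] k \<cdot> u \<in> sat P N" and uc: "u \<in> carrier M" by (auto simp: T_def)
          have "u \<in> sat P ?X" using u TX by blast
          then obtain s v where s: "s \<in> carrier R - P" and v: "v \<in> carrier M" and c: "cng N (s \<cdot> u) (x \<cdot> v)"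
            using sat_addmE[OF N P xR subset_refl] by metis
          have "cng N (s \<cdot> (x [^] k \<cdot> u)) (x [^] Suc k \<cdot> v)"
            using cng_smult[OF N c, of "x [^] k"] smult_comm[of s "x [^] k" u] s xR uc v by (simp add: smult_assoc1)
          moreover have "s \<cdot> (x [^] k \<cdot> u) \<in> sat P N" using submoduleE(4)[OF NP _ k] s by simp
          ultimately have "x [^] Suc k \<cdot> v \<in> sat P N"
            using cng_mem[OF NP] cng_mono sat_sup[OF N P] by blast
          then have "v \<in> T" using v unfolding T_def by blast
          then have "s \<cdot> u \<in> W" using JW[OF x] cng_mem[OF W(1) cng_mono[OF c W(2)]] by blast
          then show "u \<in> sat P W" using s uc by (auto simp: sat_def)
        qed
      qed simp
      then show False using nT by blast
    qed
    then obtain u where u: "u \<in> T" "u \<notin> sat P ?X" by blast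
    then obtain k :: nat where k: "x [^] k \<cdot> u \<in> sat P N" and uc: "u \<in> carrier M" by (auto simp: T_def)
    have "col ?X u \<subseteq> P" using u(2) notin_sat[OF uc] by blast
    then obtain c where c: "c \<in> carrier R" "col ?X (c \<cdot> u) \<in> ass ?X" "col ?X (c \<cdot> u) \<subseteq> P"
      and pr: "primeideal (col ?X (c \<cdot> u)) R"
      by (rule ass_below[OF X(1) P uc])
    let ?Q = "col ?X (c \<cdot> u)"
    obtain n where n: "n \<ge> t" "prime_chain R n ?Q P" using unm c by blast
    have "col N u \<subseteq> ?Q" using col_mult_sup[OF X(1) uc c(1)] X(2) by (auto simp: col_def)
    \<comment> \<open>The second associated prime is taken below the first one, \<open>?Q\<close>.
      It contains a power of \<open>x\<close> because \<open>u\<close> is torsion, hence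
      \<open>x\<close>; and its chain to \<open>P\<close> runs through \<open>?Q\<close>, so it is
      long enough to contradict \<open>avoid\<close>.\<close>
    then obtain e where e: "e \<in> carrier R" "col N (e \<cdot> u) \<in> ass N" "col N (e \<cdot> u) \<subseteq> ?Q"
      and pre: "primeideal (col N (e \<cdot> u)) R"
      by (rule ass_below[OF N pr uc])
    obtain s where s: "s \<in> carrier R - P" "s \<cdot> (x [^] k \<cdot> u) \<in> N" using k by (auto simp: sat_def)
    then have "s \<otimes> x [^] k \<in> col N u" using uc xR by (simp add: col_def smult_assoc1)
    then have "s \<otimes> x [^] k \<in> col N (e \<cdot> u)" using col_mult_sup[OF N uc e(1)] by blast
    then have "x [^] k \<in> col N (e \<cdot> u)" using prime_mult_cancel[OF pre] s(1) xR e(3) c(3) by blast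
    then have xe: "x \<in> col N (e \<cdot> u)" using prime_pow[OF pre xR] by blast
    obtain m where "prime_chain R m (col N (e \<cdot> u)) ?Q" using prime_chain_step[OF pre pr e(3)] by blast
    then have "prime_chain R (m + n) (col N (e \<cdot> u)) P" using prime_chain_trans n(2) by blast
    then show False using avoid[OF e(2)] e(3) c(3) n(1) xe by fastforce
  qed
  show ?thesis
    unfolding reg_def
  proof (intro ballI impI)
    fix w assume w: "w \<in> carrier M" "x \<cdot> w \<in> sat P N"
    then have "x [^] (1::nat) \<cdot> w \<in> sat P N" using xR by simp
    then show "w \<in> sat P N" using w \<open>T \<subseteq> sat P N\<close> unfolding T_def by blast
  qed
qed

text \<open>The hypothesis is the reducing condition seen from \<open>P\<close>: the distance of
  \<open>Q\<close> from \<open>P\<close> replaces \<open>dim R/Q\<close>. The tail is shown regular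
  before the head, because its regularity supplies the distance of the associated primes of
  \<open>M/(N + xM)\<close> from \<open>P\<close>.\<close>

lemma regseq_of_avoiding:
  assumes "submodule N R M" "primeideal P R" "set xs \<subseteq> P"
    "\<And>i Q n. i < length xs \<Longrightarrow> Q \<in> ass (seqm N (take i xs)) \<Longrightarrow> Q \<subseteq> P \<Longrightarrow> prime_chain R n Q P \<Longrightarrow>
      n \<ge> length xs - Suc i \<Longrightarrow> xs ! i \<notin> Q"
  shows "regseq P N xs"
  using assms
proof (induction xs arbitrary: N)
  case (Cons x xs)
  note N = Cons.prems(1) and P = Cons.prems(2)
  have x: "x \<in> P" "x \<in> carrier R" and xs: "set xs \<subseteq> P" using Cons.prems(3) prime_subset[OF P] by auto
  have r: "regseq P (addm N x (carrier M)) xs"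
  proof (rule Cons.IH[OF addm_carr(1)[OF N x(2)] P xs])
    show "xs ! i \<notin> Q" if "i < length xs" "Q \<in> ass (seqm (addm N x (carrier M)) (take i xs))" "Q \<subseteq> P"
      "prime_chain R n Q P" "n \<ge> length xs - Suc i" for i Q n
      using Cons.prems(4)[of "Suc i" Q n] that by simp
  qed
  have "reg P N x"
  proof (rule reg_of_unmixed[OF N P x(1)])
    show "\<exists>n\<ge>length xs. prime_chain R n Q P" if "Q \<in> ass (addm N x (carrier M))" "Q \<subseteq> P" for Q
      using regseq_climb[OF addm_carr(1)[OF N x(2)] P xs r that] .
    show "x \<notin> Q" if "Q \<in> ass N" "Q \<subseteq> P" "prime_chain R n Q P" "n \<ge> length xs" for Q n
      using Cons.prems(4)[of 0 Q n] that by simp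
  qed
  then show ?case using r by simp
qed simp

end

section \<open>Quotient modules\<close>

context module
begin

lemma submodule_abelian_subgroup: "submodule N R M \<Longrightarrow> abelian_subgroup N M"
  by (intro abelian_subgroupI3 additive_subgroup.intro) (auto simp: submodule_def M.abelian_group_axioms)

lemma coset_eq_cng:
  assumes N: "submodule N R M" and y: "y \<in> carrier M"
  shows "N +>\<^bsub>M\<^esub> y = {u. cng N u y}"
proof -
  interpret N: abelian_subgroup N M using submodule_abelian_subgroup[OF N] .
  show ?thesis
    using N.a_elemrcos_carrier[OF y] N.a_rcos_module[OF y] y by (auto simp: cng_def M.minus_eq)
qed

lemma coset_eq_iff:
  assumes N: "submodule N R M" and "x \<in> carrier M" "y \<in> carrier M"
  shows "N +>\<^bsub>M\<^esub> x = N +>\<^bsub>M\<^esub> y \<longleftrightarrow> cng N x y"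
  using assms cng_refl[OF N] cng_sym[OF N] cng_trans[OF N] unfolding coset_eq_cng[OF N assms(2)] coset_eq_cng[OF N assms(3)]
  by blast

lemma coset_eq_zero_iff:
  assumes N: "submodule N R M" and "x \<in> carrier M"
  shows "N +>\<^bsub>M\<^esub> x = N \<longleftrightarrow> x \<in> N"
proof -
  have "N +>\<^bsub>M\<^esub> \<zero>\<^bsub>M\<^esub> = N"
    unfolding coset_eq_cng[OF N M.zero_closed] using cng_zero_iff[OF N] by blast
  then show ?thesis using coset_eq_iff[OF assms M.zero_closed] cng_zero_iff[OF N] by simp
qed

lemma quot_carrier: "carrier (quot_module R M N) = (\<lambda>y. N +>\<^bsub>M\<^esub> y) ` carrier M"
  by (auto simp: quot_module_def A_RCOSETS_def')

lemma quot_zero: "\<zero>\<^bsub>quot_module R M N\<^esub> = N"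
  by (simp add: quot_module_def)

lemma quot_smult:
  assumes N: "submodule N R M" and "a \<in> carrier R" "y \<in> carrier M"
  shows "a \<odot>\<^bsub>quot_module R M N\<^esub> (N +>\<^bsub>M\<^esub> y) = N +>\<^bsub>M\<^esub> (a \<cdot> y)"
proof -
  have "N +>\<^bsub>M\<^esub> (a \<cdot> x) = N +>\<^bsub>M\<^esub> (a \<cdot> y)" if "x \<in> N +>\<^bsub>M\<^esub> y" for x
  proof -
    have "cng N x y" using that coset_eq_cng[OF N assms(3)] by blast
    then show ?thesis using coset_eq_iff[OF N] cng_smult[OF N _ assms(2)] cng_carr assms by blast
  qed
  moreover have "y \<in> N +>\<^bsub>M\<^esub> y" using coset_eq_cng[OF N assms(3)] cng_refl[OF N assms(3)] by blast
  ultimately have "(\<Union>x\<in>N +>\<^bsub>M\<^esub> y. N +>\<^bsub>M\<^esub> (a \<cdot> x)) = N +>\<^bsub>M\<^esub> (a \<cdot> y)"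
    by blast
  then show ?thesis by (simp add: quot_module_def)
qed

lemma quot_add:
  assumes N: "submodule N R M" and "x \<in> carrier M" "y \<in> carrier M"
  shows "(N +>\<^bsub>M\<^esub> x) \<oplus>\<^bsub>quot_module R M N\<^esub> (N +>\<^bsub>M\<^esub> y) = N +>\<^bsub>M\<^esub> (x \<oplus>\<^bsub>M\<^esub> y)"
  using abelian_subgroup.a_rcos_sum[OF submodule_abelian_subgroup[OF N] assms(2,3)]
  by (simp add: quot_module_def)

lemma quot_module_module:
  assumes N: "submodule N R M"
  shows "module R (quot_module R M N)"
proof (rule moduleI)
  have z: "\<zero>\<^bsub>quot_module R M N\<^esub> = N +>\<^bsub>M\<^esub> \<zero>\<^bsub>M\<^esub>"
    using coset_eq_zero_iff[OF N M.zero_closed] submodule_zero[OF N] by (simp add: quot_zero)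
  have rep: "(\<And>a. a \<in> carrier M \<Longrightarrow> x = N +>\<^bsub>M\<^esub> a \<Longrightarrow> thesis) \<Longrightarrow> thesis"
    if "x \<in> carrier (quot_module R M N)" for x thesis using that by (auto simp: quot_carrier)
  have mem: "N +>\<^bsub>M\<^esub> a \<in> carrier (quot_module R M N)" if "a \<in> carrier M" for a
    using that by (simp add: quot_carrier)
  show "cring R" by (rule R.is_cring)
  show "abelian_group (quot_module R M N)"
  proof (rule abelian_groupI)
    fix x assume "x \<in> carrier (quot_module R M N)"
    then obtain a where a: "a \<in> carrier M" "x = N +>\<^bsub>M\<^esub> a" by (rule rep)
    then have "(N +>\<^bsub>M\<^esub> (\<ominus>\<^bsub>M\<^esub> a)) \<oplus>\<^bsub>quot_module R M N\<^esub> x = \<zero>\<^bsub>quot_module R M N\<^esub>"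
      by (simp add: quot_add[OF N] z M.l_neg)
    then show "\<exists>y\<in>carrier (quot_module R M N). y \<oplus>\<^bsub>quot_module R M N\<^esub> x = \<zero>\<^bsub>quot_module R M N\<^esub>"
      using a mem by blast
    show "\<zero>\<^bsub>quot_module R M N\<^esub> \<oplus>\<^bsub>quot_module R M N\<^esub> x = x"
      using a by (simp add: z quot_add[OF N])
    fix y assume "y \<in> carrier (quot_module R M N)"
    then obtain b where b: "b \<in> carrier M" "y = N +>\<^bsub>M\<^esub> b" by (rule rep)
    show "x \<oplus>\<^bsub>quot_module R M N\<^esub> y = y \<oplus>\<^bsub>quot_module R M N\<^esub> x"
      "x \<oplus>\<^bsub>quot_module R M N\<^esub> y \<in> carrier (quot_module R M N)"
      using a b mem by (simp_all add: quot_add[OF N] M.a_comm[of a b])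
    fix u assume "u \<in> carrier (quot_module R M N)"
    then obtain c where c: "c \<in> carrier M" "u = N +>\<^bsub>M\<^esub> c" by (rule rep)
    show "x \<oplus>\<^bsub>quot_module R M N\<^esub> y \<oplus>\<^bsub>quot_module R M N\<^esub> u
        = x \<oplus>\<^bsub>quot_module R M N\<^esub> (y \<oplus>\<^bsub>quot_module R M N\<^esub> u)"
      using a b c by (simp add: quot_add[OF N] M.a_assoc)
  qed (simp add: z mem)
  fix x assume "x \<in> carrier (quot_module R M N)"
  then obtain u where u: "u \<in> carrier M" "x = N +>\<^bsub>M\<^esub> u" by (rule rep)
  show "\<one> \<odot>\<^bsub>quot_module R M N\<^esub> x = x" using u by (simp add: quot_smult[OF N])
  fix a assume a: "a \<in> carrier R"
  show "a \<odot>\<^bsub>quot_module R M N\<^esub> x \<in> carrier (quot_module R M N)"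
    using u a mem by (simp add: quot_smult[OF N])
  show "a \<odot>\<^bsub>quot_module R M N\<^esub> (x \<oplus>\<^bsub>quot_module R M N\<^esub> y)
      = a \<odot>\<^bsub>quot_module R M N\<^esub> x \<oplus>\<^bsub>quot_module R M N\<^esub> a \<odot>\<^bsub>quot_module R M N\<^esub> y"
    if y: "y \<in> carrier (quot_module R M N)" for y
  proof -
    from y obtain v where "v \<in> carrier M" "y = N +>\<^bsub>M\<^esub> v" by (rule rep)
    then show ?thesis using u a by (simp add: quot_add[OF N] quot_smult[OF N] smult_r_distr)
  qed
  fix b assume b: "b \<in> carrier R"
  show "(a \<oplus> b) \<odot>\<^bsub>quot_module R M N\<^esub> x
      = a \<odot>\<^bsub>quot_module R M N\<^esub> x \<oplus>\<^bsub>quot_module R M N\<^esub> b \<odot>\<^bsub>quot_module R M N\<^esub> x"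
    "(a \<otimes> b) \<odot>\<^bsub>quot_module R M N\<^esub> x = a \<odot>\<^bsub>quot_module R M N\<^esub> (b \<odot>\<^bsub>quot_module R M N\<^esub> x)"
    using u a b by (simp_all add: quot_add[OF N] quot_smult[OF N] smult_l_distr smult_assoc1)
qed

lemma Ass_quot:
  assumes N: "submodule N R M"
  shows "Ass R (quot_module R M N) = ass N"
proof -
  have *: "{a \<in> carrier R. a \<odot>\<^bsub>quot_module R M N\<^esub> (N +>\<^bsub>M\<^esub> y) = \<zero>\<^bsub>quot_module R M N\<^esub>} = col N y"
    if "y \<in> carrier M" for y
    unfolding col_def using that quot_smult[OF N _ that] coset_eq_zero_iff[OF N]
    by (intro Collect_cong conj_cong) (simp_all add: quot_zero)
  have "(\<exists>x\<in>carrier (quot_module R M N).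
      P = {a \<in> carrier R. a \<odot>\<^bsub>quot_module R M N\<^esub> x = \<zero>\<^bsub>quot_module R M N\<^esub>}) \<longleftrightarrow> (\<exists>y\<in>carrier M. P = col N y)" for P
    unfolding quot_carrier bex_simps by (rule bex_cong[OF refl]) (simp only: *)
  then show ?thesis unfolding Ass_def ass_def by simp
qed

lemma nonzerodivisor_quot:
  assumes N: "submodule N R M" and "a \<in> carrier R"
  shows "nonzerodivisor_on (quot_module R M N) a \<longleftrightarrow> (\<forall>w\<in>carrier M. a \<cdot> w \<in> N \<longrightarrow> w \<in> N)"
  using assms by (auto simp: nonzerodivisor_on_def quot_carrier quot_zero quot_smult[OF N] coset_eq_zero_iff[OF N])

lemma quot_nonzero:
  assumes N: "submodule N R M"
  shows "carrier (quot_module R M N) \<noteq> {\<zero>\<^bsub>quot_module R M N\<^esub>} \<longleftrightarrow> N \<noteq> carrier M"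
proof -
  have "carrier (quot_module R M N) = {\<zero>\<^bsub>quot_module R M N\<^esub>} \<longleftrightarrow> (\<forall>y\<in>carrier M. N +>\<^bsub>M\<^esub> y = N)"
    using M.zero_closed by (auto simp: quot_carrier quot_zero image_iff)
  also have "\<dots> \<longleftrightarrow> carrier M \<subseteq> N" using coset_eq_zero_iff[OF N] by blast
  finally show ?thesis using submoduleE(1)[OF N] by auto
qed

lemma quot_submodule_vimage:
  assumes N: "submodule N R M" and H: "submodule H R (quot_module R M N)"
  shows "submodule {y \<in> carrier M. N +>\<^bsub>M\<^esub> y \<in> H} R M" "N \<subseteq> {y \<in> carrier M. N +>\<^bsub>M\<^esub> y \<in> H}"
    "H = (\<lambda>y. N +>\<^bsub>M\<^esub> y) ` {y \<in> carrier M. N +>\<^bsub>M\<^esub> y \<in> H}"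
proof -
  interpret Q: module R "quot_module R M N" by (rule quot_module_module[OF N])
  have z: "N \<in> H" using Q.submodule_zero[OF H] by (simp add: quot_zero)
  show NL: "N \<subseteq> {y \<in> carrier M. N +>\<^bsub>M\<^esub> y \<in> H}"
  proof
    fix y assume y: "y \<in> N"
    then have "y \<in> carrier M" using submodule_carr[OF N] by blast
    moreover from this have "N +>\<^bsub>M\<^esub> y = N" using coset_eq_zero_iff[OF N] y by blast
    ultimately show "y \<in> {y \<in> carrier M. N +>\<^bsub>M\<^esub> y \<in> H}" using z by simp
  qed
  show "submodule {y \<in> carrier M. N +>\<^bsub>M\<^esub> y \<in> H} R M"
  proof (rule submodule_of_closed)
    show "\<zero>\<^bsub>M\<^esub> \<in> {y \<in> carrier M. N +>\<^bsub>M\<^esub> y \<in> H}" using NL submodule_zero[OF N] by blast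
    show "a \<cdot> y \<in> {y \<in> carrier M. N +>\<^bsub>M\<^esub> y \<in> H}" if "a \<in> carrier R" "y \<in> {y \<in> carrier M. N +>\<^bsub>M\<^esub> y \<in> H}" for a y
      using that Q.submoduleE(4)[OF H, of a "N +>\<^bsub>M\<^esub> y"] by (simp add: quot_smult[OF N])
    show "a \<oplus>\<^bsub>M\<^esub> b \<in> {y \<in> carrier M. N +>\<^bsub>M\<^esub> y \<in> H}"
      if "a \<in> {y \<in> carrier M. N +>\<^bsub>M\<^esub> y \<in> H}" "b \<in> {y \<in> carrier M. N +>\<^bsub>M\<^esub> y \<in> H}" for a b
      using that Q.submoduleE(5)[OF H, of "N +>\<^bsub>M\<^esub> a" "N +>\<^bsub>M\<^esub> b"] by (simp add: quot_add[OF N])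
  qed auto
  show "H = (\<lambda>y. N +>\<^bsub>M\<^esub> y) ` {y \<in> carrier M. N +>\<^bsub>M\<^esub> y \<in> H}"
    using Q.submodule_carr[OF H] by (auto simp: quot_carrier)
qed

lemma quot_submodule_image:
  assumes N: "submodule N R M" and L: "submodule L R M"
  shows "submodule ((\<lambda>y. N +>\<^bsub>M\<^esub> y) ` L) R (quot_module R M N)"
proof -
  interpret Q: module R "quot_module R M N" by (rule quot_module_module[OF N])
  let ?I = "(\<lambda>y. N +>\<^bsub>M\<^esub> y) ` L"
  note Lc = submodule_carr[OF L]
  have sm: "a \<odot>\<^bsub>quot_module R M N\<^esub> y \<in> ?I" if "a \<in> carrier R" "y \<in> ?I" for a y
    using that Lc submoduleE(4)[OF L] by (auto simp: quot_smult[OF N])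
  show ?thesis
  proof (rule Q.submodule_of_closed)
    show sub: "?I \<subseteq> carrier (quot_module R M N)" using Lc by (auto simp: quot_carrier)
    show "\<zero>\<^bsub>quot_module R M N\<^esub> \<in> ?I"
      using submodule_zero[OF L] coset_eq_zero_iff[OF N M.zero_closed] submodule_zero[OF N]
      by (auto simp: quot_zero image_iff intro!: bexI[of _ "\<zero>\<^bsub>M\<^esub>"])
    show "a \<oplus>\<^bsub>quot_module R M N\<^esub> b \<in> ?I" if "a \<in> ?I" "b \<in> ?I" for a b
      using that Lc submoduleE(5)[OF L] by (auto simp: quot_add[OF N])
  qed (rule sm)
qed

lemma coset_image_mem_iff:
  assumes N: "submodule N R M" and L: "submodule L R M" "N \<subseteq> L" and y: "y \<in> carrier M"
  shows "N +>\<^bsub>M\<^esub> y \<in> (\<lambda>y. N +>\<^bsub>M\<^esub> y) ` L \<longleftrightarrow> y \<in> L"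
proof
  assume "N +>\<^bsub>M\<^esub> y \<in> (\<lambda>y. N +>\<^bsub>M\<^esub> y) ` L"
  then obtain z where z: "z \<in> L" "N +>\<^bsub>M\<^esub> y = N +>\<^bsub>M\<^esub> z" by blast
  then have "cng N y z" using coset_eq_iff[OF N y submodule_carr[OF L(1)]] by blast
  then show "y \<in> L" using cng_mem[OF L(1) cng_mono[OF _ L(2)]] z by blast
qed blast

text \<open>Adding the submodules \<open>xM\<close> one after another gives the product of the
  generated ideal with \<open>M\<close>: the elements \<open>a\<close> with \<open>aM\<close> inside
  \<open>seqm S0 xs\<close> form an ideal containing the list. From here on the quotients in the
  definitions can be handled through \<open>seqm\<close>.\<close>

lemma ideal_smult_eq_seqm:
  assumes xs: "set xs \<subseteq> carrier R"
  shows "ideal_smult R M (Idl (set xs)) = seqm S0 xs"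
proof
  let ?G = "{a \<cdot> x | a x. a \<in> Idl (set xs) \<and> x \<in> carrier M}"
  have IR: "Idl (set xs) \<subseteq> carrier R"
    using additive_subgroup.a_subset[OF ideal.axioms(1)[OF R.genideal_ideal[OF xs]]] .
  have G: "?G \<subseteq> carrier M" using IR by auto
  have least: "seqm N ys \<subseteq> W"
    if "submodule W R M" "N \<subseteq> W" "\<And>x v. x \<in> set ys \<Longrightarrow> v \<in> carrier M \<Longrightarrow> x \<cdot> v \<in> W" for N ys W
    using that
  proof (induction ys arbitrary: N)
    case (Cons y ys)
    show ?case
      using Cons.IH[of "addm N y (carrier M)"] addm_least[OF Cons.prems(1,2)] Cons.prems by simp
  qed simp
  note S = seqm_submodule[OF submodule_zeroset xs]
  have mem: "x \<cdot> v \<in> seqm N ys"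
    if "submodule N R M" "set ys \<subseteq> carrier R" "x \<in> set ys" "v \<in> carrier M" for N ys x v
    using that
  proof (induction ys arbitrary: N)
    case (Cons y ys)
    then show ?case
      using addm_carr[of N y] seqm_mono[of "addm N y (carrier M)" ys] Cons.IH[of "addm N y (carrier M)"]
      by (cases "x = y") auto
  qed simp
  have "set xs \<subseteq> {a \<in> carrier R. \<forall>v\<in>carrier M. a \<cdot> v \<in> seqm S0 xs}"
    using mem[OF submodule_zeroset xs] xs by blast
  moreover have "{a \<in> carrier R. \<forall>v\<in>carrier M. a \<cdot> v \<in> seqm S0 xs}
      = \<Inter>(col (seqm S0 xs) ` carrier M)"
    using M.zero_closed by (auto simp: col_def)
  moreover have "ideal (\<Inter>(col (seqm S0 xs) ` carrier M)) R"
    by (rule R.i_Intersect) (use col_ideal[OF S] M.zero_closed in auto)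
  ultimately have "Idl (set xs) \<subseteq> {a \<in> carrier R. \<forall>v\<in>carrier M. a \<cdot> v \<in> seqm S0 xs}"
    using R.genideal_minimal by metis
  then show "ideal_smult R M (Idl (set xs)) \<subseteq> seqm S0 xs"
    unfolding ideal_smult_def by (intro submodule_gen_least[OF S]) auto
  show "seqm S0 xs \<subseteq> ideal_smult R M (Idl (set xs))"
  proof (rule least)
    show W: "submodule (ideal_smult R M (Idl (set xs))) R M"
      unfolding ideal_smult_def using submodule_gen_submodule[OF G] by blast
    show "S0 \<subseteq> ideal_smult R M (Idl (set xs))" using submodule_zero[OF W] by blast
    show "x \<cdot> v \<in> ideal_smult R M (Idl (set xs))" if "x \<in> set xs" "v \<in> carrier M" for x v
      unfolding ideal_smult_def using submodule_gen_submodule(2)[OF G] that R.genideal_self[OF xs] by blast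
  qed
qed

lemma annihilator_ideal: "ideal (annihilator R M) R"
proof -
  have "annihilator R M = \<Inter>(col S0 ` carrier M)"
    using M.zero_closed by (auto simp: col_def annihilator_def)
  moreover have "ideal (\<Inter>(col S0 ` carrier M)) R"
    by (rule R.i_Intersect) (use col_ideal[OF submodule_zeroset] M.zero_closed in auto)
  ultimately show ?thesis by simp
qed

end

section \<open>Krull dimension\<close>

text \<open>Depends only on a family of sets ordered by inclusion, so dimensions of different rings
  can be compared by strictly monotone maps between their sets of primes.\<close>

definition chain_dim :: "'a set set \<Rightarrow> enat"
  where "chain_dim A = Sup {enat n | n. \<exists>P :: nat \<Rightarrow> 'a set. (\<forall>i\<le>n. P i \<in> A) \<and> (\<forall>i<n. P i \<subset> P (Suc i))}"

lemma krull_dim_chain_dim: "krull_dim R = chain_dim {P. primeideal P R}"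
  by (simp add: krull_dim_def chain_dim_def)

lemma chain_dim_le:
  assumes "\<And>p. p \<in> A \<Longrightarrow> f p \<in> B" and "\<And>p q. p \<in> A \<Longrightarrow> q \<in> A \<Longrightarrow> p \<subset> q \<Longrightarrow> f p \<subset> f q"
  shows "chain_dim A \<le> chain_dim B"
  unfolding chain_dim_def
proof (rule Sup_subset_mono, clarify)
  fix n and P :: "nat \<Rightarrow> 'a set" assume P: "\<forall>i\<le>n. P i \<in> A" "\<forall>i<n. P i \<subset> P (Suc i)"
  have "(\<forall>i\<le>n. f (P i) \<in> B) \<and> (\<forall>i<n. f (P i) \<subset> f (P (Suc i)))"
    using P assms by (simp add: Suc_leI)
  then show "\<exists>m. enat n = enat m \<and> (\<exists>P. (\<forall>i\<le>m. P i \<in> B) \<and> (\<forall>i<m. P i \<subset> P (Suc i)))"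
    by (intro exI[of _ n] conjI refl exI[of _ "\<lambda>i. f (P i)"]) blast+
qed

lemma chain_dim_eq:
  assumes "\<And>p. p \<in> A \<Longrightarrow> f p \<in> B" and "\<And>p q. p \<in> A \<Longrightarrow> q \<in> A \<Longrightarrow> p \<subset> q \<Longrightarrow> f p \<subset> f q"
    and "\<And>p. p \<in> B \<Longrightarrow> g p \<in> A" and "\<And>p q. p \<in> B \<Longrightarrow> q \<in> B \<Longrightarrow> p \<subset> q \<Longrightarrow> g p \<subset> g q"
  shows "chain_dim A = chain_dim B"
  using chain_dim_le[of A f B] chain_dim_le[of B g A] assms by (intro antisym) blast+

lemma krull_dim_quot:
  assumes "cring R" and I: "ideal I R"
  shows "krull_dim (R Quot I) = chain_dim {P. primeideal P R \<and> I \<subseteq> P}"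
proof -
  interpret R: cring R by fact
  interpret I: ideal I R by fact
  have cQ: "carrier (R Quot I) = (+>\<^bsub>R\<^esub>) I ` carrier R"
    by (auto simp: FactRing_def A_RCOSETS_def')
  have zQ: "\<zero>\<^bsub>R Quot I\<^esub> = I" by (simp add: FactRing_def)
  define f where "f q = {r \<in> carrier R. I +>\<^bsub>R\<^esub> r \<in> q}" for q
  have mem: "I +>\<^bsub>R\<^esub> r \<in> (+>\<^bsub>R\<^esub>) I ` P \<longleftrightarrow> r \<in> P" if P: "ideal P R" "I \<subseteq> P" and r: "r \<in> carrier R" for P r
  proof
    interpret P: ideal P R by fact
    assume "I +>\<^bsub>R\<^esub> r \<in> (+>\<^bsub>R\<^esub>) I ` P"
    then obtain p where p: "p \<in> P" "I +>\<^bsub>R\<^esub> r = I +>\<^bsub>R\<^esub> p" by blast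
    then have "r \<ominus>\<^bsub>R\<^esub> p \<in> P" using R.quotient_eq_iff_same_a_r_cos[OF I r P.Icarr] P(2) by blast
    then have "(r \<ominus>\<^bsub>R\<^esub> p) \<oplus>\<^bsub>R\<^esub> p \<in> P" using p by simp
    moreover have "(r \<ominus>\<^bsub>R\<^esub> p) \<oplus>\<^bsub>R\<^esub> p = r" using r P.Icarr[OF p(1)] by (simp add: R.minus_eq R.a_assoc R.l_neg)
    ultimately show "r \<in> P" by simp
  qed blast
  interpret Q: cring "R Quot I" by (rule I.quotient_is_cring) (rule R.is_cring)
  interpret h: ring_hom_cring R "R Quot I" "(+>\<^bsub>R\<^esub>) I" by (rule I.rcos_ring_hom_cring) (rule R.is_cring)
  show ?thesis
    unfolding krull_dim_chain_dim
  proof (rule chain_dim_eq[of _ f _ "\<lambda>P. (+>\<^bsub>R\<^esub>) I ` P"])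
    fix q assume "q \<in> {P. primeideal P (R Quot I)}"
    then have q: "primeideal q (R Quot I)" by simp
    interpret q: primeideal q "R Quot I" by fact
    have id: "ideal (f q) R" unfolding f_def by (rule ring_hom_ring.ideal_vimage[OF I.rcos_ring_hom_ring q.is_ideal])
    show "f q \<in> {P. primeideal P R \<and> I \<subseteq> P}"
    proof (intro CollectI conjI)
      show "primeideal (f q) R"
      proof (rule primeidealI[OF id R.is_cring])
        show "carrier R \<noteq> f q"
        proof
          assume "carrier R = f q"
          then have "carrier (R Quot I) \<subseteq> q" by (auto simp: cQ f_def)
          then show False using q.I_notcarr q.a_subset by blast
        qed
        show "a \<in> f q \<or> b \<in> f q" if "a \<in> carrier R" "b \<in> carrier R" "a \<otimes>\<^bsub>R\<^esub> b \<in> f q" for a b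
          using that q.I_prime[of "I +>\<^bsub>R\<^esub> a" "I +>\<^bsub>R\<^esub> b"] by (auto simp: f_def)
      qed
      show "I \<subseteq> f q"
      proof
        fix i assume i: "i \<in> I"
        have "I +>\<^bsub>R\<^esub> i = \<zero>\<^bsub>R Quot I\<^esub>" unfolding zQ using R.a_rcos_zero[OF I i] .
        then show "i \<in> f q" using q.zero_closed I.Icarr[OF i] by (simp add: f_def)
      qed
    qed
  next
    fix q q' assume "q \<in> {P. primeideal P (R Quot I)}" "q' \<in> {P. primeideal P (R Quot I)}" "q \<subset> q'"
    then have q: "primeideal q (R Quot I)" "primeideal q' (R Quot I)" "q \<subset> q'" by simp_all
    then obtain z where z: "z \<in> q'" "z \<notin> q" by blast
    have "z \<in> (+>\<^bsub>R\<^esub>) I ` carrier R" using subsetD[OF prime_subset[OF q(2)] z(1)] unfolding cQ .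
    then obtain r where r: "r \<in> carrier R" "z = I +>\<^bsub>R\<^esub> r" by blast
    then have "r \<in> f q'" "r \<notin> f q" using z by (simp_all add: f_def)
    moreover have "f q \<subseteq> f q'" using q(3) by (auto simp: f_def)
    ultimately show "f q \<subset> f q'" by blast
  next
    fix P assume "P \<in> {P. primeideal P R \<and> I \<subseteq> P}"
    then have P: "primeideal P R" "I \<subseteq> P" by simp_all
    interpret P: primeideal P R by fact
    have id: "ideal ((+>\<^bsub>R\<^esub>) I ` P) (R Quot I)" using R.ring_ideal_imp_quot_ideal[OF I P.is_ideal] .
    have "primeideal ((+>\<^bsub>R\<^esub>) I ` P) (R Quot I)"
    proof (rule primeidealI[OF id Q.is_cring])
      show "carrier (R Quot I) \<noteq> (+>\<^bsub>R\<^esub>) I ` P"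
      proof
        assume e: "carrier (R Quot I) = (+>\<^bsub>R\<^esub>) I ` P"
        have "r \<in> P" if "r \<in> carrier R" for r
          using mem[OF P.is_ideal P(2) that] that unfolding e[symmetric] cQ by blast
        then show False using P.a_subset P.I_notcarr by blast
      qed
      fix a b assume "a \<in> carrier (R Quot I)" "b \<in> carrier (R Quot I)"
        and ab: "a \<otimes>\<^bsub>R Quot I\<^esub> b \<in> (+>\<^bsub>R\<^esub>) I ` P"
      then obtain r s where r: "r \<in> carrier R" "s \<in> carrier R" and e: "a = I +>\<^bsub>R\<^esub> r" "b = I +>\<^bsub>R\<^esub> s"
        by (auto simp: cQ)
      have "I +>\<^bsub>R\<^esub> (r \<otimes>\<^bsub>R\<^esub> s) \<in> (+>\<^bsub>R\<^esub>) I ` P" using ab r by (simp add: e)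
      then have "r \<otimes>\<^bsub>R\<^esub> s \<in> P" using mem[OF P.is_ideal P(2), of "r \<otimes>\<^bsub>R\<^esub> s"] r by blast
      then show "a \<in> (+>\<^bsub>R\<^esub>) I ` P \<or> b \<in> (+>\<^bsub>R\<^esub>) I ` P" using P.I_prime r e by blast
    qed
    then show "(+>\<^bsub>R\<^esub>) I ` P \<in> {P. primeideal P (R Quot I)}" by simp
  next
    fix P P' assume "P \<in> {P. primeideal P R \<and> I \<subseteq> P}" "P' \<in> {P. primeideal P R \<and> I \<subseteq> P}" "P \<subset> P'"
    then have P: "primeideal P R" "I \<subseteq> P" "primeideal P' R" "I \<subseteq> P'" "P \<subset> P'" by simp_all
    then obtain r where r: "r \<in> P'" "r \<notin> P" by blast
    have "I +>\<^bsub>R\<^esub> r \<notin> (+>\<^bsub>R\<^esub>) I ` P"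
      using mem[OF primeideal.axioms(1)[OF P(1)] P(2)] prime_subset[OF P(3)] r by blast
    then show "(+>\<^bsub>R\<^esub>) I ` P \<subset> (+>\<^bsub>R\<^esub>) I ` P'" using r P(5) by blast
  qed
qed

lemma prime_chain_of_seq:
  "(\<And>i. i \<le> n \<Longrightarrow> primeideal (S i) R) \<Longrightarrow> (\<And>i. i < n \<Longrightarrow> S i \<subset> S (Suc i)) \<Longrightarrow> prime_chain R n (S 0) (S n)"
proof (induction n arbitrary: S)
  case (Suc n)
  have "prime_chain R n (S (Suc 0)) (S (Suc n))" using Suc.IH[of "\<lambda>i. S (Suc i)"] Suc.prems by auto
  then show ?case using Suc.prems(1)[of 0] Suc.prems(2)[of 0] by auto
qed auto

lemma seq_of_prime_chain:
  "prime_chain R n Q P \<Longrightarrow> \<exists>S. S 0 = Q \<and> S n = P \<and>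
    (\<forall>i\<le>n. primeideal (S i) R \<and> Q \<subseteq> S i \<and> S i \<subseteq> P) \<and> (\<forall>i<n. S i \<subset> S (Suc i))"
proof (induction n arbitrary: Q)
  case 0
  then show ?case by (intro exI[of _ "\<lambda>_. Q"]) auto
next
  case (Suc n)
  then obtain Q' where Q': "primeideal Q R" "Q \<subset> Q'" "prime_chain R n Q' P" by auto
  obtain S where S: "S 0 = Q'" "S n = P" "\<forall>i\<le>n. primeideal (S i) R \<and> Q' \<subseteq> S i \<and> S i \<subseteq> P"
    "\<forall>i<n. S i \<subset> S (Suc i)" using Suc.IH[OF Q'(3)] by blast
  let ?S = "\<lambda>i. case i of 0 \<Rightarrow> Q | Suc j \<Rightarrow> S j"
  have "Q \<subseteq> P" using prime_chain_subset[OF Q'(3)] Q'(2) by blast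
  then have "primeideal (?S i) R \<and> Q \<subseteq> ?S i \<and> ?S i \<subseteq> P" if "i \<le> Suc n" for i
    using S(3) Q'(1,2) that by (cases i) (simp_all, blast)
  then have "\<forall>i\<le>Suc n. primeideal (?S i) R \<and> Q \<subseteq> ?S i \<and> ?S i \<subseteq> P" by blast
  moreover have "\<forall>i<Suc n. ?S i \<subset> ?S (Suc i)" using S Q'(2) by (auto split: nat.split)
  ultimately show ?case using S(2) by (intro exI[of _ ?S]) auto
qed

text \<open>As every element of \<open>A\<close> is contained in \<open>P \<in> A\<close>, chains may be assumed to end in \<open>P\<close>.\<close>

lemma chain_dim_top:
  assumes A: "\<And>Q. Q \<in> A \<longleftrightarrow> primeideal Q R \<and> I \<subseteq> Q \<and> Q \<subseteq> P" and P: "primeideal P R"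
  shows "chain_dim A = Sup {enat n | n. \<exists>Q\<in>A. prime_chain R n Q P}"
proof (rule antisym)
  show "chain_dim A \<le> Sup {enat n | n. \<exists>Q\<in>A. prime_chain R n Q P}"
    unfolding chain_dim_def
  proof (rule Sup_least, clarify)
    fix n and S :: "nat \<Rightarrow> 'a set" assume S: "\<forall>i\<le>n. S i \<in> A" "\<forall>i<n. S i \<subset> S (Suc i)"
    then have "prime_chain R n (S 0) (S n)" using A by (intro prime_chain_of_seq) auto
    moreover obtain m where "prime_chain R m (S n) P" using prime_chain_step[of "S n" R P] S(1) A P by auto
    ultimately have "prime_chain R (n + m) (S 0) P" by (rule prime_chain_trans)
    then have "enat (n + m) \<le> Sup {enat n | n. \<exists>Q\<in>A. prime_chain R n Q P}"
      using S(1) by (intro Sup_upper) blast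
    then show "enat n \<le> Sup {enat n | n. \<exists>Q\<in>A. prime_chain R n Q P}" by (rule order.trans[rotated]) simp
  qed
  show "Sup {enat n | n. \<exists>Q\<in>A. prime_chain R n Q P} \<le> chain_dim A"
    unfolding chain_dim_def
  proof (rule Sup_subset_mono, clarify)
    fix n Q assume Q: "Q \<in> A" "prime_chain R n Q P"
    obtain S where "\<forall>i\<le>n. primeideal (S i) R \<and> Q \<subseteq> S i \<and> S i \<subseteq> P" "\<forall>i<n. S i \<subset> S (Suc i)"
      using seq_of_prime_chain[OF Q(2)] by blast
    moreover have "I \<subseteq> Q" using A Q(1) by blast
    ultimately have "(\<forall>i\<le>n. S i \<in> A) \<and> (\<forall>i<n. S i \<subset> S (Suc i))" unfolding A by (meson order_trans)
    then show "\<exists>m. enat n = enat m \<and> (\<exists>P. (\<forall>i\<le>m. P i \<in> A) \<and> (\<forall>i<m. P i \<subset> P (Suc i)))" by blast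
  qed
qed

text \<open>Turns equations for dimension and depth into statements about an attained maximum.
  Non-emptiness excludes the empty supremum, which is \<open>0\<close> without being
  attained.\<close>

lemma Sup_enat_eq_iff:
  fixes A :: "nat set"
  assumes "A \<noteq> {}"
  shows "Sup {enat n | n. n \<in> A} = enat d \<longleftrightarrow> d \<in> A \<and> (\<forall>n\<in>A. n \<le> d)"
proof
  assume S: "Sup {enat n | n. n \<in> A} = enat d"
  have le: "n \<le> d" if "n \<in> A" for n
  proof -
    have "enat n \<le> Sup {enat n | n. n \<in> A}" using that by (intro Sup_upper) blast
    then show ?thesis using S by simp
  qed
  then have fin: "finite A" using finite_subset[of A "{..d}"] by auto
  have "Sup {enat n | n. n \<in> A} \<le> enat (Max A)"
    by (rule Sup_least) (use fin in auto)
  then have "d \<le> Max A" using S by simp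
  then show "d \<in> A \<and> (\<forall>n\<in>A. n \<le> d)" using le Max_in[OF fin assms] by (metis le_antisym)
next
  assume d: "d \<in> A \<and> (\<forall>n\<in>A. n \<le> d)"
  show "Sup {enat n | n. n \<in> A} = enat d"
  proof (rule antisym)
    show "Sup {enat n | n. n \<in> A} \<le> enat d" by (rule Sup_least) (use d in auto)
    show "enat d \<le> Sup {enat n | n. n \<in> A}" by (rule Sup_upper) (use d in auto)
  qed
qed

locale local_noeth_module = noeth_module R M + R?: local_ring R \<mm> for R (structure) and M (structure) and \<mm>
begin

section \<open>Modules over a local ring\<close>

lemma mm_prime: "primeideal \<mm> R"
  using maximalideal_prime maximal by blast

lemma proper_ideal_subset:
  assumes "ideal I R" "I \<noteq> carrier R"
  shows "I \<subseteq> \<mm>"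
proof -
  define F where "F = {J. ideal J R \<and> I \<subseteq> J \<and> J \<noteq> carrier R}"
  have "\<exists>J\<in>F. \<forall>J'\<in>F. J \<subseteq> J' \<longrightarrow> J' = J"
    by (rule ideal_family_maximal) (use assms in \<open>auto simp: F_def\<close>)
  then obtain J where J: "ideal J R" "I \<subseteq> J" "J \<noteq> carrier R"
    and max: "\<And>J'. J' \<in> F \<Longrightarrow> J \<subseteq> J' \<Longrightarrow> J' = J" by (auto simp: F_def)
  have "maximalideal J R"
  proof (rule maximalidealI[OF J(1)])
    show "carrier R \<noteq> J" using J(3) by blast
    show "J' = J \<or> J' = carrier R" if "ideal J' R" "J \<subseteq> J'" "J' \<subseteq> carrier R" for J'
      using max[of J'] that J(2) by (auto simp: F_def)
  qed
  then show ?thesis using maximal_unique J(2) by blast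
qed

lemma prime_in_mm: "primeideal P R \<Longrightarrow> P \<subseteq> \<mm>"
  using proper_ideal_subset primeideal.axioms(1) primeideal.I_notcarr by metis

lemma mm_carr: "\<mm> \<subseteq> carrier R"
  using prime_subset mm_prime by blast

lemma unit_of_notin_mm:
  assumes "s \<in> carrier R - \<mm>" shows "\<exists>t\<in>carrier R. t \<otimes> s = \<one>"
proof -
  have "s \<in> PIdl s" using cgenideal_self assms by blast
  then have "PIdl s = carrier R" using proper_ideal_subset[OF cgenideal_ideal] assms by blast
  then have "\<one> \<in> PIdl s" by simp
  then show ?thesis by (auto simp: cgenideal_def)
qed

text \<open>Elements outside \<open>\<mm>\<close> are units, so localizing at \<open>\<mm>\<close>
  changes nothing and the local lemmas yield global statements.\<close>

lemma sat_mm: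
  assumes N: "submodule N R M" shows "sat \<mm> N = N"
proof
  show "N \<subseteq> sat \<mm> N" using sat_sup[OF N mm_prime] .
  show "sat \<mm> N \<subseteq> N"
  proof
    fix y assume "y \<in> sat \<mm> N"
    then obtain s where s: "s \<in> carrier R - \<mm>" "s \<cdot> y \<in> N" "y \<in> carrier M" by (auto simp: sat_def)
    obtain t where t: "t \<in> carrier R" "t \<otimes> s = \<one>" using unit_of_notin_mm[OF s(1)] by blast
    have "t \<cdot> (s \<cdot> y) = y" using s t smult_assoc1[of t s y] by simp
    then show "y \<in> N" using submoduleE(4)[OF N t(1) s(2)] by simp
  qed
qed

lemma mm_supp: "submodule N R M \<Longrightarrow> N \<noteq> carrier M \<Longrightarrow> \<mm> \<in> supp N"
  using sat_mm[of N] submoduleE(1)[of N] mm_prime by (auto simp: supp_def)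

lemma chain_dim_mm:
  assumes A: "\<And>Q. Q \<in> A \<longleftrightarrow> primeideal Q R \<and> I \<subseteq> Q" and "A \<noteq> {}"
  shows "chain_dim A = enat d \<longleftrightarrow>
    (\<exists>Q\<in>A. prime_chain R d Q \<mm>) \<and> (\<forall>Q\<in>A. \<forall>n. prime_chain R n Q \<mm> \<longrightarrow> n \<le> d)"
proof -
  let ?A = "{n. \<exists>Q\<in>A. prime_chain R n Q \<mm>}"
  have eq: "chain_dim A = Sup {enat n | n. n \<in> ?A}"
  proof -
    have "Q \<in> A \<longleftrightarrow> primeideal Q R \<and> I \<subseteq> Q \<and> Q \<subseteq> \<mm>" for Q using A prime_in_mm by blast
    from chain_dim_top[of A R I \<mm>, OF this mm_prime] show ?thesis by simp
  qed
  obtain Q where "Q \<in> A" using assms(2) by blast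
  then have "?A \<noteq> {}" using prime_chain_step[of Q R \<mm>] A prime_in_mm mm_prime by auto
  from Sup_enat_eq_iff[OF this, of d] show ?thesis unfolding eq by blast
qed

text \<open>A chain of primes over \<open>P\<close> whose lower end differs from \<open>P\<close>
  can be prolonged downwards to \<open>P\<close>, so it suffices to consider chains that start in
  \<open>P\<close>.\<close>

lemma krull_dim_quot_prime:
  assumes P: "primeideal P R"
  shows "krull_dim (R Quot P) = enat k \<longleftrightarrow>
    prime_chain R k P \<mm> \<and> (\<forall>n. prime_chain R n P \<mm> \<longrightarrow> n \<le> k)"
proof -
  let ?A = "{Q. primeideal Q R \<and> P \<subseteq> Q}"
  have "krull_dim (R Quot P) = chain_dim ?A"
    using krull_dim_quot[OF R.is_cring primeideal.axioms(1)[OF P]] .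
  moreover have "chain_dim ?A = enat k \<longleftrightarrow>
      (\<exists>Q\<in>?A. prime_chain R k Q \<mm>) \<and> (\<forall>Q\<in>?A. \<forall>n. prime_chain R n Q \<mm> \<longrightarrow> n \<le> k)"
    by (rule chain_dim_mm[of _ P]) (use P in auto)
  moreover have "prime_chain R (Suc n) P \<mm>" if "Q \<in> ?A" "Q \<noteq> P" "prime_chain R n Q \<mm>" for Q n
    using that P by auto
  ultimately show ?thesis using P
    by (smt (verit, best) mem_Collect_eq not_less_eq_eq order_refl Suc_leD)
qed

lemma module_dim_eq_iff:
  assumes "carrier M \<noteq> S0"
  shows "module_dim R M = enat d \<longleftrightarrow> (\<exists>Q\<in>supp S0. prime_chain R d Q \<mm>) \<and>
    (\<forall>Q\<in>supp S0. \<forall>n. prime_chain R n Q \<mm> \<longrightarrow> n \<le> d)"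
proof -
  have ann: "annihilator R M = {a \<in> carrier R. \<forall>z\<in>carrier M. a \<cdot> z \<in> S0}"
    by (simp add: annihilator_def)
  have supp: "supp S0 = {Q. primeideal Q R \<and> annihilator R M \<subseteq> Q}"
    using supp_iff_ann[OF submodule_zeroset] supp_prime unfolding ann by blast
  have "module_dim R M = chain_dim (supp S0)"
    unfolding module_dim_def supp using krull_dim_quot[OF R.is_cring annihilator_ideal] .
  moreover have "\<mm> \<in> supp S0" using mm_supp[OF submodule_zeroset] assms by blast
  ultimately show ?thesis using chain_dim_mm[of "supp S0" "annihilator R M" d] supp by auto
qed

text \<open>If two consecutive powers gave the same submodule, Nakayama's lemma would put a power of
  \<open>a\<close> into the annihilator of \<open>M/N\<close>, hence into \<open>Q\<close>.\<close>

lemma pow_strict: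
  assumes N: "submodule N R M" and Q: "Q \<in> supp N" and a: "a \<in> \<mm>" "a \<notin> Q"
  shows "addm N (a [^] Suc k) (carrier M) \<subset> addm N (a [^] (k::nat)) (carrier M)"
proof
  have aR: "a \<in> carrier R" using a mm_carr by blast
  have S: "submodule (addm N (a [^] j) (carrier M)) R M" "N \<subseteq> addm N (a [^] j) (carrier M)"
    "\<And>v. v \<in> carrier M \<Longrightarrow> a [^] j \<cdot> v \<in> addm N (a [^] j) (carrier M)" for j :: nat
    using addm_carr[OF N, of "a [^] j"] aR by simp_all
  show "addm N (a [^] Suc k) (carrier M) \<subseteq> addm N (a [^] k) (carrier M)"
    by (rule addm_least[OF S(1,2)]) (use S(3)[of "a \<cdot> _" k] aR in \<open>simp add: smult_assoc1\<close>)
  show "addm N (a [^] Suc k) (carrier M) \<noteq> addm N (a [^] k) (carrier M)"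
  proof
    assume e: "addm N (a [^] Suc k) (carrier M) = addm N (a [^] k) (carrier M)"
    have "addm N (a [^] k) (carrier M) \<subseteq> sat \<mm> N"
    proof (rule nakayama[OF S(1) N mm_prime primeideal.axioms(1)[OF mm_prime]])
      fix W assume W: "submodule W R M" "N \<subseteq> W"
        and JW: "\<And>j z. j \<in> \<mm> \<Longrightarrow> z \<in> addm N (a [^] k) (carrier M) \<Longrightarrow> j \<cdot> z \<in> W"
      have "a [^] Suc k \<cdot> v \<in> W" if v: "v \<in> carrier M" for v
      proof -
        have "a [^] Suc k \<cdot> v = a \<cdot> (a [^] k \<cdot> v)"
          using aR v by (simp add: smult_assoc1 smult_comm)
        then show ?thesis using JW[OF a(1) S(3)[OF v]] by simp
      qed
      then have "addm N (a [^] Suc k) (carrier M) \<subseteq> W" using addm_least[OF W] by blast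
      then show "addm N (a [^] k) (carrier M) \<subseteq> sat \<mm> W" using e sat_sup[OF W(1) mm_prime] by blast
    qed simp
    then have kN: "a [^] k \<cdot> v \<in> N" if "v \<in> carrier M" for v using S(3)[OF that] sat_mm[OF N] by blast
    have Qp: "primeideal Q R" using supp_prime[OF Q] .
    have "a [^] k \<in> Q" using Q kN aR supp_iff_ann[OF N Qp] by auto
    then show False using prime_pow[OF Qp aR] a(2) by blast
  qed
qed

text \<open>A prime other than \<open>\<mm>\<close> in the support leaves out some \<open>a\<close>
  in \<open>\<mm>\<close>, whose powers give strict chains of every length. Conversely, if only
  \<open>\<mm>\<close> occurs, \<open>local_chain_bounded\<close> at \<open>\<mm>\<close> bounds all
  chains.\<close>

lemma module_length_quot:
  assumes N: "submodule N R M"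
  shows "module_length R (quot_module R M N) < \<infinity> \<longleftrightarrow> (\<forall>Q\<in>supp N. Q = \<mm>)"
proof
  assume fin: "module_length R (quot_module R M N) < \<infinity>"
  show "\<forall>Q\<in>supp N. Q = \<mm>"
  proof (rule ballI, rule ccontr)
    fix Q assume Q: "Q \<in> supp N" "Q \<noteq> \<mm>"
    then obtain a where a: "a \<in> \<mm>" "a \<notin> Q" using prime_in_mm supp_prime by blast
    have aR: "a \<in> carrier R" using a mm_carr by blast
    define L where "L k = addm N (a [^] k) (carrier M)" for k :: nat
    have L: "submodule (L k) R M" "N \<subseteq> L k" for k
      using addm_carr(1,2)[OF N, of "a [^] k"] aR by (simp_all add: L_def)
    have "enat n \<le> module_length R (quot_module R M N)" for n
      unfolding module_length_def
    proof (rule Sup_upper, rule CollectI, intro exI conjI allI impI)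
      define C where "C i = (\<lambda>y. N +>\<^bsub>M\<^esub> y) ` L (n - i)" for i
      show "enat n = enat n" ..
      show "submodule (C i) R (quot_module R M N)" for i
        unfolding C_def by (rule quot_submodule_image[OF N L(1)])
      fix i assume i: "i < n"
      then obtain k where k: "n - i = Suc k" "n - Suc i = k" by (metis Suc_diff_Suc)
      have "L (Suc k) \<subset> L k" unfolding L_def using pow_strict[OF N Q(1) a] .
      then obtain y where y: "y \<in> L k" "y \<notin> L (Suc k)" and sub: "L (Suc k) \<subseteq> L k" by blast
      have "N +>\<^bsub>M\<^esub> y \<in> C (Suc i)" "N +>\<^bsub>M\<^esub> y \<notin> C i"
        unfolding C_def k using y coset_image_mem_iff[OF N L] submodule_carr[OF L(1)] by blast+
      moreover have "C i \<subseteq> C (Suc i)" unfolding C_def k using sub by blast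
      ultimately show "C i \<subset> C (Suc i)" by blast
    qed
    moreover obtain k where "module_length R (quot_module R M N) = enat k" using fin by auto
    ultimately have "enat (Suc k) \<le> enat k" by metis
    then show False by simp
  qed
next
  assume Q: "\<forall>Q\<in>supp N. Q = \<mm>"
  have "\<exists>n. \<forall>C m. local_chain \<mm> N C \<longrightarrow> card {i. i < m \<and> C i \<noteq> C (Suc i)} \<le> n"
    by (rule local_chain_bounded[OF N mm_prime]) (use Q supp_iff_ann[OF N] in blast)
  then obtain b where b: "\<And>C m. local_chain \<mm> N C \<Longrightarrow> card {i. i < m \<and> C i \<noteq> C (Suc i)} \<le> b" by blast
  have "module_length R (quot_module R M N) \<le> enat b"
    unfolding module_length_def
  proof (rule Sup_least, clarify)
    fix n and H :: "nat \<Rightarrow> 'c set set"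
    assume H: "\<forall>i\<le>n. submodule (H i) R (quot_module R M N)" "\<forall>i<n. H i \<subset> H (Suc i)"
    \<comment> \<open>The finite chain is continued constantly beyond \<open>n\<close>, as
      \<open>local_chain\<close> speaks of infinite sequences.\<close>
    define C where "C i = {y \<in> carrier M. N +>\<^bsub>M\<^esub> y \<in> H (min i n)}" for i
    have sub: "submodule (C i) R M" "N \<subseteq> C i" "H (min i n) = (\<lambda>y. N +>\<^bsub>M\<^esub> y) ` C i" for i
      unfolding C_def using quot_submodule_vimage[OF N, of "H (min i n)"] H(1) by auto
    have "local_chain \<mm> N C"
      unfolding local_chain_def
    proof (intro allI conjI)
      fix i
      show "submodule (C i) R M" "N \<subseteq> C i" using sub by blast+
      show "sat \<mm> (C i) \<subseteq> C i" using sat_mm[OF sub(1)] by blast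
      have "H (min i n) \<subseteq> H (min (Suc i) n)" using H(2) by (cases "i < n") (auto simp: min_def)
      then show "C i \<subseteq> C (Suc i)" by (auto simp: C_def)
    qed
    moreover have "{i. i < n \<and> C i \<noteq> C (Suc i)} = {..<n}"
    proof -
      have "C i \<noteq> C (Suc i)" if "i < n" for i
      proof
        assume "C i = C (Suc i)"
        then have "H (min i n) = H (min (Suc i) n)" using sub(3) by metis
        then show False using H(2) that by (auto simp: min_def)
      qed
      then show ?thesis by blast
    qed
    ultimately have "n \<le> b" using b[of C n] by simp
    then show "enat n \<le> enat b" by simp
  qed
  then show "module_length R (quot_module R M N) < \<infinity>" using order.strict_trans1 by fastforce
qed

section \<open>Systems of parameters\<close>

text \<open>Says that \<open>M/(xs)M\<close> has dimension at most \<open>d - length xs\<close>,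
  with the subtraction moved to the other side. For a list of length \<open>d\<close> it leaves only
  \<open>\<mm>\<close> in the support, that is, finite length.\<close>

definition params :: "nat \<Rightarrow> 'a list \<Rightarrow> bool"
  where "params d xs \<longleftrightarrow> set xs \<subseteq> \<mm> \<and>
    (\<forall>Q\<in>supp S0. set xs \<subseteq> Q \<longrightarrow> (\<forall>n. prime_chain R n Q \<mm> \<longrightarrow> n + length xs \<le> d))"

lemma params_bound:
  "params d xs \<Longrightarrow> Q \<in> supp S0 \<Longrightarrow> set xs \<subseteq> Q \<Longrightarrow> prime_chain R n Q \<mm> \<Longrightarrow> n + length xs \<le> d"
  unfolding params_def by blast

lemma mm_list_carr: "set xs \<subseteq> \<mm> \<Longrightarrow> set xs \<subseteq> carrier R"
  using mm_carr by blast

lemma seqm_S0: "set xs \<subseteq> \<mm> \<Longrightarrow> submodule (seqm S0 xs) R M"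
  using seqm_submodule[OF submodule_zeroset] mm_list_carr by blast

lemma supp_seqm_S0: "set xs \<subseteq> \<mm> \<Longrightarrow> supp (seqm S0 xs) = {Q \<in> supp S0. set xs \<subseteq> Q}"
  using supp_seqm[OF submodule_zeroset] mm_list_carr by blast

lemma quot_seq_eq: "set xs \<subseteq> \<mm> \<Longrightarrow> quot_seq R M xs = quot_module R M (seqm S0 xs)"
  using ideal_smult_eq_seqm[OF mm_list_carr] by simp

text \<open>Each omitted parameter can raise the dimension by at most one: a chain over
  \<open>xs\<close> loses at most \<open>length zs\<close> steps when its lower end is required to
  contain \<open>zs\<close> as well.\<close>

lemma params_prefix:
  assumes "params d (xs @ zs)" shows "params d xs"
  unfolding params_def
proof (intro conjI ballI impI allI)
  show "set xs \<subseteq> \<mm>" using assms by (simp add: params_def)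
  fix Q n assume Q: "Q \<in> supp S0" "set xs \<subseteq> Q" "prime_chain R n Q \<mm>"
  obtain Q' where Q': "Q \<subseteq> Q'" "set zs \<subseteq> Q'" "prime_chain R (n - length zs) Q' \<mm>"
    using prime_chain_drop_list[OF Q(3), of zs] assms by (auto simp: params_def)
  have "Q' \<in> supp S0" using supp_up[OF Q(1) Q'(1)] prime_chain_primes(1)[OF Q'(3)] .
  \<comment> \<open>Truncation of the difference is harmless: if \<open>n\<close> is below
    \<open>length zs\<close>, the bound with \<open>0\<close> in its place is stronger than the one
    wanted.\<close>
  then have "n - length zs + length (xs @ zs) \<le> d" using assms Q Q' unfolding params_def by auto
  then show "n + length xs \<le> d" by simp
qed

lemma sop_iff:
  assumes "module_dim R M = enat d" and "carrier M \<noteq> S0"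
  shows "sop R \<mm> M xs \<longleftrightarrow> length xs = d \<and> params d xs"
proof -
  have "(\<forall>Q\<in>supp (seqm S0 xs). Q = \<mm>) \<longleftrightarrow> params d xs" if xs: "set xs \<subseteq> \<mm>" "length xs = d"
  proof
    assume a: "\<forall>Q\<in>supp (seqm S0 xs). Q = \<mm>"
    have "n = 0" if "Q \<in> supp S0" "set xs \<subseteq> Q" "prime_chain R n Q \<mm>" for Q n
    proof -
      have "Q = \<mm>" using a that(1,2) supp_seqm_S0[OF xs(1)] by blast
      then show ?thesis using that(3) prime_chain_self by blast
    qed
    then show "params d xs" using xs by (auto simp: params_def)
  next
    assume p: "params d xs"
    show "\<forall>Q\<in>supp (seqm S0 xs). Q = \<mm>"
    proof
      fix Q assume "Q \<in> supp (seqm S0 xs)"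
      then have Q: "Q \<in> supp S0" "set xs \<subseteq> Q" using supp_seqm_S0[OF xs(1)] by auto
      have "primeideal Q R" using supp_prime Q by blast
      then obtain n where n: "prime_chain R n Q \<mm>" "Q \<noteq> \<mm> \<longrightarrow> n = 1"
        using prime_chain_step[OF _ mm_prime prime_in_mm] by blast
      then have "n + length xs \<le> d" using p Q by (auto simp: params_def)
      then show "Q = \<mm>" using n xs by auto
    qed
  qed
  moreover have "module_length R (quot_seq R M xs) < \<infinity> \<longleftrightarrow> (\<forall>Q\<in>supp (seqm S0 xs). Q = \<mm>)"
    if "set xs \<subseteq> \<mm>"
    unfolding quot_seq_eq[OF that] by (rule module_length_quot[OF seqm_S0[OF that]])
  moreover have "params d xs \<Longrightarrow> set xs \<subseteq> \<mm>" by (simp add: params_def)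
  ultimately show ?thesis unfolding sop_def assms(1) enat.inject by blast
qed

text \<open>Below any \<open>Q\<close> in the support of the quotient lies an associated prime;
  unless it is \<open>\<mm>\<close>, it misses \<open>z\<close>, so a chain from a prime containing
  \<open>z\<close> can be prolonged downwards. All associated primes except \<open>\<mm>\<close> are
  avoided, also the embedded ones, since the same \<open>z\<close> has to meet the reducing
  condition.\<close>

lemma params_extend:
  assumes p: "params d xs" and "length xs < d"
  shows "\<exists>z. params d (xs @ [z]) \<and> (\<forall>Q\<in>ass (seqm S0 xs). Q \<noteq> \<mm> \<longrightarrow> z \<notin> Q)"
proof -
  have xs: "set xs \<subseteq> \<mm>" using p by (simp add: params_def)
  let ?F = "ass (seqm S0 xs) - {\<mm>}"
  have "finite ?F" using finite_ass[OF seqm_S0[OF xs]] by blast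
  moreover have "primeideal Q R \<and> \<not> \<mm> \<subseteq> Q" if "Q \<in> ?F" for Q
    using that ass_prime prime_in_mm by blast
  ultimately obtain z where z: "z \<in> \<mm>" "\<forall>Q\<in>?F. z \<notin> Q"
    using prime_avoidance[of ?F \<mm>] primeideal.axioms(1)[OF mm_prime] by blast
  have "params d (xs @ [z])"
    unfolding params_def
  proof (intro conjI ballI impI allI)
    show "set (xs @ [z]) \<subseteq> \<mm>" using xs z by simp
    fix Q n assume Q: "Q \<in> supp S0" "set (xs @ [z]) \<subseteq> Q" "prime_chain R n Q \<mm>"
    have "Q \<in> supp (seqm S0 xs)" using Q supp_seqm_S0[OF xs] by auto
    then obtain Q0 where Q0: "Q0 \<in> ass (seqm S0 xs)" "Q0 \<subseteq> Q" using supp_ass[OF seqm_S0[OF xs]] by blast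
    have Q0s: "Q0 \<in> supp S0" "set xs \<subseteq> Q0" using ass_supp[OF Q0(1)] supp_seqm_S0[OF xs] by auto
    show "n + length (xs @ [z]) \<le> d"
    proof (cases "Q0 = Q")
      case True
      then have "Q = \<mm>" using z Q0 Q by auto
      then show ?thesis using prime_chain_self[of R n \<mm>] Q(3) assms(2) by simp
    next
      case False
      then have "Q0 \<subset> Q" using Q0(2) by blast
      then have "prime_chain R (Suc n) Q0 \<mm>" using ass_prime[OF Q0(1)] Q(3) by auto
      then have "Suc n + length xs \<le> d" by (rule params_bound[OF p Q0s])
      then show ?thesis by simp
    qed
  qed
  then show ?thesis using z by blast
qed

lemma params_complete:
  assumes "params d xs" and "length xs \<le> d"
  shows "\<exists>zs. params d (xs @ zs) \<and> length (xs @ zs) = d \<and>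
    (\<forall>i<length zs. \<forall>Q\<in>ass (seqm S0 (xs @ take i zs)). Q \<noteq> \<mm> \<longrightarrow> zs ! i \<notin> Q)"
  using assms
proof (induction "d - length xs" arbitrary: xs)
  case 0
  then show ?case by (intro exI[of _ "[]"]) simp
next
  case (Suc n)
  then obtain z where z: "params d (xs @ [z])" "\<forall>Q\<in>ass (seqm S0 xs). Q \<noteq> \<mm> \<longrightarrow> z \<notin> Q"
    using params_extend[of d xs] by (metis zero_less_Suc zero_less_diff)
  have "n = d - length (xs @ [z])" "length (xs @ [z]) \<le> d" using Suc.hyps(2) by auto
  then obtain zs where zs: "params d ((xs @ [z]) @ zs)" "length ((xs @ [z]) @ zs) = d"
    "\<forall>i<length zs. \<forall>Q\<in>ass (seqm S0 ((xs @ [z]) @ take i zs)). Q \<noteq> \<mm> \<longrightarrow> zs ! i \<notin> Q"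
    using Suc.hyps(1)[OF _ z(1)] by blast
  have "\<forall>Q\<in>ass (seqm S0 (xs @ take i (z # zs))). Q \<noteq> \<mm> \<longrightarrow> (z # zs) ! i \<notin> Q"
    if "i < length (z # zs)" for i
    using that zs(3) z(2) by (cases i) auto
  then show ?case using zs by (intro exI[of _ "z # zs"]) simp
qed

lemma part_of_sop_iff:
  assumes "module_dim R M = enat d" and "carrier M \<noteq> S0" and "length xs \<le> d"
  shows "part_of_sop R \<mm> M xs \<longleftrightarrow> params d xs"
  unfolding part_of_sop_def sop_iff[OF assms(1,2)]
  using params_prefix params_complete[OF _ assms(3)] by blast

text \<open>The part of the reducing condition that concerns \<open>xs\<close> alone, with indices
  from \<open>0\<close> and with \<open>d\<close> in place of the length of the completed
  system.\<close>

definition reducing :: "nat \<Rightarrow> 'a list \<Rightarrow> bool"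
  where "reducing d xs \<longleftrightarrow> (\<forall>i<length xs. \<forall>Q\<in>ass (seqm S0 (take i xs)).
    krull_dim (R Quot Q) = enat (d - Suc i) \<longrightarrow> xs ! i \<notin> Q)"

text \<open>Existence of a reducing completion imposes nothing further: the completion from
  \<open>params_complete\<close> avoids all associated primes except \<open>\<mm>\<close>. As
  \<open>length xs < d\<close>, every position of \<open>xs\<close> falls under the
  condition.\<close>

lemma part_of_reducing_sop_iff:
  assumes dim: "module_dim R M = enat d" "carrier M \<noteq> S0" and len: "length xs < d"
  shows "part_of_reducing_sop R \<mm> M xs \<longleftrightarrow> params d xs \<and> reducing d xs"
proof
  assume "part_of_reducing_sop R \<mm> M xs"
  then obtain zs where zs: "reducing_sop R \<mm> M (xs @ zs)" by (auto simp: part_of_reducing_sop_def)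
  then have s: "length (xs @ zs) = d" "params d (xs @ zs)"
    using sop_iff[OF dim] by (auto simp: reducing_sop_def)
  have p: "params d xs" using params_prefix[OF s(2)] .
  have "reducing d xs"
    unfolding reducing_def
  proof (intro allI impI ballI)
    fix i Q assume i: "i < length xs" and Q: "Q \<in> ass (seqm S0 (take i xs))"
      "krull_dim (R Quot Q) = enat (d - Suc i)"
    have "set (take i xs) \<subseteq> \<mm>" using p set_take_subset[of i xs] by (auto simp: params_def)
    then have "Ass R (quot_seq R M (take i xs)) = ass (seqm S0 (take i xs))"
      using quot_seq_eq Ass_quot[OF seqm_S0] by simp
    moreover have "Suc i \<in> {1..<length (xs @ zs)}" "take (Suc i - 1) (xs @ zs) = take i xs"
      "(xs @ zs) ! (Suc i - 1) = xs ! i" using i len s(1) by (auto simp: nth_append)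
    ultimately show "xs ! i \<notin> Q" using zs Q s(1) unfolding reducing_sop_def by metis
  qed
  then show "params d xs \<and> reducing d xs" using p by blast
next
  assume a: "params d xs \<and> reducing d xs"
  obtain zs where zs: "params d (xs @ zs)" "length (xs @ zs) = d"
    "\<forall>i<length zs. \<forall>Q\<in>ass (seqm S0 (xs @ take i zs)). Q \<noteq> \<mm> \<longrightarrow> zs ! i \<notin> Q"
    using params_complete[of d xs] a len by auto
  have "(xs @ zs) ! i \<notin> Q"
    if i: "Suc i < d" and Q: "Q \<in> Ass R (quot_seq R M (take i (xs @ zs)))"
      "krull_dim (R Quot Q) = enat (d - Suc i)" for i Q
  proof -
    have "set (take i (xs @ zs)) \<subseteq> \<mm>"
      using zs(1) set_take_subset[of i "xs @ zs"] unfolding params_def by blast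
    from Ass_quot[OF seqm_S0[OF this]] have Q': "Q \<in> ass (seqm S0 (take i (xs @ zs)))"
      using Q(1) unfolding quot_seq_eq[OF \<open>set (take i (xs @ zs)) \<subseteq> \<mm>\<close>] by blast
    show ?thesis
    proof (cases "i < length xs")
      case True
      then show ?thesis using a Q' Q(2) by (auto simp: reducing_def nth_append)
    next
      case False
      then obtain j where j: "i = length xs + j" using le_Suc_ex not_less by blast
      \<comment> \<open>The reducing condition stops before the last element, so
        \<open>dim R/Q\<close> is positive here, whereas \<open>\<mm>\<close> has dimension
        \<open>0\<close>.\<close>
      have "Q \<noteq> \<mm>"
        using Q(2) krull_dim_quot_prime[OF ass_prime[OF Q']] prime_chain_self i by fastforce
      moreover have "take i (xs @ zs) = xs @ take j zs" "(xs @ zs) ! i = zs ! j" "j < length zs"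
        using j i zs(2) by auto
      ultimately show ?thesis using zs(3) Q' by metis
    qed
  qed
  then have "\<forall>i\<in>{1..<length (xs @ zs)}. \<forall>P\<in>Ass R (quot_seq R M (take (i - 1) (xs @ zs))).
      krull_dim (R Quot P) = enat (length (xs @ zs) - i) \<longrightarrow> (xs @ zs) ! (i - 1) \<notin> P"
    unfolding zs(2) by (metis One_nat_def Suc_pred atLeastLessThan_iff less_eq_Suc_le)
  then have "reducing_sop R \<mm> M (xs @ zs)"
    using sop_iff[OF dim] zs(1,2) unfolding reducing_sop_def by blast
  then show "part_of_reducing_sop R \<mm> M xs" by (auto simp: part_of_reducing_sop_def)
qed

lemma reducing_iff_regseq:
  assumes p: "params d xs" and len: "length xs < d"
  shows "reducing d xs \<longleftrightarrow> (\<forall>P\<in>supp S0. set xs \<subseteq> P \<longrightarrow>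
    krull_dim (R Quot P) = enat (d - length xs) \<longrightarrow> regseq P S0 xs)"
proof
  have xm: "set xs \<subseteq> \<mm>" using p by (simp add: params_def)
  have tm: "set (take i xs) \<subseteq> \<mm>" for i using xm set_take_subset[of i xs] by blast
  {
    assume red: "reducing d xs"
    show "\<forall>P\<in>supp S0. set xs \<subseteq> P \<longrightarrow> krull_dim (R Quot P) = enat (d - length xs) \<longrightarrow> regseq P S0 xs"
    proof (intro ballI impI)
      fix P assume P: "P \<in> supp S0" "set xs \<subseteq> P" "krull_dim (R Quot P) = enat (d - length xs)"
      have prP: "primeideal P R" using supp_prime[OF P(1)] .
      have cP: "prime_chain R (d - length xs) P \<mm>" using krull_dim_quot_prime[OF prP] P(3) by blast
      show "regseq P S0 xs"
      proof (rule regseq_of_avoiding[OF submodule_zeroset prP P(2)], rule notI)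
        fix i Q n assume i: "i < length xs" and Q: "Q \<in> ass (seqm S0 (take i xs))" "Q \<subseteq> P"
          and n: "prime_chain R n Q P" "n \<ge> length xs - Suc i" and x: "xs ! i \<in> Q"
        have Qs: "Q \<in> supp S0" "set (take i xs) \<subseteq> Q" using ass_supp[OF Q(1)] supp_seqm_S0[OF tm] by auto
        have Qt: "set (take (Suc i) xs) \<subseteq> Q" using Qs(2) x i by (simp add: take_Suc_conv_app_nth)
        have "params d (take (Suc i) xs)" using params_prefix[of d "take (Suc i) xs" "drop (Suc i) xs"] p by simp
        then have le: "m + Suc i \<le> d" if "prime_chain R m Q \<mm>" for m
          using params_bound[OF _ Qs(1) Qt that] i by simp
        have c: "prime_chain R (n + (d - length xs)) Q \<mm>" using prime_chain_trans[OF n(1) cP] .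
        \<comment> \<open>The chain from \<open>Q\<close> through \<open>P\<close> has at least
          \<open>d - Suc i\<close> steps, and no chain from \<open>Q\<close> has more, because
          \<open>Q\<close> contains the first \<open>Suc i\<close> parameters. So
          \<open>dim R/Q\<close> has exactly the value in the reducing condition.\<close>
        have "n + (d - length xs) = d - Suc i" using le[OF c] n(2) i len by linarith
        then have "krull_dim (R Quot Q) = enat (d - Suc i)"
          unfolding krull_dim_quot_prime[OF ass_prime[OF Q(1)]] using c le by fastforce
        then show False using red i Q(1) x unfolding reducing_def by blast
      qed
    qed
  }
  assume reg: "\<forall>P\<in>supp S0. set xs \<subseteq> P \<longrightarrow> krull_dim (R Quot P) = enat (d - length xs) \<longrightarrow> regseq P S0 xs"
  show "reducing d xs"
    unfolding reducing_def
  proof (intro allI impI ballI notI)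
    fix i Q assume i: "i < length xs" and Q: "Q \<in> ass (seqm S0 (take i xs))"
      and dQ: "krull_dim (R Quot Q) = enat (d - Suc i)" and x: "xs ! i \<in> Q"
    have Qs: "Q \<in> supp S0" "set (take i xs) \<subseteq> Q" using ass_supp[OF Q] supp_seqm_S0[OF tm] by auto
    have "prime_chain R (d - Suc i) Q \<mm>" using dQ krull_dim_quot_prime[OF ass_prime[OF Q]] by blast
    moreover have "set (drop (Suc i) xs) \<subseteq> \<mm>" using xm set_drop_subset[of "Suc i" xs] by blast
    \<comment> \<open>The remaining \<open>r - Suc i\<close> parameters, with
      \<open>r = length xs\<close>, cost at most as many steps of a chain of length
      \<open>d - Suc i\<close>. The resulting \<open>P\<close> keeps a chain of length
      \<open>d - r\<close>, and the parameter bound makes this its exact dimension.\<close>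
    ultimately have "\<exists>P. Q \<subseteq> P \<and> set (drop (Suc i) xs) \<subseteq> P \<and>
        prime_chain R (d - Suc i - length (drop (Suc i) xs)) P \<mm>" by (rule prime_chain_drop_list)
    then obtain P where P: "Q \<subseteq> P" "set (drop (Suc i) xs) \<subseteq> P"
      "prime_chain R (d - Suc i - length (drop (Suc i) xs)) P \<mm>"
      by blast
    have "d - Suc i - length (drop (Suc i) xs) = d - length xs" using i len by simp
    then have c: "prime_chain R (d - length xs) P \<mm>" using P(3) by simp
    have prP: "primeideal P R" using prime_chain_primes(1)[OF c] .
    have Ps: "P \<in> supp S0" using supp_up[OF Qs(1) P(1) prP] .
    have "set xs = set (take i xs) \<union> {xs ! i} \<union> set (drop (Suc i) xs)"
      using i by (metis id_take_nth_drop list.simps(15) set_append Un_insert_right sup_bot_right Un_insert_left)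
    then have xP: "set xs \<subseteq> P" using Qs(2) x P by blast
    have "n \<le> d - length xs" if "prime_chain R n P \<mm>" for n
      using params_bound[OF p Ps xP that] by simp
    then have "krull_dim (R Quot P) = enat (d - length xs)"
      using krull_dim_quot_prime[OF prP] c by blast
    then have "regseq P S0 xs" using reg Ps xP by blast
    then have "reg P (seqm S0 (take i xs)) (xs ! i)" using i regseq_iff_nth by blast
    moreover have "xs ! i \<in> carrier R" using x prime_subset[OF ass_prime[OF Q]] by blast
    ultimately show False using reg_iff_ass[OF seqm_S0[OF tm] prP] Q P(1) x by blast
  qed
qed

text \<open>The two suprema are the dimension and the depth of \<open>M_P\<close> in terms of
  \<open>R\<close> and \<open>M\<close>. The first is at most \<open>length xs\<close>, and the
  second is at most the first by climbing from an associated prime; a regular \<open>xs\<close>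
  therefore forces equality in both. Conversely the depth is attained by some \<open>ys\<close>, and
  \<open>regseq_of_parameters\<close> passes from \<open>ys\<close> to \<open>xs\<close>.\<close>

lemma regseq_iff_cohen_macaulay:
  assumes p: "params d xs" and len: "length xs < d"
    and dim: "\<And>Q n. Q \<in> supp S0 \<Longrightarrow> prime_chain R n Q \<mm> \<Longrightarrow> n \<le> d"
    and P: "P \<in> supp S0" "set xs \<subseteq> P" "krull_dim (R Quot P) = enat (d - length xs)"
  shows "regseq P S0 xs \<longleftrightarrow>
    Sup {enat n | n. \<exists>Q\<in>supp S0. prime_chain R n Q P} = enat (length xs) \<and>
    Sup {enat (length ys) | ys. set ys \<subseteq> P \<and> regseq P S0 ys} = enat (length xs)"
proof -
  let ?r = "length xs"
  let ?A = "{n. \<exists>Q\<in>supp S0. prime_chain R n Q P}" and ?B = "length ` {ys. set ys \<subseteq> P \<and> regseq P S0 ys}"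
  have prP: "primeideal P R" using supp_prime[OF P(1)] .
  have cP: "prime_chain R (d - ?r) P \<mm>" using krull_dim_quot_prime[OF prP] P(3) by blast
  have A: "n \<le> ?r" if "n \<in> ?A" for n
  proof -
    from that obtain Q where "Q \<in> supp S0" "prime_chain R n Q P" by blast
    then have "n + (d - ?r) \<le> d" using dim prime_chain_trans[OF _ cP] by blast
    then show ?thesis using len by simp
  qed
  obtain Q0 where Q0: "Q0 \<in> ass S0" "Q0 \<subseteq> P" using supp_ass[OF submodule_zeroset P(1)] by blast
  have B: "\<exists>n\<in>?A. n \<ge> length ys" if "set ys \<subseteq> P" "regseq P S0 ys" for ys
    using regseq_climb[OF submodule_zeroset prP that Q0] ass_supp[OF Q0(1)] by blast
  have "0 \<in> ?A" using P(1) prP by auto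
  then have An: "?A \<noteq> {}" by blast
  have Bn: "?B \<noteq> {}" by (auto intro!: exI[of _ "[]"])
  have eqA: "{enat n | n. \<exists>Q\<in>supp S0. prime_chain R n Q P} = {enat n | n. n \<in> ?A}" by blast
  have eqB: "{enat (length ys) | ys. set ys \<subseteq> P \<and> regseq P S0 ys} = {enat n | n. n \<in> ?B}" by blast
  show ?thesis
    unfolding eqA eqB Sup_enat_eq_iff[OF An] Sup_enat_eq_iff[OF Bn]
  proof
    assume r: "regseq P S0 xs"
    then have "?r \<in> ?B" using P(2) by blast
    moreover have "?r \<in> ?A"
    proof -
      obtain n where n: "n \<in> ?A" "n \<ge> ?r" using B[OF P(2) r] by blast
      then have "n = ?r" using A[OF n(1)] by simp
      then show ?thesis using n(1) by simp
    qed
    moreover have "n \<le> ?r" if n: "n \<in> ?B" for n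
    proof -
      from n obtain ys where ys: "set ys \<subseteq> P" "regseq P S0 ys" "n = length ys" by blast
      obtain m where m: "m \<in> ?A" "m \<ge> length ys" using B[OF ys(1,2)] by blast
      show ?thesis using A[OF m(1)] m(2) ys(3) by simp
    qed
    ultimately show "(?r \<in> ?A \<and> (\<forall>n\<in>?A. n \<le> ?r)) \<and> ?r \<in> ?B \<and> (\<forall>n\<in>?B. n \<le> ?r)" using A by blast
  next
    assume "(?r \<in> ?A \<and> (\<forall>n\<in>?A. n \<le> ?r)) \<and> ?r \<in> ?B \<and> (\<forall>n\<in>?B. n \<le> ?r)"
    then obtain ys where ys: "set ys \<subseteq> P" "regseq P S0 ys" "length ys = ?r" by auto
    show "regseq P S0 xs"
    proof (rule regseq_of_parameters[OF submodule_zeroset prP ys P(2)])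
      fix Q assume Q: "Q \<in> supp S0" "Q \<subseteq> P" "set xs \<subseteq> Q"
      obtain n where n: "prime_chain R n Q P" "Q \<noteq> P \<longrightarrow> n = 1"
        using prime_chain_step[OF supp_prime[OF Q(1)] prP Q(2)] by blast
      \<comment> \<open>A prime \<open>Q\<close> strictly below \<open>P\<close> and containing
        \<open>xs\<close> would give a chain to \<open>\<mm>\<close> one step longer than the
        parameter bound permits.\<close>
      have "n + (d - ?r) + ?r \<le> d"
        using params_bound[OF p Q(1,3) prime_chain_trans[OF n(1) cP]] .
      then show "Q = P" using n(2) len by auto
    qed
  qed
qed

end

section \<open>Localization\<close>

locale mult_set = module R M for R (structure) and M (structure) +
  fixes S
  assumes S_carr: "S \<subseteq> carrier R" and S_one: "\<one> \<in> S" and S_mult: "s \<in> S \<Longrightarrow> t \<in> S \<Longrightarrow> s \<otimes> t \<in> S"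
begin

lemma S_in [simp]: "s \<in> S \<Longrightarrow> s \<in> carrier R"
  using S_carr by blast

lemma frac_mem_sym:
  assumes "x \<in> carrier M" "s \<in> S" "(y, t) \<in> frac R M S x s" shows "(x, s) \<in> frac R M S y t"
  using assms by (auto simp: frac_def) metis

lemma frac_mem_trans:
  assumes "x \<in> carrier M" "s \<in> S" "(y, t) \<in> frac R M S x s" "(z, w) \<in> frac R M S y t"
  shows "(z, w) \<in> frac R M S x s"
proof -
  obtain u v where y: "y \<in> carrier M" "t \<in> S" and z: "z \<in> carrier M" "w \<in> S" and uv: "u \<in> S" "v \<in> S"
    and e: "u \<cdot> (t \<cdot> x) = u \<cdot> (s \<cdot> y)" "v \<cdot> (w \<cdot> y) = v \<cdot> (t \<cdot> z)"
    using assms by (auto simp: frac_def)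
  have "(u \<otimes> v \<otimes> t) \<cdot> (w \<cdot> x) = (v \<otimes> w) \<cdot> (u \<cdot> (t \<cdot> x))"
    using assms y z uv by (simp add: smult_assoc1[symmetric] R.m_ac)
  also have "\<dots> = (u \<otimes> s) \<cdot> (v \<cdot> (w \<cdot> y))"
    unfolding e(1) using assms y z uv by (simp add: smult_assoc1[symmetric] R.m_ac)
  also have "\<dots> = (u \<otimes> v \<otimes> t) \<cdot> (s \<cdot> z)"
    unfolding e(2) using assms y z uv by (simp add: smult_assoc1[symmetric] R.m_ac)
  finally show ?thesis using z S_mult uv y by (auto simp: frac_def)
qed

lemma frac_self: "x \<in> carrier M \<Longrightarrow> s \<in> S \<Longrightarrow> (x, s) \<in> frac R M S x s"
  using S_one by (auto simp: frac_def)

lemma frac_eqI: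
  assumes "x \<in> carrier M" "s \<in> S" "(y, t) \<in> frac R M S x s"
  shows "frac R M S y t = frac R M S x s"
proof -
  have yt: "y \<in> carrier M" "t \<in> S" using assms(3) by (auto simp: frac_def)
  have "p \<in> frac R M S y t \<longleftrightarrow> p \<in> frac R M S x s" for p
    using frac_mem_trans[OF assms, of "fst p" "snd p"]
      frac_mem_trans[OF yt frac_mem_sym[OF assms], of "fst p" "snd p"] by auto
  then show ?thesis by blast
qed

lemma frac_eq_iff:
  assumes "x \<in> carrier M" "s \<in> S" "y \<in> carrier M" "t \<in> S"
  shows "frac R M S x s = frac R M S y t \<longleftrightarrow> (\<exists>u\<in>S. u \<cdot> (t \<cdot> x) = u \<cdot> (s \<cdot> y))"
proof -
  have "frac R M S x s = frac R M S y t \<longleftrightarrow> (y, t) \<in> frac R M S x s"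
    using frac_self[OF assms(3,4)] frac_eqI[OF assms(1,2)] by auto
  then show ?thesis using assms by (simp add: frac_def)
qed

lemma frac_eqI': "\<lbrakk>x \<in> carrier M; s \<in> S; y \<in> carrier M; t \<in> S; t \<cdot> x = s \<cdot> y\<rbrakk> \<Longrightarrow>
    frac R M S x s = frac R M S y t"
  using frac_eq_iff S_one by auto

lemma loc_carrier: "carrier (loc_module R M S) = {frac R M S x s | x s. x \<in> carrier M \<and> s \<in> S}"
  by (simp add: loc_module_def)

lemma loc_zero: "\<zero>\<^bsub>loc_module R M S\<^esub> = frac R M S \<zero>\<^bsub>M\<^esub> \<one>"
  by (simp add: loc_module_def)

lemma frac_in: "x \<in> carrier M \<Longrightarrow> s \<in> S \<Longrightarrow> frac R M S x s \<in> carrier (loc_module R M S)"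
  by (auto simp: loc_carrier)

text \<open>Addition and scalar multiplication of fractions are defined as unions over all
  representatives; once the result is shown independent of them, this collapses the union.\<close>

lemma union_const2:
  assumes "(a, b) \<in> A" "(c, d) \<in> B"
    and "\<And>a' b' c' d'. (a', b') \<in> A \<Longrightarrow> (c', d') \<in> B \<Longrightarrow> f a' b' c' d' = Z"
  shows "(\<Union>(a', b')\<in>A. \<Union>(c', d')\<in>B. f a' b' c' d') = Z"
proof -
  have "(\<Union>(a', b')\<in>A. \<Union>(c', d')\<in>B. f a' b' c' d') = (\<Union>p\<in>A. \<Union>q\<in>B. Z)"
    using assms(3) by (intro SUP_cong refl) auto
  also have "\<dots> = Z" using assms(1,2) by auto
  finally show ?thesis .
qed

lemma loc_add:
  assumes "x \<in> carrier M" "s \<in> S" "y \<in> carrier M" "t \<in> S"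
  shows "frac R M S x s \<oplus>\<^bsub>loc_module R M S\<^esub> frac R M S y t
    = frac R M S (t \<cdot> x \<oplus>\<^bsub>M\<^esub> s \<cdot> y) (s \<otimes> t)"
proof -
  have "frac R M S (t' \<cdot> x' \<oplus>\<^bsub>M\<^esub> s' \<cdot> y') (s' \<otimes> t') = frac R M S (t \<cdot> x \<oplus>\<^bsub>M\<^esub> s \<cdot> y) (s \<otimes> t)"
    if h: "(x', s') \<in> frac R M S x s" "(y', t') \<in> frac R M S y t" for x' s' y' t'
  proof -
    obtain u v where c: "x' \<in> carrier M" "s' \<in> S" "y' \<in> carrier M" "t' \<in> S" "u \<in> S" "v \<in> S"
      and e: "u \<cdot> (s' \<cdot> x) = u \<cdot> (s \<cdot> x')" "v \<cdot> (t' \<cdot> y) = v \<cdot> (t \<cdot> y')"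
      using h by (auto simp: frac_def)
    have "(u \<otimes> v) \<cdot> ((s \<otimes> t) \<cdot> (t' \<cdot> x' \<oplus>\<^bsub>M\<^esub> s' \<cdot> y'))
      = (v \<otimes> t \<otimes> t') \<cdot> (u \<cdot> (s \<cdot> x')) \<oplus>\<^bsub>M\<^esub> (u \<otimes> s \<otimes> s') \<cdot> (v \<cdot> (t \<cdot> y'))"
      using assms c by (simp add: smult_r_distr smult_assoc1[symmetric] R.m_ac)
    also have "\<dots> = (u \<otimes> v) \<cdot> ((s' \<otimes> t') \<cdot> (t \<cdot> x \<oplus>\<^bsub>M\<^esub> s \<cdot> y))"
      unfolding e[symmetric] using assms c by (simp add: smult_r_distr smult_assoc1[symmetric] R.m_ac)
    finally show ?thesis using assms c S_mult by (subst frac_eq_iff) auto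
  qed
  from union_const2[OF frac_self[OF assms(1,2)] frac_self[OF assms(3,4)] this] show ?thesis
    by (simp add: loc_module_def)
qed

lemma self_mult_set: "mult_set R (self_module R) S"
  by (intro mult_set.intro mult_set_axioms.intro R.self_module_module S_carr S_one S_mult)

lemma loc_smult:
  assumes "a \<in> carrier R" "s \<in> S" "y \<in> carrier M" "t \<in> S"
  shows "frac R (self_module R) S a s \<odot>\<^bsub>loc_module R M S\<^esub> frac R M S y t = frac R M S (a \<cdot> y) (s \<otimes> t)"
proof -
  interpret A: mult_set R "self_module R" S by (rule self_mult_set)
  have "frac R M S (a' \<cdot> y') (s' \<otimes> t') = frac R M S (a \<cdot> y) (s \<otimes> t)"
    if h: "(a', s') \<in> frac R (self_module R) S a s" "(y', t') \<in> frac R M S y t" for a' s' y' t'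
  proof -
    obtain u v where c: "a' \<in> carrier R" "s' \<in> S" "y' \<in> carrier M" "t' \<in> S" "u \<in> S" "v \<in> S"
      and e: "u \<otimes> (s' \<otimes> a) = u \<otimes> (s \<otimes> a')" "v \<cdot> (t' \<cdot> y) = v \<cdot> (t \<cdot> y')"
      using h by (auto simp: frac_def)
    have "(u \<otimes> v) \<cdot> ((s \<otimes> t) \<cdot> (a' \<cdot> y')) = (u \<otimes> (s \<otimes> a')) \<cdot> (v \<cdot> (t \<cdot> y'))"
      using assms c by (simp add: smult_assoc1[symmetric] R.m_ac)
    also have "\<dots> = (u \<otimes> v) \<cdot> ((s' \<otimes> t') \<cdot> (a \<cdot> y))"
      unfolding e[symmetric] using assms c by (simp add: smult_assoc1[symmetric] R.m_ac)
    finally show ?thesis using assms c S_mult by (subst frac_eq_iff) auto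
  qed
  from union_const2[OF A.frac_self[of a s, simplified, OF assms(1,2)] frac_self[OF assms(3,4)] this] show ?thesis
    by (simp add: loc_module_def)
qed

lemma loc_abelian_group: "abelian_group (loc_module R M S)"
proof (rule abelian_groupI)
  let ?L = "loc_module R M S"
  have rep: "(\<And>y s. y \<in> carrier M \<Longrightarrow> s \<in> S \<Longrightarrow> x = frac R M S y s \<Longrightarrow> thesis) \<Longrightarrow> thesis"
    if "x \<in> carrier ?L" for x thesis using that by (auto simp: loc_carrier)
  fix x assume "x \<in> carrier ?L"
  then obtain a s where a: "a \<in> carrier M" "s \<in> S" "x = frac R M S a s" by (rule rep)
  show "\<zero>\<^bsub>?L\<^esub> \<oplus>\<^bsub>?L\<^esub> x = x"
    using a S_one by (simp add: loc_zero loc_add)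
  have "frac R M S (\<ominus>\<^bsub>M\<^esub> a) s \<oplus>\<^bsub>?L\<^esub> x = \<zero>\<^bsub>?L\<^esub>"
  proof -
    have "frac R M S (\<ominus>\<^bsub>M\<^esub> a) s \<oplus>\<^bsub>?L\<^esub> x = frac R M S \<zero>\<^bsub>M\<^esub> (s \<otimes> s)"
      using a by (simp add: loc_add smult_r_minus M.l_neg)
    also have "\<dots> = \<zero>\<^bsub>?L\<^esub>" unfolding loc_zero by (rule frac_eqI') (use a S_one S_mult in simp_all)
    finally show ?thesis .
  qed
  then show "\<exists>y\<in>carrier ?L. y \<oplus>\<^bsub>?L\<^esub> x = \<zero>\<^bsub>?L\<^esub>" using a frac_in[of "\<ominus>\<^bsub>M\<^esub> a" s] by blast
  fix y assume "y \<in> carrier ?L"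
  then obtain b t where b: "b \<in> carrier M" "t \<in> S" "y = frac R M S b t" by (rule rep)
  show "x \<oplus>\<^bsub>?L\<^esub> y \<in> carrier ?L" using a b S_mult by (simp add: loc_add frac_in)
  show "x \<oplus>\<^bsub>?L\<^esub> y = y \<oplus>\<^bsub>?L\<^esub> x"
    using a b by (simp add: loc_add M.a_comm[of "t \<cdot> a"] R.m_comm[of s])
  fix z assume "z \<in> carrier ?L"
  then obtain c u where c: "c \<in> carrier M" "u \<in> S" "z = frac R M S c u" by (rule rep)
  show "(x \<oplus>\<^bsub>?L\<^esub> y) \<oplus>\<^bsub>?L\<^esub> z = x \<oplus>\<^bsub>?L\<^esub> (y \<oplus>\<^bsub>?L\<^esub> z)"
    using a b c S_mult by (simp add: loc_add smult_r_distr smult_assoc1[symmetric] M.a_assoc R.m_ac)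
next
  show "\<zero>\<^bsub>loc_module R M S\<^esub> \<in> carrier (loc_module R M S)"
    using S_one by (simp add: loc_zero frac_in)
qed

abbreviation "RS \<equiv> loc_ring R S"
abbreviation "LM \<equiv> loc_module R M S"
abbreviation "rf \<equiv> frac R (self_module R) S"
abbreviation "mf \<equiv> frac R M S"

lemma loc_ring_simps:
  "carrier RS = {rf a s | a s. a \<in> carrier R \<and> s \<in> S}" "\<one>\<^bsub>RS\<^esub> = rf \<one> \<one>" "\<zero>\<^bsub>RS\<^esub> = rf \<zero> \<one>"
  by (simp_all add: loc_ring_def Let_def loc_module_def)

lemma loc_ring_ops:
  assumes "a \<in> carrier R" "s \<in> S" "b \<in> carrier R" "t \<in> S"
  shows "rf a s \<oplus>\<^bsub>RS\<^esub> rf b t = rf (t \<otimes> a \<oplus> s \<otimes> b) (s \<otimes> t)"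
    "rf a s \<otimes>\<^bsub>RS\<^esub> rf b t = rf (a \<otimes> b) (s \<otimes> t)"
proof -
  interpret A: mult_set R "self_module R" S by (rule self_mult_set)
  show "rf a s \<oplus>\<^bsub>RS\<^esub> rf b t = rf (t \<otimes> a \<oplus> s \<otimes> b) (s \<otimes> t)"
    using A.loc_add[of a s b t] assms by (simp add: loc_ring_def Let_def)
  show "rf a s \<otimes>\<^bsub>RS\<^esub> rf b t = rf (a \<otimes> b) (s \<otimes> t)"
    using A.loc_smult[of a s b t] assms by (simp add: loc_ring_def Let_def)
qed

lemma rf_in: "a \<in> carrier R \<Longrightarrow> s \<in> S \<Longrightarrow> rf a s \<in> carrier RS"
  by (auto simp: loc_ring_simps)

lemma rf_eq_iff:
  "\<lbrakk>a \<in> carrier R; s \<in> S; b \<in> carrier R; t \<in> S\<rbrakk> \<Longrightarrow>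
    rf a s = rf b t \<longleftrightarrow> (\<exists>u\<in>S. u \<otimes> (t \<otimes> a) = u \<otimes> (s \<otimes> b))"
  using mult_set.frac_eq_iff[OF self_mult_set, of a s b t] by simp

lemma loc_ring_cring: "cring RS"
proof -
  interpret A: mult_set R "self_module R" S by (rule self_mult_set)
  interpret L: abelian_group "loc_module R (self_module R) S" by (rule A.loc_abelian_group)
  have s: "carrier RS = carrier (loc_module R (self_module R) S)" "add RS = add (loc_module R (self_module R) S)"
    "zero RS = zero (loc_module R (self_module R) S)" by (simp_all add: loc_ring_def Let_def)
  have rep: "(\<And>y s. y \<in> carrier R \<Longrightarrow> s \<in> S \<Longrightarrow> x = rf y s \<Longrightarrow> thesis) \<Longrightarrow> thesis"
    if "x \<in> carrier RS" for x thesis using that by (auto simp: loc_ring_simps)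
  show ?thesis
  proof (rule cringI)
    show "abelian_group RS"
    proof (rule abelian_groupI)
      show "\<exists>y\<in>carrier RS. y \<oplus>\<^bsub>RS\<^esub> x = \<zero>\<^bsub>RS\<^esub>" if "x \<in> carrier RS" for x
        using that L.l_neg L.a_inv_closed unfolding s by blast
    qed (simp_all add: s L.a_ac)
    show "Group.comm_monoid RS"
    proof (rule comm_monoidI)
      show "\<one>\<^bsub>RS\<^esub> \<in> carrier RS" using rf_in S_one by (simp add: loc_ring_simps(2))
      fix x assume "x \<in> carrier RS"
      then obtain a p where a: "a \<in> carrier R" "p \<in> S" "x = rf a p" by (rule rep)
      show "\<one>\<^bsub>RS\<^esub> \<otimes>\<^bsub>RS\<^esub> x = x" using a S_one by (simp add: loc_ring_simps(2) loc_ring_ops)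
      fix y assume "y \<in> carrier RS"
      then obtain b q where b: "b \<in> carrier R" "q \<in> S" "y = rf b q" by (rule rep)
      show "x \<otimes>\<^bsub>RS\<^esub> y \<in> carrier RS" using a b rf_in S_mult by (simp add: loc_ring_ops)
      show "x \<otimes>\<^bsub>RS\<^esub> y = y \<otimes>\<^bsub>RS\<^esub> x" using a b by (simp add: loc_ring_ops R.m_comm)
      fix z assume "z \<in> carrier RS"
      then obtain c r where c: "c \<in> carrier R" "r \<in> S" "z = rf c r" by (rule rep)
      show "(x \<otimes>\<^bsub>RS\<^esub> y) \<otimes>\<^bsub>RS\<^esub> z = x \<otimes>\<^bsub>RS\<^esub> (y \<otimes>\<^bsub>RS\<^esub> z)"
        using a b c S_mult by (simp add: loc_ring_ops R.m_assoc)
    qed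
    fix x y z assume "x \<in> carrier RS" "y \<in> carrier RS" "z \<in> carrier RS"
    then obtain a p b q c r where a: "a \<in> carrier R" "p \<in> S" "x = rf a p"
      and b: "b \<in> carrier R" "q \<in> S" "y = rf b q" and c: "c \<in> carrier R" "r \<in> S" "z = rf c r"
      by (metis rep)
    have "p \<otimes> r \<otimes> (q \<otimes> r) \<otimes> ((q \<otimes> a \<oplus> p \<otimes> b) \<otimes> c)
        = p \<otimes> q \<otimes> r \<otimes> (q \<otimes> r \<otimes> (a \<otimes> c) \<oplus> p \<otimes> r \<otimes> (b \<otimes> c))"
      using a b c by (simp add: R.l_distr R.r_distr R.m_ac)
    then have "rf ((q \<otimes> a \<oplus> p \<otimes> b) \<otimes> c) (p \<otimes> q \<otimes> r)
        = rf (q \<otimes> r \<otimes> (a \<otimes> c) \<oplus> p \<otimes> r \<otimes> (b \<otimes> c)) (p \<otimes> r \<otimes> (q \<otimes> r))"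
      using a b c S_mult by (intro A.frac_eqI') simp_all
    then show "(x \<oplus>\<^bsub>RS\<^esub> y) \<otimes>\<^bsub>RS\<^esub> z = x \<otimes>\<^bsub>RS\<^esub> z \<oplus>\<^bsub>RS\<^esub> y \<otimes>\<^bsub>RS\<^esub> z"
      using a b c S_mult by (simp add: loc_ring_ops)
  qed
qed

lemma loc_module_module: "module RS LM"
proof (rule moduleI)
  have repR: "(\<And>y s. y \<in> carrier R \<Longrightarrow> s \<in> S \<Longrightarrow> x = rf y s \<Longrightarrow> thesis) \<Longrightarrow> thesis"
    if "x \<in> carrier RS" for x thesis using that by (auto simp: loc_ring_simps)
  have rep: "(\<And>y s. y \<in> carrier M \<Longrightarrow> s \<in> S \<Longrightarrow> x = mf y s \<Longrightarrow> thesis) \<Longrightarrow> thesis"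
    if "x \<in> carrier LM" for x thesis using that by (auto simp: loc_carrier)
  show "cring RS" "abelian_group LM" by (rule loc_ring_cring loc_abelian_group)+
  fix x assume "x \<in> carrier LM"
  then obtain u s where u: "u \<in> carrier M" "s \<in> S" "x = mf u s" by (rule rep)
  show "\<one>\<^bsub>RS\<^esub> \<odot>\<^bsub>LM\<^esub> x = x" using u S_one by (simp add: loc_ring_simps(2) loc_smult)
  fix a assume "a \<in> carrier RS"
  then obtain k p where a: "k \<in> carrier R" "p \<in> S" "a = rf k p" by (rule repR)
  show "a \<odot>\<^bsub>LM\<^esub> x \<in> carrier LM" using u a S_mult by (simp add: loc_smult frac_in)
  show "a \<odot>\<^bsub>LM\<^esub> (x \<oplus>\<^bsub>LM\<^esub> y) = a \<odot>\<^bsub>LM\<^esub> x \<oplus>\<^bsub>LM\<^esub> a \<odot>\<^bsub>LM\<^esub> y" if y: "y \<in> carrier LM" for y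
  proof -
    from y obtain v t where v: "v \<in> carrier M" "t \<in> S" "y = mf v t" by (rule rep)
    have "(p \<otimes> s \<otimes> (p \<otimes> t)) \<cdot> (k \<cdot> (t \<cdot> u \<oplus>\<^bsub>M\<^esub> s \<cdot> v))
      = (p \<otimes> (s \<otimes> t)) \<cdot> ((p \<otimes> t) \<cdot> (k \<cdot> u) \<oplus>\<^bsub>M\<^esub> (p \<otimes> s) \<cdot> (k \<cdot> v))"
      using u v a by (simp add: smult_r_distr smult_assoc1[symmetric] R.m_ac)
    then have "mf (k \<cdot> (t \<cdot> u \<oplus>\<^bsub>M\<^esub> s \<cdot> v)) (p \<otimes> (s \<otimes> t))
      = mf ((p \<otimes> t) \<cdot> (k \<cdot> u) \<oplus>\<^bsub>M\<^esub> (p \<otimes> s) \<cdot> (k \<cdot> v)) (p \<otimes> s \<otimes> (p \<otimes> t))"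
      using u v a S_mult by (intro frac_eqI') simp_all
    then show ?thesis using u v a S_mult by (simp add: loc_smult loc_add)
  qed
  fix b assume "b \<in> carrier RS"
  then obtain l q where b: "l \<in> carrier R" "q \<in> S" "b = rf l q" by (rule repR)
  show "(a \<otimes>\<^bsub>RS\<^esub> b) \<odot>\<^bsub>LM\<^esub> x = a \<odot>\<^bsub>LM\<^esub> (b \<odot>\<^bsub>LM\<^esub> x)"
    using u a b S_mult by (simp add: loc_smult loc_ring_ops smult_assoc1 R.m_assoc)
  have "(p \<otimes> s \<otimes> (q \<otimes> s)) \<cdot> ((q \<otimes> k \<oplus> p \<otimes> l) \<cdot> u)
    = (p \<otimes> q \<otimes> s) \<cdot> ((q \<otimes> s) \<cdot> (k \<cdot> u) \<oplus>\<^bsub>M\<^esub> (p \<otimes> s) \<cdot> (l \<cdot> u))"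
    using u a b by (simp add: smult_l_distr smult_r_distr smult_assoc1[symmetric] R.m_ac R.r_distr)
  then have "mf ((q \<otimes> k \<oplus> p \<otimes> l) \<cdot> u) (p \<otimes> q \<otimes> s)
    = mf ((q \<otimes> s) \<cdot> (k \<cdot> u) \<oplus>\<^bsub>M\<^esub> (p \<otimes> s) \<cdot> (l \<cdot> u)) (p \<otimes> s \<otimes> (q \<otimes> s))"
    using u a b S_mult by (intro frac_eqI') simp_all
  then show "(a \<oplus>\<^bsub>RS\<^esub> b) \<odot>\<^bsub>LM\<^esub> x = a \<odot>\<^bsub>LM\<^esub> x \<oplus>\<^bsub>LM\<^esub> b \<odot>\<^bsub>LM\<^esub> x"
    using u a b S_mult by (simp add: loc_smult loc_add loc_ring_ops)
qed

end

lemma prime_mult_set: "module R M \<Longrightarrow> primeideal P R \<Longrightarrow> mult_set R M (carrier R - P)"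
  using prime_compl[of P R] by (intro mult_set.intro mult_set_axioms.intro) auto

lemma (in module) Supp_eq_supp: "Supp R M = supp S0"
proof -
  have "carrier (module_at R M P) \<noteq> {\<zero>\<^bsub>module_at R M P\<^esub>} \<longleftrightarrow> \<not> carrier M \<subseteq> sat P S0"
    if P: "primeideal P R" for P
  proof -
    interpret L: mult_set R M "carrier R - P" by (rule prime_mult_set[OF module_axioms P])
    have *: "L.mf x s = \<zero>\<^bsub>L.LM\<^esub> \<longleftrightarrow> x \<in> sat P S0" if "x \<in> carrier M" "s \<in> carrier R - P" for x s
      using L.frac_eq_iff[OF that M.zero_closed L.S_one] that by (auto simp: L.loc_zero sat_def)
    have "\<zero>\<^bsub>L.LM\<^esub> \<in> carrier L.LM" unfolding L.loc_zero by (rule L.frac_in[OF M.zero_closed L.S_one])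
    then have "carrier L.LM = {\<zero>\<^bsub>L.LM\<^esub>} \<longleftrightarrow> (\<forall>w\<in>carrier L.LM. w = \<zero>\<^bsub>L.LM\<^esub>)" by blast
    also have "\<dots> \<longleftrightarrow> (\<forall>x\<in>carrier M. \<forall>s\<in>carrier R - P. L.mf x s = \<zero>\<^bsub>L.LM\<^esub>)"
      unfolding L.loc_carrier by blast
    also have "\<dots> \<longleftrightarrow> carrier M \<subseteq> sat P S0" using * L.S_one by blast
    finally show ?thesis by blast
  qed
  then show ?thesis unfolding Supp_def supp_def by blast
qed

locale noeth_module_at = noeth_module R M for R (structure) and M (structure) +
  fixes P
  assumes P: "primeideal P R"

sublocale noeth_module_at \<subseteq> mult_set R M "carrier R - P"
  by (rule prime_mult_set[OF module_axioms P])

context noeth_module_at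
begin

interpretation L: module RS LM by (rule loc_module_module)

section \<open>Submodules, regular sequences and depth of the localized module\<close>

definition locN :: "'c set \<Rightarrow> ('c \<times> 'a) set set"
  where "locN N = {mf y s | y s. y \<in> N \<and> s \<in> carrier R - P}"

text \<open>A fraction can lie in the localized submodule although its numerator is not in
  \<open>N\<close>; what counts is the saturation. This is the dictionary between \<open>M_P\<close>
  and the calculus of \<open>sat P\<close>.\<close>

lemma locN_mem:
  assumes N: "submodule N R M" and y: "y \<in> carrier M" "t \<in> carrier R - P"
  shows "mf y t \<in> locN N \<longleftrightarrow> y \<in> sat P N"
proof
  assume "mf y t \<in> locN N"
  then obtain n s where n: "n \<in> N" "s \<in> carrier R - P" "mf y t = mf n s" by (auto simp: locN_def)
  have nc: "n \<in> carrier M" using submodule_carr[OF N n(1)] .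
  obtain u where u: "u \<in> carrier R - P" "u \<cdot> (s \<cdot> y) = u \<cdot> (t \<cdot> n)"
    using frac_eq_iff[OF y nc n(2)] n(3) by blast
  have "u \<cdot> (s \<cdot> y) \<in> N" unfolding u(2) using submoduleE(4)[OF N] u(1) y n by simp
  then have "(u \<otimes> s) \<cdot> y \<in> N" using u(1) n y by (simp add: smult_assoc1)
  then show "y \<in> sat P N" using S_mult[OF u(1) n(2)] y unfolding sat_def by blast
next
  assume "y \<in> sat P N"
  then obtain s where s: "s \<in> carrier R - P" "s \<cdot> y \<in> N" by (auto simp: sat_def)
  have "mf y t = mf (s \<cdot> y) (s \<otimes> t)"
    by (rule frac_eqI') (use s y S_mult[OF s(1) y(2)] in \<open>simp_all add: smult_assoc1 smult_comm\<close>)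
  then show "mf y t \<in> locN N" using s S_mult[OF s(1) y(2)] unfolding locN_def by blast
qed

lemma locN_submodule:
  assumes N: "submodule N R M"
  shows "submodule (locN N) RS LM"
proof (rule L.submodule_of_closed)
  note Nc = submodule_carr[OF N]
  show "locN N \<subseteq> carrier LM" using Nc frac_in by (auto simp: locN_def)
  show "\<zero>\<^bsub>LM\<^esub> \<in> locN N" unfolding loc_zero locN_def using submodule_zero[OF N] S_one by blast
  show "a \<oplus>\<^bsub>LM\<^esub> b \<in> locN N" if ab: "a \<in> locN N" "b \<in> locN N" for a b
  proof -
    obtain x s y t where x: "x \<in> N" "s \<in> carrier R - P" "a = mf x s" and y: "y \<in> N" "t \<in> carrier R - P" "b = mf y t"
      using ab by (auto simp: locN_def)
    have "t \<cdot> x \<oplus>\<^bsub>M\<^esub> s \<cdot> y \<in> N" using submoduleE(4,5)[OF N] x y by simp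
    then show ?thesis
      using loc_add[OF Nc[OF x(1)] x(2) Nc[OF y(1)] y(2)] S_mult[OF x(2) y(2)] x(3) y(3)
      unfolding locN_def by blast
  qed
  show "a \<odot>\<^bsub>LM\<^esub> x \<in> locN N" if ax: "a \<in> carrier RS" "x \<in> locN N" for a x
  proof -
    obtain c s y t where c: "c \<in> carrier R" "s \<in> carrier R - P" "a = rf c s"
      and y: "y \<in> N" "t \<in> carrier R - P" "x = mf y t"
      using ax by (auto simp: locN_def loc_ring_simps(1))
    have "c \<cdot> y \<in> N" using submoduleE(4)[OF N] c y by simp
    then show ?thesis
      using loc_smult[OF c(1,2) Nc[OF y(1)] y(2)] S_mult[OF c(2) y(2)] c(3) y(3)
      unfolding locN_def by blast
  qed
qed

lemma locN_zero: "locN S0 = {\<zero>\<^bsub>LM\<^esub>}"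
proof -
  have "mf \<zero>\<^bsub>M\<^esub> s = mf \<zero>\<^bsub>M\<^esub> \<one>" if "s \<in> carrier R - P" for s
    by (rule frac_eqI') (use that S_one in simp_all)
  then show ?thesis unfolding locN_def loc_zero using S_one by blast
qed

lemma locN_addm:
  assumes N: "submodule N R M" and a: "a \<in> carrier R" "s \<in> carrier R - P"
  shows "L.addm (locN N) (rf a s) (carrier LM) = locN (addm N a (carrier M))"
proof
  note A = addm_carr[OF N a(1)]
  note B = L.addm_carr[OF locN_submodule[OF N] rf_in[OF a]]
  show "L.addm (locN N) (rf a s) (carrier LM) \<subseteq> locN (addm N a (carrier M))"
  proof (rule L.addm_least[OF locN_submodule[OF A(1)]])
    show "locN N \<subseteq> locN (addm N a (carrier M))" using A(2) by (auto simp: locN_def)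
    fix v assume "v \<in> carrier LM"
    then obtain x t where x: "x \<in> carrier M" "t \<in> carrier R - P" "v = mf x t" by (auto simp: loc_carrier)
    then have "rf a s \<odot>\<^bsub>LM\<^esub> v = mf (a \<cdot> x) (s \<otimes> t)" using loc_smult[OF a x(1,2)] by simp
    then show "rf a s \<odot>\<^bsub>LM\<^esub> v \<in> locN (addm N a (carrier M))"
      using A(3)[OF x(1)] S_mult[OF a(2) x(2)] unfolding locN_def by blast
  qed
  show "locN (addm N a (carrier M)) \<subseteq> L.addm (locN N) (rf a s) (carrier LM)"
  proof
    fix z assume "z \<in> locN (addm N a (carrier M))"
    then obtain w t v where t: "t \<in> carrier R - P" "z = mf w t" and v: "v \<in> carrier M"
      and c: "cng N w (a \<cdot> v)" by (auto simp: locN_def addm_def)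
    define n where "n = w \<ominus>\<^bsub>M\<^esub> a \<cdot> v"
    have n: "n \<in> N" "w \<in> carrier M" using c by (auto simp: cng_def n_def)
    have nc: "n \<in> carrier M" using submodule_carr[OF N n(1)] .
    have w: "w = n \<oplus>\<^bsub>M\<^esub> a \<cdot> v"
      unfolding n_def using n(2) v a by (simp add: M.minus_eq M.a_assoc M.l_neg)
    have st: "s \<otimes> t \<in> carrier R - P" using S_mult[OF a(2) t(1)] .
    \<comment> \<open>Writing \<open>w = n + av\<close>, the fraction \<open>w/t\<close> is
      \<open>n/t + (a/s)(sv/t)\<close>; the factor \<open>s\<close> in the numerator compensates the
      denominator of \<open>a/s\<close>.\<close>
    have "mf n t \<oplus>\<^bsub>LM\<^esub> rf a s \<odot>\<^bsub>LM\<^esub> mf (s \<cdot> v) t = mf n t \<oplus>\<^bsub>LM\<^esub> mf (a \<cdot> (s \<cdot> v)) (s \<otimes> t)"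
      using loc_smult[OF a _ t(1), of "s \<cdot> v"] v a by simp
    also have "\<dots> = mf ((s \<otimes> t) \<cdot> n \<oplus>\<^bsub>M\<^esub> t \<cdot> (a \<cdot> (s \<cdot> v))) (t \<otimes> (s \<otimes> t))"
      using loc_add[OF nc t(1) _ st] v a by simp
    also have "\<dots> = z"
      unfolding t(2)
    proof (rule frac_eqI')
      show "t \<otimes> (s \<otimes> t) \<in> carrier R - P" using S_mult[OF t(1) st] .
      show "t \<cdot> ((s \<otimes> t) \<cdot> n \<oplus>\<^bsub>M\<^esub> t \<cdot> (a \<cdot> (s \<cdot> v))) = (t \<otimes> (s \<otimes> t)) \<cdot> w"
        unfolding w using v a nc t by (simp add: smult_r_distr smult_assoc1[symmetric] R.m_ac)
    qed (use n nc v a t in simp_all)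
    finally have z: "z = mf n t \<oplus>\<^bsub>LM\<^esub> rf a s \<odot>\<^bsub>LM\<^esub> mf (s \<cdot> v) t" by simp
    have "mf n t \<in> locN N" using n t unfolding locN_def by blast
    moreover have "mf (s \<cdot> v) t \<in> carrier LM" using frac_in[OF _ t(1)] v a by simp
    ultimately show "z \<in> L.addm (locN N) (rf a s) (carrier LM)"
      unfolding z using L.submoduleE(5)[OF B(1)] B(2,3) by blast
  qed
qed

lemma nonzerodivisor_loc:
  assumes N: "submodule N R M" and a: "a \<in> carrier R" "s \<in> carrier R - P"
  shows "nonzerodivisor_on (quot_module RS LM (locN N)) (rf a s) \<longleftrightarrow> reg P N a"
proof -
  have *: "rf a s \<odot>\<^bsub>LM\<^esub> mf y t \<in> locN N \<longleftrightarrow> a \<cdot> y \<in> sat P N" "mf y t \<in> locN N \<longleftrightarrow> y \<in> sat P N"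
    if "y \<in> carrier M" "t \<in> carrier R - P" for y t
    using locN_mem[OF N] that loc_smult[OF a that] a S_mult[OF a(2) that(2)] by simp_all
  have "nonzerodivisor_on (quot_module RS LM (locN N)) (rf a s) \<longleftrightarrow>
      (\<forall>w\<in>carrier LM. rf a s \<odot>\<^bsub>LM\<^esub> w \<in> locN N \<longrightarrow> w \<in> locN N)"
    by (rule L.nonzerodivisor_quot[OF locN_submodule[OF N] rf_in[OF a]])
  also have "\<dots> \<longleftrightarrow> (\<forall>y\<in>carrier M. \<forall>t\<in>carrier R - P. rf a s \<odot>\<^bsub>LM\<^esub> mf y t \<in> locN N \<longrightarrow> mf y t \<in> locN N)"
    unfolding loc_carrier by blast
  also have "\<dots> \<longleftrightarrow> reg P N a" unfolding reg_def using * S_one by blast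
  finally show ?thesis .
qed

lemma locN_proper:
  assumes N: "submodule N R M" and "P \<in> supp N"
  shows "locN N \<noteq> carrier LM"
proof -
  obtain y where y: "y \<in> carrier M" "y \<notin> sat P N" using assms(2) by (auto simp: supp_def)
  then have "mf y \<one> \<notin> locN N" using locN_mem[OF N y(1) S_one] by blast
  then show ?thesis using frac_in[OF y(1) S_one] by blast
qed

text \<open>Chosen numerators for a sequence in the maximal ideal of \<open>R_P\<close>. The
  denominators are units, so regularity depends on the numerators only.\<close>

definition num_list :: "('a \<times> 'a) set list \<Rightarrow> 'a list \<Rightarrow> bool"
  where "num_list qs as \<longleftrightarrow> list_all2 (\<lambda>q a. a \<in> P \<and> (\<exists>s\<in>carrier R - P. q = rf a s)) qs as"

lemma locN_seqm:
  "num_list qs as \<Longrightarrow> submodule N R M \<Longrightarrow> L.seqm (locN N) qs = locN (seqm N as)"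
proof (induction as arbitrary: qs N)
  case (Cons a as)
  then obtain q qs' s where q: "qs = q # qs'" "num_list qs' as" "a \<in> P" "s \<in> carrier R - P" "q = rf a s"
    by (auto simp: num_list_def list_all2_Cons2)
  have aR: "a \<in> carrier R" using q prime_subset[OF P] by blast
  show ?case
    using Cons.IH[OF q(2) addm_carr(1)[OF Cons.prems(2) aR]] locN_addm[OF Cons.prems(2) aR q(4)] q by simp
qed (simp add: num_list_def)

lemma regular_sequence_loc:
  assumes n: "num_list qs as" and supp: "P \<in> supp S0"
  shows "regular_sequence RS LM qs \<longleftrightarrow> regseq P S0 as"
proof -
  have len: "length qs = length as" using n list_all2_lengthD by (auto simp: num_list_def)
  have nth: "as ! i \<in> P" "\<exists>s\<in>carrier R - P. qs ! i = rf (as ! i) s" if "i < length as" for i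
    using n that len by (auto simp: num_list_def list_all2_conv_all_nth)
  have aP: "set as \<subseteq> P" using nth(1) by (auto simp: in_set_conv_nth)
  have qR: "set qs \<subseteq> carrier RS"
  proof
    fix q assume "q \<in> set qs"
    then obtain i where i: "i < length as" "q = qs ! i" using len by (auto simp: in_set_conv_nth)
    then obtain s where "s \<in> carrier R - P" "q = rf (as ! i) s" using nth(2) by blast
    then show "q \<in> carrier RS" using rf_in nth(1)[OF i(1)] prime_subset[OF P] by blast
  qed
  have aR: "set as \<subseteq> carrier R" using aP prime_subset[OF P] by blast
  have sub: "submodule (seqm S0 (take i as)) R M" for i
    using seqm_submodule[OF submodule_zeroset] set_take_subset[of i as] aR by blast
  have eq: "quot_seq RS LM (take i qs) = quot_module RS LM (locN (seqm S0 (take i as)))" for i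
  proof -
    have t: "num_list (take i qs) (take i as)" using n by (auto simp: num_list_def)
    have "set (take i qs) \<subseteq> carrier RS" using qR set_take_subset[of i qs] by blast
    then have "ideal_smult RS LM (Idl\<^bsub>RS\<^esub> (set (take i qs))) = L.seqm (locN S0) (take i qs)"
      unfolding locN_zero by (rule L.ideal_smult_eq_seqm)
    then show ?thesis using locN_seqm[OF t submodule_zeroset] by simp
  qed
  have nz: "nonzerodivisor_on (quot_seq RS LM (take i qs)) (qs ! i) \<longleftrightarrow> reg P (seqm S0 (take i as)) (as ! i)"
    if i: "i < length qs" for i
  proof -
    obtain s where s: "s \<in> carrier R - P" "qs ! i = rf (as ! i) s"
      using n i by (auto simp: num_list_def list_all2_conv_all_nth)
    have "as ! i \<in> carrier R" using aR i len by auto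
    from nonzerodivisor_loc[OF sub this s(1), of i] show ?thesis unfolding eq s(2) .
  qed
  have "seqm S0 as = seqm S0 (take (length as) as)" by simp
  then have sub': "submodule (seqm S0 as) R M" using sub by metis
  \<comment> \<open>The numerators lie in \<open>P\<close>, so \<open>P\<close> stays in the support
    of the quotient; this settles the non-vanishing that \<open>regular_sequence\<close> requires
    and \<open>regseq\<close> omits.\<close>
  have "P \<in> supp (seqm S0 as)" using supp_seqm[OF submodule_zeroset aR] supp aP by blast
  then have "carrier (quot_seq RS LM (take (length qs) qs)) \<noteq> {\<zero>\<^bsub>quot_seq RS LM (take (length qs) qs)\<^esub>}"
    unfolding eq using L.quot_nonzero[OF locN_submodule[OF sub']] locN_proper[OF sub'] len by simp
  then show ?thesis
    unfolding regular_sequence_def regseq_iff_nth using nz qR len by simp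
qed

lemma ideal_at_eq: "ideal_at R P = {rf a s | a s. a \<in> P \<and> s \<in> carrier R - P}"
  by (simp add: ideal_at_def)

lemma depth_loc:
  assumes supp: "P \<in> supp S0"
  shows "depth RS (ideal_at R P) LM = Sup {enat (length ys) | ys. set ys \<subseteq> P \<and> regseq P S0 ys}"
proof -
  have "\<exists>ys. length ys = length qs \<and> set ys \<subseteq> P \<and> regseq P S0 ys"
    if q: "set qs \<subseteq> ideal_at R P" "regular_sequence RS LM qs" for qs
  proof -
    have "\<forall>q\<in>set qs. \<exists>a. a \<in> P \<and> (\<exists>s\<in>carrier R - P. q = rf a s)" using q(1) unfolding ideal_at_eq by blast
    then obtain f where "\<forall>q\<in>set qs. f q \<in> P \<and> (\<exists>s\<in>carrier R - P. q = rf (f q) s)" by metis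
    then have n: "num_list qs (map f qs)" "set (map f qs) \<subseteq> P"
      by (auto simp: num_list_def list_all2_conv_all_nth)
    then show ?thesis using regular_sequence_loc[OF n(1) supp] q(2) by (intro exI[of _ "map f qs"]) auto
  qed
  moreover have "\<exists>qs. length qs = length ys \<and> set qs \<subseteq> ideal_at R P \<and> regular_sequence RS LM qs"
    if y: "set ys \<subseteq> P" "regseq P S0 ys" for ys
  proof -
    let ?qs = "map (\<lambda>a. rf a \<one>) ys"
    have n: "num_list ?qs ys" using y(1) S_one by (auto simp: num_list_def list_all2_conv_all_nth)
    have "set ?qs \<subseteq> ideal_at R P" using y(1) S_one unfolding ideal_at_eq by auto
    then show ?thesis using regular_sequence_loc[OF n supp] y(2) by (intro exI[of _ ?qs]) auto
  qed
  ultimately have "{enat (length xs) | xs. set xs \<subseteq> ideal_at R P \<and> regular_sequence RS LM xs}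
      = {enat (length ys) | ys. set ys \<subseteq> P \<and> regseq P S0 ys}"
    by (smt (verit, best) Collect_cong)
  then show ?thesis by (simp add: depth_def)
qed

section \<open>Primes of the localized ring and the dimension of the localized module\<close>

lemma rf_in_ext:
  assumes Q: "primeideal Q R" "Q \<subseteq> P" and a: "a \<in> carrier R" "s \<in> carrier R - P"
  shows "rf a s \<in> {rf a s | a s. a \<in> Q \<and> s \<in> carrier R - P} \<longleftrightarrow> a \<in> Q"
proof
  assume "rf a s \<in> {rf a s | a s. a \<in> Q \<and> s \<in> carrier R - P}"
  then obtain b t where b: "b \<in> Q" "t \<in> carrier R - P" "rf a s = rf b t" by blast
  have bR: "b \<in> carrier R" using b prime_subset[OF Q(1)] by blast
  obtain u where u: "u \<in> carrier R - P" "u \<otimes> (t \<otimes> a) = u \<otimes> (s \<otimes> b)"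
    using rf_eq_iff[OF a bR b(2)] b(3) by blast
  have "u \<otimes> (s \<otimes> b) \<in> Q" using prime_absorb(2)[OF Q(1)] b(1) u(1) a by simp
  then have "u \<otimes> (t \<otimes> a) \<in> Q" using u(2) by simp
  then have "t \<otimes> a \<in> Q" using prime_mult_cancel[OF Q(1)] u(1) b(2) a Q(2) by blast
  then show "a \<in> Q" using prime_mult_cancel[OF Q(1)] b(2) a Q(2) by blast
qed (use a in blast)

lemma prime_ext:
  assumes Q: "primeideal Q R" "Q \<subseteq> P"
  shows "primeideal {rf a s | a s. a \<in> Q \<and> s \<in> carrier R - P} RS" (is "primeideal ?E RS")
proof -
  interpret A: mult_set R "self_module R" "carrier R - P" by (rule self_mult_set)
  have QR: "a \<in> carrier R" if "a \<in> Q" for a using that prime_subset[OF Q(1)] by blast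
  have sm: "x \<otimes>\<^bsub>RS\<^esub> e \<in> ?E" if x: "x \<in> carrier RS" and e: "e \<in> ?E" for x e
  proof -
    obtain c s b t where c: "c \<in> carrier R" "s \<in> carrier R - P" "x = rf c s"
      and b: "b \<in> Q" "t \<in> carrier R - P" "e = rf b t" using x e unfolding loc_ring_simps(1) by blast
    have "x \<otimes>\<^bsub>RS\<^esub> e = rf (c \<otimes> b) (s \<otimes> t)" using loc_ring_ops(2)[OF c(1,2) QR[OF b(1)] b(2)] c(3) b(3) by simp
    moreover have "c \<otimes> b \<in> Q" using prime_absorb(2)[OF Q(1) b(1) c(1)] .
    ultimately show ?thesis using S_mult[OF c(2) b(2)] by blast
  qed
  have sub: "?E \<subseteq> carrier RS" using QR rf_in by blast
  have "ideal ?E RS"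
  proof (rule idealI[OF L.R.ring_axioms])
    show "subgroup ?E (add_monoid RS)"
    proof (rule L.R.add.subgroupI)
      show "?E \<subseteq> carrier RS" by (rule sub)
      have "\<zero> \<in> Q" using Q(1) by (simp add: additive_subgroup.zero_closed ideal.axioms(1) primeideal.axioms(1))
      then show "?E \<noteq> {}" using S_one by blast
      show "\<ominus>\<^bsub>RS\<^esub> e \<in> ?E" if e: "e \<in> ?E" for e
        using sm[OF L.R.a_inv_closed[OF L.R.one_closed] e] subsetD[OF sub e] L.R.l_minus[of "\<one>\<^bsub>RS\<^esub>" e] by simp
      show "e \<oplus>\<^bsub>RS\<^esub> e' \<in> ?E" if e: "e \<in> ?E" "e' \<in> ?E" for e e'
      proof -
        obtain a s b t where a: "a \<in> Q" "s \<in> carrier R - P" "e = rf a s"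
          and b: "b \<in> Q" "t \<in> carrier R - P" "e' = rf b t" using e by blast
        have "e \<oplus>\<^bsub>RS\<^esub> e' = rf (t \<otimes> a \<oplus> s \<otimes> b) (s \<otimes> t)"
          using loc_ring_ops(1)[OF QR[OF a(1)] a(2) QR[OF b(1)] b(2)] a(3) b(3) by simp
        moreover have "t \<otimes> a \<oplus> s \<otimes> b \<in> Q"
          using prime_add[OF Q(1)] prime_absorb(2)[OF Q(1)] a b by blast
        ultimately show ?thesis using S_mult[OF a(2) b(2)] by blast
      qed
    qed
    show 1: "x \<otimes>\<^bsub>RS\<^esub> e \<in> ?E" if "e \<in> ?E" "x \<in> carrier RS" for e x using sm[OF that(2,1)] .
    show "e \<otimes>\<^bsub>RS\<^esub> x \<in> ?E" if e: "e \<in> ?E" "x \<in> carrier RS" for e x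
      using 1[OF e] L.R.m_comm[of e x] subsetD[OF sub e(1)] e(2) by simp
  qed
  then show ?thesis
  proof (rule primeidealI[OF _ loc_ring_cring])
    show "carrier RS \<noteq> ?E"
    proof
      assume "carrier RS = ?E"
      then have "rf \<one> \<one> \<in> ?E" using rf_in[OF R.one_closed S_one] by blast
      then have "\<one> \<in> Q" using rf_in_ext[OF Q R.one_closed S_one] by blast
      then show False using prime_compl(1)[OF Q(1)] by blast
    qed
    fix x y assume "x \<in> carrier RS" "y \<in> carrier RS" and xy: "x \<otimes>\<^bsub>RS\<^esub> y \<in> ?E"
    then obtain a s b t where a: "a \<in> carrier R" "s \<in> carrier R - P" "x = rf a s"
      and b: "b \<in> carrier R" "t \<in> carrier R - P" "y = rf b t" unfolding loc_ring_simps(1) by blast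
    have "rf (a \<otimes> b) (s \<otimes> t) \<in> ?E" using xy loc_ring_ops(2)[OF a(1,2) b(1,2)] a(3) b(3) by simp
    then have "a \<otimes> b \<in> Q" using rf_in_ext[OF Q R.m_closed[OF a(1) b(1)] S_mult[OF a(2) b(2)]] by blast
    then have "a \<in> Q \<or> b \<in> Q" using primeideal.I_prime[OF Q(1) a(1) b(1)] by blast
    then show "x \<in> ?E \<or> y \<in> ?E" using a b by blast
  qed
qed

lemma contraction:
  assumes q: "primeideal q RS"
  defines "Q \<equiv> {a \<in> carrier R. rf a \<one> \<in> q}"
  shows "primeideal Q R" "Q \<subseteq> P"
    "\<And>a s. a \<in> carrier R \<Longrightarrow> s \<in> carrier R - P \<Longrightarrow> rf a s \<in> q \<longleftrightarrow> a \<in> Q"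
proof -
  interpret q: primeideal q RS by fact
  interpret A: mult_set R "self_module R" "carrier R - P" by (rule self_mult_set)
  have one: "rf \<one> \<one> \<notin> q" using prime_compl(1)[OF q] by (simp add: loc_ring_simps(2))
  have prod: "rf (b \<otimes> a) \<one> = rf b \<one> \<otimes>\<^bsub>RS\<^esub> rf a \<one>" if "a \<in> carrier R" "b \<in> carrier R" for a b
    using loc_ring_ops(2)[OF that(2) S_one that(1) S_one] by simp
  have ab: "b \<otimes> a \<in> Q" if "a \<in> Q" "b \<in> carrier R" for a b
    using that prod q.I_l_closed rf_in[OF that(2) S_one] by (simp add: Q_def)
  have id: "ideal Q R"
  proof (rule idealI[OF R.ring_axioms])
    show "subgroup Q (add_monoid R)"
    proof (rule R.add.subgroupI)
      show "Q \<subseteq> carrier R" by (auto simp: Q_def)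
      have "\<zero> \<in> Q" using q.zero_closed by (simp add: Q_def loc_ring_simps(3))
      then show "Q \<noteq> {}" by blast
      show "\<ominus> a \<in> Q" if "a \<in> Q" for a
        using ab[OF that, of "\<ominus> \<one>"] that R.l_minus[of \<one> a] by (simp add: Q_def)
      show "a \<oplus> b \<in> Q" if "a \<in> Q" "b \<in> Q" for a b
        using that loc_ring_ops(1)[of a \<one> b \<one>] S_one q.a_closed[of "rf a \<one>" "rf b \<one>"] by (simp add: Q_def)
    qed
    show "b \<otimes> a \<in> Q" if "a \<in> Q" "b \<in> carrier R" for a b using ab[OF that] .
    show "a \<otimes> b \<in> Q" if h: "a \<in> Q" "b \<in> carrier R" for a b
      using ab[OF h] R.m_comm[of a b] h by (simp add: Q_def)
  qed
  show pr: "primeideal Q R"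
  proof (rule primeidealI[OF id R.is_cring])
    show "carrier R \<noteq> Q" using one R.one_closed unfolding Q_def by blast
    show "a \<in> Q \<or> b \<in> Q" if h: "a \<in> carrier R" "b \<in> carrier R" "a \<otimes> b \<in> Q" for a b
      using h prod[of b a] q.I_prime[OF rf_in[OF h(1) S_one] rf_in[OF h(2) S_one]] by (simp add: Q_def)
  qed
  have eq1: "rf s \<one> \<otimes>\<^bsub>RS\<^esub> rf a s = rf a \<one>" if "a \<in> carrier R" "s \<in> carrier R - P" for a s
  proof -
    have "rf s \<one> \<otimes>\<^bsub>RS\<^esub> rf a s = rf (s \<otimes> a) (\<one> \<otimes> s)" using loc_ring_ops(2)[of s \<one> a s] that S_one by simp
    also have "\<dots> = rf a \<one>" by (rule A.frac_eqI') (use that S_one in simp_all)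
    finally show ?thesis .
  qed
  have eq2: "rf \<one> s \<otimes>\<^bsub>RS\<^esub> rf a \<one> = rf a s" if "a \<in> carrier R" "s \<in> carrier R - P" for a s
    using loc_ring_ops(2)[of \<one> s a \<one>] that S_one by simp
  show "rf a s \<in> q \<longleftrightarrow> a \<in> Q" if a: "a \<in> carrier R" "s \<in> carrier R - P" for a s
  proof
    assume "rf a s \<in> q"
    then have "rf s \<one> \<otimes>\<^bsub>RS\<^esub> rf a s \<in> q" using q.I_l_closed rf_in[OF _ S_one] a(2) by blast
    then show "a \<in> Q" using eq1[OF a] a(1) by (simp add: Q_def)
  next
    assume "a \<in> Q"
    then have "rf \<one> s \<otimes>\<^bsub>RS\<^esub> rf a \<one> \<in> q" using q.I_l_closed rf_in[OF R.one_closed a(2)] by (simp add: Q_def)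
    then show "rf a s \<in> q" using eq2[OF a] by simp
  qed
  show "Q \<subseteq> P"
  proof
    fix a assume a: "a \<in> Q"
    show "a \<in> P"
    proof (rule ccontr)
      assume "a \<notin> P"
      then have aS: "a \<in> carrier R" "a \<in> carrier R - P" using a by (auto simp: Q_def)
      have "rf \<one> a \<otimes>\<^bsub>RS\<^esub> rf a \<one> \<in> q" using q.I_l_closed rf_in[OF R.one_closed aS(2)] a by (simp add: Q_def)
      then have "rf a a \<in> q" using eq2[OF aS] by simp
      moreover have "rf a a = rf \<one> \<one>" by (rule A.frac_eqI') (use aS S_one in simp_all)
      ultimately show False using one by simp
    qed
  qed
qed

text \<open>The annihilator of \<open>M_P\<close> is not computed; only the primes containing it are
  compared. Elements killing \<open>M\<close> give fractions killing \<open>M_P\<close>. Conversely,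
  for an element \<open>y\<close> that survives at the contraction of \<open>q\<close>, every
  fraction killing \<open>y/1\<close> has its numerator in the contraction.\<close>

lemma ann_loc_subset_iff:
  assumes q: "primeideal q RS"
  shows "annihilator RS LM \<subseteq> q \<longleftrightarrow> {a \<in> carrier R. rf a \<one> \<in> q} \<in> supp S0"
proof -
  let ?Q = "{a \<in> carrier R. rf a \<one> \<in> q}"
  note Q = contraction[OF q]
  have z: "c \<cdot> y \<in> sat P S0 \<longleftrightarrow> rf c s \<odot>\<^bsub>LM\<^esub> mf y t = \<zero>\<^bsub>LM\<^esub>"
    if "c \<in> carrier R" "s \<in> carrier R - P" "y \<in> carrier M" "t \<in> carrier R - P" for c s y t
    using locN_mem[OF submodule_zeroset, of "c \<cdot> y" "s \<otimes> t"] loc_smult[OF that] S_mult[OF that(2,4)] that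
    by (simp add: locN_zero)
  show ?thesis
  proof
    assume ann: "annihilator RS LM \<subseteq> q"
    have "{a \<in> carrier R. \<forall>z\<in>carrier M. a \<cdot> z \<in> S0} \<subseteq> ?Q"
    proof
      fix a assume a: "a \<in> {a \<in> carrier R. \<forall>z\<in>carrier M. a \<cdot> z \<in> S0}"
      have zs: "\<zero>\<^bsub>M\<^esub> \<in> sat P S0" using sat_sup[OF submodule_zeroset P] by blast
      have "rf a \<one> \<odot>\<^bsub>LM\<^esub> w = \<zero>\<^bsub>LM\<^esub>" if w: "w \<in> carrier LM" for w
      proof -
        obtain y t where y: "y \<in> carrier M" "t \<in> carrier R - P" "w = mf y t" using w unfolding loc_carrier by blast
        then show ?thesis using z[OF _ S_one y(1,2), of a] a zs by simp
      qed
      then have "rf a \<one> \<in> annihilator RS LM" using rf_in[OF _ S_one] a unfolding annihilator_def by blast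
      then show "a \<in> ?Q" using ann a by blast
    qed
    then show "?Q \<in> supp S0" using supp_iff_ann[OF submodule_zeroset Q(1)] by blast
  next
    assume "?Q \<in> supp S0"
    then obtain y where y: "y \<in> carrier M" "y \<notin> sat ?Q S0" by (auto simp: supp_def)
    show "annihilator RS LM \<subseteq> q"
    proof
      fix e assume e: "e \<in> annihilator RS LM"
      then obtain a s where a: "a \<in> carrier R" "s \<in> carrier R - P" "e = rf a s"
        unfolding annihilator_def loc_ring_simps(1) by blast
      have "e \<odot>\<^bsub>LM\<^esub> mf y \<one> = \<zero>\<^bsub>LM\<^esub>" using e frac_in[OF y(1) S_one] by (simp add: annihilator_def)
      then have "a \<cdot> y \<in> sat P S0" using z[OF a(1,2) y(1) S_one] a(3) by blast
      then have "a \<cdot> y \<in> sat ?Q S0" using sat_antimono[OF Q(2)] by blast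
      then have "a \<in> ?Q" using sat_cancel[OF Q(1) _ _ y(1)] y(2) a(1) by blast
      then show "e \<in> q" using Q(3)[OF a(1,2)] a(3) by blast
    qed
  qed
qed

text \<open>Contraction and extension match the primes of \<open>R_P\<close> over the annihilator of
  \<open>M_P\<close> with the primes inside \<open>P\<close> in the support of \<open>M\<close>,
  strictly preserving inclusions. As \<open>P\<close> is the largest of these, chains may be taken
  to end in it.\<close>

lemma module_dim_loc:
  "module_dim RS LM = Sup {enat n | n. \<exists>Q\<in>supp S0. prime_chain R n Q P}"
proof -
  let ?A = "{q. primeideal q RS \<and> annihilator RS LM \<subseteq> q}"
  let ?B = "{Q \<in> supp S0. Q \<subseteq> P}"
  let ?f = "\<lambda>q. {a \<in> carrier R. rf a \<one> \<in> q}"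
  let ?g = "\<lambda>Q. {rf a s | a s. a \<in> Q \<and> s \<in> carrier R - P}"
  have gp: "primeideal (?g Q) RS" if "Q \<in> ?B" for Q
    using prime_ext[of Q] supp_prime that by blast
  have mem: "rf a s \<in> ?g Q \<longleftrightarrow> a \<in> Q" if "Q \<in> ?B" "a \<in> carrier R" "s \<in> carrier R - P" for Q a s
    using rf_in_ext[of Q a s] supp_prime that by blast
  have fg: "?f (?g Q) = Q" if Q: "Q \<in> ?B" for Q
  proof -
    have "Q \<subseteq> carrier R" using prime_subset supp_prime Q by blast
    then show ?thesis using mem[OF Q _ S_one] by blast
  qed
  have "chain_dim ?A = chain_dim ?B"
  proof (rule chain_dim_eq[of _ ?f _ ?g])
    show "?f q \<in> ?B" if "q \<in> ?A" for q
      using that contraction(2)[of q] ann_loc_subset_iff[of q] by blast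
    show "?f p \<subset> ?f q" if h: "p \<in> ?A" "q \<in> ?A" "p \<subset> q" for p q
    proof -
      have p: "primeideal p RS" and q: "primeideal q RS" using h by auto
      obtain e where e: "e \<in> q" "e \<notin> p" using h(3) by blast
      have "e \<in> carrier RS" using prime_subset[OF q] e(1) by blast
      then obtain a s where a: "a \<in> carrier R" "s \<in> carrier R - P" "e = rf a s"
        unfolding loc_ring_simps(1) by blast
      have "a \<in> ?f q" "a \<notin> ?f p" using contraction(3)[OF p a(1,2)] contraction(3)[OF q a(1,2)] e a(3) by blast+
      then show ?thesis using h(3) by blast
    qed
    show "?g Q \<in> ?A" if Q: "Q \<in> ?B" for Q
    proof -
      have "?f (?g Q) \<in> supp S0" unfolding fg[OF Q] using Q by blast
      then have "annihilator RS LM \<subseteq> ?g Q" using ann_loc_subset_iff[OF gp[OF Q]] by blast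
      then show ?thesis using gp[OF Q] by blast
    qed
    show "?g Q \<subset> ?g Q'" if h: "Q \<in> ?B" "Q' \<in> ?B" "Q \<subset> Q'" for Q Q'
    proof -
      obtain a where a: "a \<in> Q'" "a \<notin> Q" using h(3) by blast
      have "Q' \<in> supp S0" using h(2) by blast
      then have aR: "a \<in> carrier R" using subsetD[OF prime_subset[OF supp_prime] a(1)] by blast
      have m1: "rf a \<one> \<in> ?g Q'" unfolding mem[OF h(2) aR S_one] by (rule a(1))
      have m2: "rf a \<one> \<notin> ?g Q" unfolding mem[OF h(1) aR S_one] by (rule a(2))
      have "?g Q \<subseteq> ?g Q'"
      proof
        fix e assume "e \<in> ?g Q"
        then obtain b s where b: "b \<in> Q" "s \<in> carrier R - P" "e = rf b s" by (elim CollectE exE conjE)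
        have "b \<in> Q'" using subsetD[OF psubset_imp_subset[OF h(3)] b(1)] .
        then show "e \<in> ?g Q'" using b(2) unfolding b(3) by (intro CollectI exI conjI) (rule refl)
      qed
      then show ?thesis
      proof (rule psubsetI)
        show "?g Q \<noteq> ?g Q'"
        proof
          assume "?g Q = ?g Q'"
          then have "rf a \<one> \<in> ?g Q" using m1 by (rule ssubst)
          with m2 show False by (rule notE)
        qed
      qed
    qed
  qed
  moreover have "module_dim RS LM = chain_dim ?A"
    unfolding module_dim_def using krull_dim_quot[OF loc_ring_cring L.annihilator_ideal] .
  moreover have "chain_dim ?B = Sup {enat n | n. \<exists>Q\<in>?B. prime_chain R n Q P}"
  proof (rule chain_dim_top[OF _ P])
    fix Q
    let ?I = "{a \<in> carrier R. \<forall>z\<in>carrier M. a \<cdot> z \<in> S0}"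
    have "Q \<in> supp S0 \<longleftrightarrow> primeideal Q R \<and> ?I \<subseteq> Q"
      using supp_iff_ann[OF submodule_zeroset, of Q] supp_prime[of Q] by blast
    then show "Q \<in> ?B \<longleftrightarrow> primeideal Q R \<and> ?I \<subseteq> Q \<and> Q \<subseteq> P" by blast
  qed
  moreover have "(\<exists>Q\<in>?B. prime_chain R n Q P) \<longleftrightarrow> (\<exists>Q\<in>supp S0. prime_chain R n Q P)" for n
    using prime_chain_subset by blast
  ultimately show ?thesis by simp
qed

end

section \<open>Equivalence of the four conditions\<close>

theorem theorem14:
  fixes R :: "('a, 'e) ring_scheme" and \<mm> :: "'a set"
    and M :: "('a, 'b, 'f) module_scheme"
    and xs :: "'a list" and r d :: nat
  assumes "noetherian_ring R" and "local_ring R \<mm>"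
    and "module R M" and "finitely_generated R M" and "carrier M \<noteq> {\<zero>\<^bsub>M\<^esub>}"
    and "module_dim R M = enat d"
    and "length xs = r" and "r < d"
    and "part_of_sop R \<mm> M xs"
  shows
    "(part_of_reducing_sop R \<mm> M xs \<longleftrightarrow>
        (\<forall>P \<in> Supp R M \<inter> V R (set xs). krull_dim (R Quot P) = enat (d - r) \<longrightarrow>
           module_dim (ring_at R P) (module_at R M P) = enat r \<and>
           cohen_macaulay (ring_at R P) (ideal_at R P) (module_at R M P)))
     \<and> (part_of_reducing_sop R \<mm> M xs \<longleftrightarrow>
        (\<exists>ys. length ys = r \<and> part_of_reducing_sop R \<mm> M ys \<and>
           ideal_smult R M (Idl\<^bsub>R\<^esub> (set ys)) = ideal_smult R M (Idl\<^bsub>R\<^esub> (set xs))))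
     \<and> (part_of_reducing_sop R \<mm> M xs \<longleftrightarrow>
        (\<exists>ys. length ys = r \<and> part_of_reducing_sop R \<mm> M ys \<and>
           Supp R M \<inter> V R (set xs) \<subseteq> V R (set ys)))"
proof -
  interpret N: noeth_module R M using module.finitely_generated_noeth[OF assms(3,1,4)] .
  interpret N: local_noeth_module R M \<mm>
    by (intro local_noeth_module.intro N.noeth_module_axioms assms(2))
  note dim = assms(6,5)
  have bound: "n \<le> d" if "Q \<in> N.supp N.S0" "prime_chain R n Q \<mm>" for Q n
    using that N.module_dim_eq_iff[OF assms(5)] assms(6) by blast
  let ?CM = "\<lambda>P. module_dim (ring_at R P) (module_at R M P) = enat r \<and>
    cohen_macaulay (ring_at R P) (ideal_at R P) (module_at R M P)"
  have mem: "P \<in> Supp R M \<inter> V R (set zs) \<longleftrightarrow> P \<in> N.supp N.S0 \<and> set zs \<subseteq> P" for P zs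
    using N.Supp_eq_supp N.supp_prime by (auto simp: V_def)
  have CM: "?CM P \<longleftrightarrow> N.regseq P N.S0 zs"
    if "N.params d zs" "length zs = r" "P \<in> N.supp N.S0" "set zs \<subseteq> P" "krull_dim (R Quot P) = enat (d - r)" for P zs
  proof -
    interpret Q: noeth_module_at R M P
      by (intro noeth_module_at.intro noeth_module_at_axioms.intro N.noeth_module_axioms N.supp_prime[OF that(3)])
    show ?thesis
      using N.regseq_iff_cohen_macaulay[OF that(1) _ bound that(3,4)] Q.module_dim_loc Q.depth_loc[OF that(3)] that(2,5) assms(8)
      unfolding cohen_macaulay_def by auto
  qed
  \<comment> \<open>Stated for an arbitrary part of a system of parameters, since it is needed both
    for \<open>xs\<close> and for the sequences \<open>ys\<close> of (iii) and (iv).\<close>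
  have i_iff_ii: "part_of_reducing_sop R \<mm> M zs \<longleftrightarrow>
      (\<forall>P \<in> Supp R M \<inter> V R (set zs). krull_dim (R Quot P) = enat (d - r) \<longrightarrow> ?CM P)"
    if p: "N.params d zs" and l: "length zs = r" for zs
  proof -
    have "part_of_reducing_sop R \<mm> M zs \<longleftrightarrow> N.reducing d zs"
      using N.part_of_reducing_sop_iff[OF dim, of zs] p l assms(8) by blast
    also have "\<dots> \<longleftrightarrow> (\<forall>P\<in>N.supp N.S0. set zs \<subseteq> P \<longrightarrow> krull_dim (R Quot P) = enat (d - r) \<longrightarrow> N.regseq P N.S0 zs)"
      using N.reducing_iff_regseq[OF p] l assms(8) by blast
    finally show ?thesis using CM[OF p l] mem by blast
  qed
  have px: "N.params d xs" using N.part_of_sop_iff[OF dim] assms(7-9) by simp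
  \<comment> \<open>The condition on a prime \<open>P\<close> does not mention the sequence. By the
    inclusion of supports every \<open>P\<close> to be tested for \<open>xs\<close> is among those
    already known for \<open>ys\<close>, and both sequences have length \<open>r\<close>.\<close>
  have iv_i: "part_of_reducing_sop R \<mm> M xs"
    if ys: "length ys = r" "part_of_reducing_sop R \<mm> M ys" "Supp R M \<inter> V R (set xs) \<subseteq> V R (set ys)" for ys
  proof -
    have py: "N.params d ys" using N.part_of_reducing_sop_iff[OF dim, of ys] ys(1,2) assms(8) by blast
    have "P \<in> Supp R M \<inter> V R (set ys)" if "P \<in> Supp R M \<inter> V R (set xs)" for P using that ys(3) by blast
    then show ?thesis using i_iff_ii[OF py ys(1)] i_iff_ii[OF px assms(7)] ys(2) by blast
  qed
  \<comment> \<open>Equal submodules have quotients with equal supports, and these supports are cut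
    out of that of \<open>M\<close> by the respective sequences.\<close>
  have iii_iv: "Supp R M \<inter> V R (set xs) \<subseteq> V R (set ys)"
    if ys: "length ys = r" "part_of_reducing_sop R \<mm> M ys"
      "ideal_smult R M (Idl\<^bsub>R\<^esub> (set ys)) = ideal_smult R M (Idl\<^bsub>R\<^esub> (set xs))" for ys
  proof -
    have py: "N.params d ys" using N.part_of_reducing_sop_iff[OF dim, of ys] ys(1,2) assms(8) by blast
    have m: "set xs \<subseteq> \<mm>" "set ys \<subseteq> \<mm>" using px py by (auto simp: N.params_def)
    have "N.seqm N.S0 xs = N.seqm N.S0 ys"
      using ys(3) N.ideal_smult_eq_seqm[OF N.mm_list_carr] m by simp
    then have "{Q \<in> N.supp N.S0. set xs \<subseteq> Q} = {Q \<in> N.supp N.S0. set ys \<subseteq> Q}"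
      using N.supp_seqm_S0 m by metis
    note eq = this
    show ?thesis
    proof
      fix P assume "P \<in> Supp R M \<inter> V R (set xs)"
      then have "P \<in> {Q \<in> N.supp N.S0. set xs \<subseteq> Q}" unfolding mem by simp
      then have "P \<in> N.supp N.S0 \<and> set ys \<subseteq> P" unfolding eq by simp
      then show "P \<in> V R (set ys)" unfolding mem[symmetric] by simp
    qed
  qed
  show ?thesis
  proof (intro conjI iffI)
    assume i: "part_of_reducing_sop R \<mm> M xs"
    show "\<forall>P \<in> Supp R M \<inter> V R (set xs). krull_dim (R Quot P) = enat (d - r) \<longrightarrow> ?CM P"
      using i unfolding i_iff_ii[OF px assms(7)] .
    show iii: "\<exists>ys. length ys = r \<and> part_of_reducing_sop R \<mm> M ys \<and>
        ideal_smult R M (Idl\<^bsub>R\<^esub> (set ys)) = ideal_smult R M (Idl\<^bsub>R\<^esub> (set xs))"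
      using i assms(7) by (intro exI[of _ xs] conjI refl)
    then show "\<exists>ys. length ys = r \<and> part_of_reducing_sop R \<mm> M ys \<and>
        Supp R M \<inter> V R (set xs) \<subseteq> V R (set ys)"
      using iii_iv by metis
  next
    assume "\<forall>P \<in> Supp R M \<inter> V R (set xs). krull_dim (R Quot P) = enat (d - r) \<longrightarrow> ?CM P"
    then show "part_of_reducing_sop R \<mm> M xs" unfolding i_iff_ii[OF px assms(7)] .
  next
    assume "\<exists>ys. length ys = r \<and> part_of_reducing_sop R \<mm> M ys \<and>
      ideal_smult R M (Idl\<^bsub>R\<^esub> (set ys)) = ideal_smult R M (Idl\<^bsub>R\<^esub> (set xs))"
    then obtain ys where ys: "length ys = r" "part_of_reducing_sop R \<mm> M ys"
      "ideal_smult R M (Idl\<^bsub>R\<^esub> (set ys)) = ideal_smult R M (Idl\<^bsub>R\<^esub> (set xs))" by (elim exE conjE)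
    show "part_of_reducing_sop R \<mm> M xs" by (rule iv_i[OF ys(1,2) iii_iv[OF ys]])
  next
    assume "\<exists>ys. length ys = r \<and> part_of_reducing_sop R \<mm> M ys \<and>
      Supp R M \<inter> V R (set xs) \<subseteq> V R (set ys)"
    then show "part_of_reducing_sop R \<mm> M xs" using iv_i by (elim exE conjE)
  qed
qed

end
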